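(* Let $N\ge2$ and let $\mathbf k=(k_1,\dots,k_N)$ be positive integers. For every $E\subseteq\mathcal E_N$, $$\mathcal D_{\mathbf k}(E)=\sum_{F\subseteq E}\mu_{\mathbf k}(F).$$ Equivalently, the M\"obius transform of the degree function is nonnegative: for every $F\subseteq\mathcal E_N$, $$\mu_{\mathbf k}(F)=\sum_{E\subseteq F}(-1)^{|F|-|E|}\mathcal D_{\mathbf k}(E)\ge0.$$ More generally, if $E,Q\subseteq\mathcal E_N$ and $E\cap Q=\varnothing$, then $$\Delta_Q\mathcal D_{\mathbf k}(E)=\sum_{F\subseteq\mathcal E_N,\ F\setminus E=Q}\mu_{\mathbf k}(F)\ge0.$$
   Context: Let $[N]=\{1,\dots,N\}$ and $\mathcal E_N=\{(j,i):1\le i,j\le N,\ j\ne i\}$, with $(j,i)$ written $j\to i$; $B_i(E)=\{j:j\to i\in E\}$. A balanced $\mathbf k$-factor is $a\in\mathbb Z_{\ge0}^{\mathcal E_N}$ with $\sum_{j\ne i}a_{ji}=k_i$ for all $i$ and $\sum_{i\ne j}a_{ji}=k_j$ for all $j$; $\mathfrak E_{\mathbf k}(\mathcal E_N)$ is the set of these, $\operatorname{supp}(a)=\{(j,i)\in\mathcal E_N:a_{ji}>0\}$, and $w_{\mathbf k}(a)=\prod_{i=1}^Nk_i!/\prod_{j\ne i}a_{ji}!$ (the denominator product being taken for each $i$). The exact-support coefficient is $\mu_{\mathbf k}(F)=\sum_{a\in\mathfrak E_{\mathbf k}(\mathcal E_N),\ \operatorname{supp}(a)=F}w_{\mathbf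 k}(a)$. For disjoint $E,Q\subseteq\mathcal E_N$, $\Delta_Q\mathcal D_{\mathbf k}(E)=\sum_{R\subseteq Q}(-1)^{|Q|-|R|}\mathcal D_{\mathbf k}(E\cup R)$. Algebraic degree. Player $i$ has pure strategies $S_i=\{0,\ldots,k_i\}$ and payoff table $u_i(s,\alpha)$, $s\in S_i$, $\alpha\in\prod_{q\in B_i(E)}S_q$. With $d=\sum_ik_i$ variables $x_{q,t}$ ($1\le t\le k_q$) and $x_{q,0}=1-\sum_{t\ge1}x_{q,t}$, the indifference system is $f_{i,s}(x)=\sum_\alpha(u_i(s,\alpha)-u_i(0,\alpha))\prod_{q\in B_i(E)}x_{q,\alpha_q}=0$ ($1\le i\le N$, $1\le s\le k_i$). $\mathcal D_{\mathbf k}(E)$ is the number of isolated solutions in $(\mathbb C^* )^d$, counted with multiplicity, for generic coefficients (a nonempty Zariski-open set of payoff tables). It equals $[z^{\mathbf k}]\prod_{i=1}^N\bigl(\sum_{j\in B_i(E)}z_j\bigr)^{k_i}$, the coefficient of $z_1^{k_1}\cdots z_N^{k_N}$. *)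

theory Defs
  imports
    "HOL-Analysis.Analysis"
    "HOL-Library.Poly_Mapping"
    "HOL-Library.Extended_Nat"
    "HOL-Library.Nat_Bijection"
    "HOL-Computational_Algebra.Fraction_Field"
begin

section \<open>Complex polynomials and generic properties\<close>

text \<open>
  Monomials are exponent vectors \<open>'v \<Rightarrow>\<^sub>0 nat\<close>; polynomials are finitely supported maps from
  monomials to coefficients, with the convolution product of \<^theory>\<open>HOL-Library.Poly_Mapping\<close>.
\<close>

type_synonym 'v cpoly = "('v \<Rightarrow>\<^sub>0 nat) \<Rightarrow>\<^sub>0 complex"

definition cvar :: "'v \<Rightarrow> 'v cpoly" where
  "cvar v = Poly_Mapping.single (Poly_Mapping.single v 1) 1"

definition cconst :: "complex \<Rightarrow> 'v cpoly" where
  "cconst c = Poly_Mapping.single 0 c"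

definition cpolys :: "'v set \<Rightarrow> 'v cpoly set" where
  "cpolys V = {P. \<forall>m \<in> Poly_Mapping.keys P. Poly_Mapping.keys m \<subseteq> V}"

definition cpeval :: "'v cpoly \<Rightarrow> ('v \<Rightarrow> complex) \<Rightarrow> complex" where
  "cpeval P x = (\<Sum>m \<in> Poly_Mapping.keys P. Poly_Mapping.lookup P m *
     (\<Prod>v \<in> Poly_Mapping.keys m. x v ^ Poly_Mapping.lookup m v))"

text \<open>
  The affine space with coordinates indexed by \<open>V\<close> is represented by the functions that are
  \<open>undefined\<close> outside \<open>V\<close>.
\<close>

definition affine_space :: "'v set \<Rightarrow> ('v \<Rightarrow> complex) set" where
  "affine_space V = PiE V (\<lambda>_. UNIV)"

definition torus :: "'v set \<Rightarrow> ('v \<Rightarrow> complex) set" where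
  "torus V = PiE V (\<lambda>_. - {0})"

definition zariski_open :: "'v set \<Rightarrow> ('v \<Rightarrow> complex) set \<Rightarrow> bool" where
  "zariski_open V U \<longleftrightarrow>
     (\<exists>I \<subseteq> cpolys V. U = affine_space V - {x. \<forall>P \<in> I. cpeval P x = 0})"

definition holds_generically :: "'v set \<Rightarrow> (('v \<Rightarrow> complex) \<Rightarrow> bool) \<Rightarrow> bool" where
  "holds_generically V Pr \<longleftrightarrow> (\<exists>U. zariski_open V U \<and> U \<noteq> {} \<and> (\<forall>u \<in> U. Pr u))"


section \<open>Intersection multiplicity\<close>

text \<open>
  \<open>local_ring V p\<close> is the localization of the polynomial ring in the variables \<open>V\<close> at the maximal
  ideal of the point \<open>p\<close>, inside the field of rational functions; \<open>local_ideal V p F\<close> is the ideal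
  of that ring generated by the finite set \<open>F\<close>. The linear order on the variables is needed only
  for the \<^class>\<open>idom\<close> instance of the polynomial type.
\<close>

definition local_ring :: "'v::linorder set \<Rightarrow> ('v \<Rightarrow> complex) \<Rightarrow> 'v cpoly fract set" where
  "local_ring V p = {Fract g h | g h. g \<in> cpolys V \<and> h \<in> cpolys V \<and> cpeval h p \<noteq> 0}"

definition local_ideal ::
    "'v::linorder set \<Rightarrow> ('v \<Rightarrow> complex) \<Rightarrow> 'v cpoly set \<Rightarrow> 'v cpoly fract set" where
  "local_ideal V p F = {(\<Sum>f\<in>F. r f * Fract f 1) | r. r ` F \<subseteq> local_ring V p}"

text \<open>
  The multiplicity is the complex dimension of the quotient of \<open>local_ring V p\<close> by
  \<open>local_ideal V p F\<close>, i.e. the largest size of a finite subset of the local ring whose elements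
  are linearly independent modulo the ideal (\<open>\<infinity>\<close> if there is no largest one).
\<close>

definition multiplicity_at ::
    "'v::linorder set \<Rightarrow> 'v cpoly set \<Rightarrow> ('v \<Rightarrow> complex) \<Rightarrow> enat" where
  "multiplicity_at V F p = Sup {enat (card B) | B. finite B \<and> B \<subseteq> local_ring V p \<and>
     (\<forall>c. (\<Sum>b\<in>B. Fract (cconst (c b)) 1 * b) \<in> local_ideal V p F \<longrightarrow> (\<forall>b\<in>B. c b = 0))}"

definition torus_zeros :: "'v set \<Rightarrow> 'v cpoly set \<Rightarrow> ('v \<Rightarrow> complex) set" where
  "torus_zeros V F = {x \<in> torus V. \<forall>f\<in>F. cpeval f x = 0}"

definition isolated_torus_zeros :: "'v set \<Rightarrow> 'v cpoly set \<Rightarrow> ('v \<Rightarrow> complex) set" where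
  "isolated_torus_zeros V F = {x. x isolated_in torus_zeros V F}"


section \<open>The indifference system and its algebraic degree\<close>

text \<open>A pair \<open>(j, i)\<close> is the arc from \<open>j\<close> to \<open>i\<close>.\<close>

definition arcs :: "nat \<Rightarrow> (nat \<times> nat) set" where
  "arcs N = {(j, i). j \<in> {1..N} \<and> i \<in> {1..N} \<and> j \<noteq> i}"

definition in_nbrs :: "(nat \<times> nat) set \<Rightarrow> nat \<Rightarrow> nat set" where
  "in_nbrs E i = {j. (j, i) \<in> E}"

definition profiles :: "(nat \<Rightarrow> nat) \<Rightarrow> (nat \<times> nat) set \<Rightarrow> nat \<Rightarrow> (nat \<Rightarrow> nat) set" where
  "profiles k E i = PiE (in_nbrs E i) (\<lambda>q. {0..k q})"

text \<open>The payoff \<open>u\<^sub>i(s, \<alpha>)\<close> is the coordinate \<open>u (i, s, \<alpha>)\<close>.\<close>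

type_synonym payoff_index = "nat \<times> nat \<times> (nat \<Rightarrow> nat)"

definition payoff_indices ::
    "nat \<Rightarrow> (nat \<Rightarrow> nat) \<Rightarrow> (nat \<times> nat) set \<Rightarrow> payoff_index set" where
  "payoff_indices N k E = {(i, s, \<alpha>). i \<in> {1..N} \<and> s \<in> {0..k i} \<and> \<alpha> \<in> profiles k E i}"

text \<open>
  The variable \<open>x\<^bsub>q,t\<^esub>\<close> is coded by the number \<open>prod_encode (q, t)\<close>: pairs of naturals carry no
  linear order here.
\<close>

definition strategy_vars :: "nat \<Rightarrow> (nat \<Rightarrow> nat) \<Rightarrow> nat set" where
  "strategy_vars N k = {prod_encode (q, t) | q t. q \<in> {1..N} \<and> t \<in> {1..k q}}"

definition strategy_prob :: "(nat \<Rightarrow> nat) \<Rightarrow> nat \<Rightarrow> nat \<Rightarrow> nat cpoly" where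
  "strategy_prob k q t =
     (if t = 0 then 1 - (\<Sum>r\<in>{1..k q}. cvar (prod_encode (q, r))) else cvar (prod_encode (q, t)))"

definition indifference_poly ::
    "(nat \<Rightarrow> nat) \<Rightarrow> (nat \<times> nat) set \<Rightarrow> (payoff_index \<Rightarrow> complex) \<Rightarrow> nat \<Rightarrow> nat \<Rightarrow> nat cpoly" where
  "indifference_poly k E u i s =
     (\<Sum>\<alpha> \<in> profiles k E i. cconst (u (i, s, \<alpha>) - u (i, 0, \<alpha>)) *
        (\<Prod>q \<in> in_nbrs E i. strategy_prob k q (\<alpha> q)))"

definition indifference_system ::
    "nat \<Rightarrow> (nat \<Rightarrow> nat) \<Rightarrow> (nat \<times> nat) set \<Rightarrow> (payoff_index \<Rightarrow> complex) \<Rightarrow> nat cpoly set" where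
  "indifference_system N k E u =
     {indifference_poly k E u i s | i s. i \<in> {1..N} \<and> s \<in> {1..k i}}"

text \<open>
  The generic value is unique because two nonempty Zariski-open sets of payoff tables meet.
\<close>

definition algebraic_degree :: "nat \<Rightarrow> (nat \<Rightarrow> nat) \<Rightarrow> (nat \<times> nat) set \<Rightarrow> nat" where
  "algebraic_degree N k E = (THE n. holds_generically (payoff_indices N k E) (\<lambda>u.
     let V = strategy_vars N k; F = indifference_system N k E u
     in finite (isolated_torus_zeros V F) \<and>
        (\<Sum>p \<in> isolated_torus_zeros V F. multiplicity_at V F p) = enat n))"

definition set_difference_op ::
    "((nat \<times> nat) set \<Rightarrow> real) \<Rightarrow> (nat \<times> nat) set \<Rightarrow> (nat \<times> nat) set \<Rightarrow> real" where
  "set_difference_op D Q E = (\<Sum>R \<in> Pow Q. (-1) ^ (card Q - card R) * D (E \<union> R))"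


section \<open>Balanced factors\<close>

definition balanced_factors :: "nat \<Rightarrow> (nat \<Rightarrow> nat) \<Rightarrow> (nat \<times> nat \<Rightarrow> nat) set" where
  "balanced_factors N k = {a \<in> PiE (arcs N) (\<lambda>_. UNIV).
     (\<forall>i\<in>{1..N}. (\<Sum>j\<in>{1..N} - {i}. a (j, i)) = k i) \<and>
     (\<forall>j\<in>{1..N}. (\<Sum>i\<in>{1..N} - {j}. a (j, i)) = k j)}"

definition factor_support :: "nat \<Rightarrow> (nat \<times> nat \<Rightarrow> nat) \<Rightarrow> (nat \<times> nat) set" where
  "factor_support N a = {e \<in> arcs N. a e > 0}"

definition factor_weight :: "nat \<Rightarrow> (nat \<Rightarrow> nat) \<Rightarrow> (nat \<times> nat \<Rightarrow> nat) \<Rightarrow> real" where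
  "factor_weight N k a = (\<Prod>i\<in>{1..N}. fact (k i) / (\<Prod>j\<in>{1..N} - {i}. fact (a (j, i))))"

definition exact_support_coeff :: "nat \<Rightarrow> (nat \<Rightarrow> nat) \<Rightarrow> (nat \<times> nat) set \<Rightarrow> real" where
  "exact_support_coeff N k F =
     (\<Sum>a \<in> {a \<in> balanced_factors N k. factor_support N a = F}. factor_weight N k a)"

end

theory Submission
  imports
    Defs
    "Jordan_Normal_Form.Determinant"
    "HOL-Computational_Algebra.Computational_Algebra"
begin

text \<open>
  The degree \<open>D(E)\<close> counts the ways to assign to every equation \<open>(i, s)\<close> an in-neighbour of \<open>i\<close> such
  that every player \<open>q\<close> is used \<open>k q\<close> times; sorting the assignments by the number \<open>a(j, i)\<close> of
  equations of player \<open>i\<close> assigned to \<open>j\<close> gives multinomial coefficients, hence \<open>D\<close> is the zeta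
  transform of \<open>\<mu>\<close>, and the other two identities are Moebius inversion.

  For the degree, consider payoffs for which every equation is a product of linear forms, one for
  each in-neighbour, with the forms in general position. An assignment chooses the factor of each
  equation that vanishes; the resulting zeros are nondegenerate, lie in the torus, and there are no
  others, not even at infinity. So for payoffs close to the special ones the zeros are again
  nondegenerate and correspond to the assignments. Having exactly that many torus zeros, all
  nondegenerate, is a constructible condition on the payoffs (quantifier elimination over the complex
  numbers), and a constructible condition that holds near a point holds generically. A nondegenerate
  zero has multiplicity one, since by Cramer's rule the equations generate the maximal ideal.
\<close>

section \<open>Polynomial functions and constructible conditions\<close>

text \<open>Genericity is a Zariski notion, whereas the zeros are controlled only in the Euclidean
  sense, near one payoff table. The dichotomy for constructible sets bridges the two: if regularity
  failed on a nonempty open set \<open>g \<noteq> 0\<close>, then on a line from the special table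
  into that set only finitely many points would be excluded, so irregular tables would accumulate at
  the special one. The moment curve makes general position explicit. Block q of a point is read as a
  polynomial of degree at most \<open>k q\<close>, and equation (i, s) asks the block of some
  in-neighbour of i to vanish at \<open>node (i, s)\<close>. There are as many equations as roots
  available in all blocks together, so each block receives exactly \<open>k q\<close> of them. The
  value of a block at 1 is its coordinate sum; as no node is 1, this sum is not 0 and no zero lies
  at infinity. Positive nodes give nonzero coefficients, hence torus points. Polynomial functions
  live on all functions from an index type: eliminating an unknown means updating one coordinate,
  and convergence is coordinatewise.\<close>

inductive_set polyfuns :: "(('w \<Rightarrow> complex) \<Rightarrow> complex) set" where
  const: "(\<lambda>_. c) \<in> polyfuns"
| var: "(\<lambda>e. e w) \<in> polyfuns"
| add: "f \<in> polyfuns \<Longrightarrow> g \<in> polyfuns \<Longrightarrow> (\<lambda>e. f e + g e) \<in> polyfuns"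
| mult: "f \<in> polyfuns \<Longrightarrow> g \<in> polyfuns \<Longrightarrow> (\<lambda>e. f e * g e) \<in> polyfuns"

lemma polyfuns_minus: "f \<in> polyfuns \<Longrightarrow> (\<lambda>e. - f e) \<in> polyfuns"
  using polyfuns.mult[OF polyfuns.const[of "-1"], of f] by simp

lemma polyfuns_diff: "f \<in> polyfuns \<Longrightarrow> g \<in> polyfuns \<Longrightarrow> (\<lambda>e. f e - g e) \<in> polyfuns"
  using polyfuns.add[OF _ polyfuns_minus, of f g] by simp

lemma polyfuns_sum: "(\<And>i. i \<in> I \<Longrightarrow> f i \<in> polyfuns) \<Longrightarrow> (\<lambda>e. \<Sum>i\<in>I. f i e) \<in> polyfuns"
  by (induction I rule: infinite_finite_induct) (auto intro: polyfuns.intros)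

lemma polyfuns_prod: "(\<And>i. i \<in> I \<Longrightarrow> f i \<in> polyfuns) \<Longrightarrow> (\<lambda>e. \<Prod>i\<in>I. f i e) \<in> polyfuns"
  by (induction I rule: infinite_finite_induct) (auto intro: polyfuns.intros)

lemma polyfuns_if: "(b \<Longrightarrow> f \<in> polyfuns) \<Longrightarrow> (\<not> b \<Longrightarrow> g \<in> polyfuns) \<Longrightarrow> (\<lambda>e. if b then f e else g e) \<in> polyfuns"
  by (cases b) auto

lemma polyfuns_comp:
  assumes "f \<in> polyfuns" and "\<And>w. (\<lambda>e. T e w) \<in> polyfuns"
  shows "(\<lambda>e. f (T e)) \<in> polyfuns"
  using assms(1) by induction (auto intro: polyfuns.intros assms(2))

text \<open>Coordinatewise convergence suffices over any index type, since only finitely many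
  coordinates enter a polynomial function. This is the continuity used for perturbed payoffs and for
  derivatives.\<close>

lemma polyfuns_tendsto:
  assumes "f \<in> polyfuns" and "\<And>w. ((\<lambda>n. e n w) \<longlongrightarrow> a w) F"
  shows "((\<lambda>n. f (e n)) \<longlongrightarrow> f a) F"
  using assms(1) by induction (auto intro!: tendsto_intros assms(2))

text \<open>Reduces questions of density to the finiteness of the roots of one univariate
  polynomial.\<close>

lemma polyfuns_line:
  assumes "f \<in> polyfuns"
  shows "\<exists>P. \<forall>z. poly P z = f (\<lambda>w. a w + z * b w)"
  using assms
proof induction
  case (const c) show ?case by (rule exI[of _ "[:c:]"]) simp
next
  case (var w) show ?case by (rule exI[of _ "[:a w, b w:]"]) simp
next
  case (add f g) then show ?case by (metis poly_add)
next
  case (mult f g) then show ?case by (metis poly_mult)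
qed

text \<open>Irreducibility of affine space: on the line from \<open>a\<close> to \<open>b\<close>
  the restriction of \<open>f\<close> is nonzero at 0 and that of \<open>g\<close> at 1, so the
  product of the two polynomials is not zero.\<close>

lemma polyfuns_common_nonzero:
  assumes "f \<in> polyfuns" "g \<in> polyfuns" "f a \<noteq> 0" "g b \<noteq> 0"
  obtains c where "f c \<noteq> 0" "g c \<noteq> 0"
proof -
  obtain P where P: "\<And>z. poly P z = f (\<lambda>w. a w + z * (b w - a w))"
    using polyfuns_line[OF assms(1), of a "\<lambda>w. b w - a w"] by auto
  obtain Q where Q: "\<And>z. poly Q z = g (\<lambda>w. a w + z * (b w - a w))"
    using polyfuns_line[OF assms(2), of a "\<lambda>w. b w - a w"] by auto
  have "poly P 0 \<noteq> 0" "poly Q 1 \<noteq> 0" using assms P Q by simp_all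
  then have "P * Q \<noteq> 0" by auto
  then obtain z where "poly (P * Q) z \<noteq> 0" using poly_all_0_iff_0 by blast
  then show ?thesis using P Q that[of "\<lambda>w. a w + z * (b w - a w)"] by auto
qed

text \<open>Negation occurs only in the atoms, so that inductions need not treat it; closure under
  negation is \<open>constructible_not\<close>.\<close>

inductive constructible :: "(('w \<Rightarrow> complex) \<Rightarrow> bool) \<Rightarrow> bool" where
  zero: "f \<in> polyfuns \<Longrightarrow> constructible (\<lambda>e. f e = 0)"
| nonzero: "f \<in> polyfuns \<Longrightarrow> constructible (\<lambda>e. f e \<noteq> 0)"
| conj: "constructible p \<Longrightarrow> constructible q \<Longrightarrow> constructible (\<lambda>e. p e \<and> q e)"
| disj: "constructible p \<Longrightarrow> constructible q \<Longrightarrow> constructible (\<lambda>e. p e \<or> q e)"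

lemma constructible_const: "constructible (\<lambda>_. b)"
proof (cases b)
  case True then show ?thesis using constructible.zero[OF polyfuns.const[of 0]] by simp
next
  case False then show ?thesis using constructible.nonzero[OF polyfuns.const[of 0]] by simp
qed

lemma constructible_ball: "finite I \<Longrightarrow> (\<And>i. i \<in> I \<Longrightarrow> constructible (p i)) \<Longrightarrow> constructible (\<lambda>e. \<forall>i\<in>I. p i e)"
proof (induction I rule: finite_induct)
  case empty then show ?case by (simp add: constructible_const)
next
  case (insert i I) then show ?case using constructible.conj[of "p i" "\<lambda>e. \<forall>i\<in>I. p i e"] by simp
qed

lemma constructible_bex: "finite I \<Longrightarrow> (\<And>i. i \<in> I \<Longrightarrow> constructible (p i)) \<Longrightarrow> constructible (\<lambda>e. \<exists>i\<in>I. p i e)"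
proof (induction I rule: finite_induct)
  case empty then show ?case by (simp add: constructible_const)
next
  case (insert i I) then show ?case using constructible.disj[of "p i" "\<lambda>e. \<exists>i\<in>I. p i e"] by simp
qed

lemma constructible_comp:
  assumes "constructible p" and "\<And>w. (\<lambda>e. T e w) \<in> polyfuns"
  shows "constructible (\<lambda>e. p (T e))"
  using assms(1)
proof induction
  case (zero f) show ?case using constructible.zero[OF polyfuns_comp[OF zero assms(2)]] .
next
  case (nonzero f) show ?case using constructible.nonzero[OF polyfuns_comp[OF nonzero assms(2)]] .
next
  case (conj p q) from constructible.conj[OF conj.IH] show ?case .
next
  case (disj p q) from constructible.disj[OF disj.IH] show ?case .
qed

text \<open>Because nonempty principal open sets meet, a constructible set contains one of them or
  misses one. Which of the two happens is then decided by a single point with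
  \<open>g e \<noteq> 0\<close>.\<close>

lemma constructible_dichotomy:
  assumes "constructible p"
  shows "\<exists>g\<in>polyfuns. (\<exists>e. g e \<noteq> 0) \<and> ((\<forall>e. g e \<noteq> 0 \<longrightarrow> p e) \<or> (\<forall>e. g e \<noteq> 0 \<longrightarrow> \<not> p e))"
  using assms
proof induction
  case (zero f)
  show ?case
  proof (cases "\<exists>e. f e \<noteq> 0")
    case True then show ?thesis using zero by (intro bexI[of _ f]) auto
  next
    case False then show ?thesis by (intro bexI[of _ "\<lambda>_. 1"] polyfuns.const) auto
  qed
next
  case (nonzero f)
  show ?case
  proof (cases "\<exists>e. f e \<noteq> 0")
    case True then show ?thesis using nonzero by (intro bexI[of _ f]) auto
  next
    case False then show ?thesis by (intro bexI[of _ "\<lambda>_. 1"] polyfuns.const) auto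
  qed
next
  case (conj p q)
  obtain g a where g: "g \<in> polyfuns" "g a \<noteq> 0" "(\<forall>e. g e \<noteq> 0 \<longrightarrow> p e) \<or> (\<forall>e. g e \<noteq> 0 \<longrightarrow> \<not> p e)"
    using conj.IH(1) by meson
  obtain h b where h: "h \<in> polyfuns" "h b \<noteq> 0" "(\<forall>e. h e \<noteq> 0 \<longrightarrow> q e) \<or> (\<forall>e. h e \<noteq> 0 \<longrightarrow> \<not> q e)"
    using conj.IH(2) by meson
  obtain c where c: "g c \<noteq> 0" "h c \<noteq> 0" by (rule polyfuns_common_nonzero[of g h a b, OF g(1) h(1) g(2) h(2)])
  have "g c * h c \<noteq> 0" using c by simp
  moreover have "(\<forall>e. g e * h e \<noteq> 0 \<longrightarrow> p e \<and> q e) \<or> (\<forall>e. g e * h e \<noteq> 0 \<longrightarrow> \<not> (p e \<and> q e))"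
    using g(3) h(3) by (metis mult_eq_0_iff)
  ultimately show ?case using polyfuns.mult[OF g(1) h(1)]
    by (intro bexI[of _ "\<lambda>e. g e * h e"] conjI exI[of _ c])
next
  case (disj p q)
  obtain g a where g: "g \<in> polyfuns" "g a \<noteq> 0" "(\<forall>e. g e \<noteq> 0 \<longrightarrow> p e) \<or> (\<forall>e. g e \<noteq> 0 \<longrightarrow> \<not> p e)"
    using disj.IH(1) by meson
  obtain h b where h: "h \<in> polyfuns" "h b \<noteq> 0" "(\<forall>e. h e \<noteq> 0 \<longrightarrow> q e) \<or> (\<forall>e. h e \<noteq> 0 \<longrightarrow> \<not> q e)"
    using disj.IH(2) by meson
  obtain c where c: "g c \<noteq> 0" "h c \<noteq> 0" by (rule polyfuns_common_nonzero[of g h a b, OF g(1) h(1) g(2) h(2)])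
  have "g c * h c \<noteq> 0" using c by simp
  moreover have "(\<forall>e. g e * h e \<noteq> 0 \<longrightarrow> p e \<or> q e) \<or> (\<forall>e. g e * h e \<noteq> 0 \<longrightarrow> \<not> (p e \<or> q e))"
    using g(3) h(3) by (metis mult_eq_0_iff)
  ultimately show ?case using polyfuns.mult[OF g(1) h(1)]
    by (intro bexI[of _ "\<lambda>e. g e * h e"] conjI exI[of _ c])
qed

section \<open>Univariate polynomials with parameters and elimination of quantifiers\<close>

text \<open>The bound \<open>d\<close> is formal and common to all parameters, because the true
  degree drops where a leading coefficient vanishes. The coefficient at \<open>d\<close> serves as
  the leading one, and its vanishing becomes part of the formulas.\<close>

definition polyfam :: "nat \<Rightarrow> (('w \<Rightarrow> complex) \<Rightarrow> complex poly) \<Rightarrow> bool" where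
  "polyfam d P \<longleftrightarrow> (\<forall>e. degree (P e) \<le> d) \<and> (\<forall>j. (\<lambda>e. coeff (P e) j) \<in> polyfuns)"

lemma polyfam_add: "polyfam d P \<Longrightarrow> polyfam d' Q \<Longrightarrow> polyfam (max d d') (\<lambda>e. P e + Q e)"
  unfolding polyfam_def by (auto intro!: polyfuns.add degree_add_le simp: max.coboundedI1 max.coboundedI2)

lemma polyfam_diff: "polyfam d P \<Longrightarrow> polyfam d' Q \<Longrightarrow> polyfam (max d d') (\<lambda>e. P e - Q e)"
  unfolding polyfam_def by (auto intro!: polyfuns_diff degree_diff_le simp: max.coboundedI1 max.coboundedI2)

lemma polyfam_mult: "polyfam d P \<Longrightarrow> polyfam d' Q \<Longrightarrow> polyfam (d + d') (\<lambda>e. P e * Q e)"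
  unfolding polyfam_def coeff_mult
  by (auto intro!: polyfuns_sum polyfuns.mult order_trans[OF degree_mult_le] add_mono)

lemma polyfam_power: "polyfam d P \<Longrightarrow> polyfam (m * d) (\<lambda>e. P e ^ m)"
proof (induction m)
  case 0 show ?case by (auto simp: polyfam_def coeff_1 intro: polyfuns.const)
next
  case (Suc m) then show ?case using polyfam_mult[of d P "m*d" "\<lambda>e. P e ^ m"] by simp
qed

lemma polyfam_monom: "f \<in> polyfuns \<Longrightarrow> polyfam d (\<lambda>e. monom (f e) d)"
  unfolding polyfam_def by (auto simp: degree_monom_le intro: polyfuns_if polyfuns.const)

lemma polyfam_smult: "f \<in> polyfuns \<Longrightarrow> polyfam d P \<Longrightarrow> polyfam d (\<lambda>e. Polynomial.smult (f e) (P e))"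
  unfolding polyfam_def by (auto intro: polyfuns.mult order_trans[OF degree_smult_le])

lemma polyfam_coeff: "polyfam d P \<Longrightarrow> (\<lambda>e. coeff (P e) j) \<in> polyfuns"
  by (simp add: polyfam_def)

lemma polyfam_degree_less:
  assumes "polyfam (Suc d) P" "\<And>e. coeff (P e) (Suc d) = 0"
  shows "polyfam d P"
  unfolding polyfam_def
proof (intro conjI allI degree_le impI)
  fix e i assume "d < i"
  show "coeff (P e) i = 0"
  proof (cases "i = Suc d")
    case False
    then have "degree (P e) < i" using \<open>d < i\<close> assms(1) by (auto simp: polyfam_def intro: le_less_trans)
    then show ?thesis by (rule coeff_eq_0)
  qed (simp add: assms(2))
qed (use assms(1) in \<open>simp add: polyfam_def\<close>)

lemma polyfuns_polyfam:
  assumes "f \<in> polyfuns"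
  shows "\<exists>d P. polyfam d P \<and> (\<forall>e y. poly (P e) y = f (e(v := y)))"
  using assms
proof induction
  case (const c)
  show ?case using polyfam_monom[OF polyfuns.const[of c], of 0]
    by (intro exI[of _ 0] exI[of _ "\<lambda>e. monom c 0"]) (auto simp: poly_monom)
next
  case (var w)
  show ?case
  proof (cases "w = v")
    case True
    then show ?thesis using polyfam_monom[OF polyfuns.const[of 1], of 1]
      by (intro exI[of _ 1] exI[of _ "\<lambda>e. monom 1 1"]) (auto simp: poly_monom)
  next
    case False
    then show ?thesis using polyfam_monom[OF polyfuns.var[of w], of 0]
      by (intro exI[of _ 0] exI[of _ "\<lambda>e. monom (e w) 0"]) (auto simp: poly_monom)
  qed
next
  case (add f g)
  then show ?case by (metis polyfam_add poly_add)
next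
  case (mult f g)
  then show ?case by (metis polyfam_mult poly_mult)
qed

text \<open>One step of pseudo-division: multiplying across by the two leading coefficients instead
  of dividing keeps all coefficients polynomial in the parameters.\<close>

lemma polyfam_cancel:
  assumes P: "polyfam (Suc d) P" and Q: "polyfam d' Q" and le: "d' \<le> Suc d"
  shows "polyfam d (\<lambda>e. Polynomial.smult (coeff (Q e) d') (P e) - monom (coeff (P e) (Suc d)) (Suc d - d') * Q e)"
proof (rule polyfam_degree_less)
  have "polyfam (Suc d - d' + d') (\<lambda>e. monom (coeff (P e) (Suc d)) (Suc d - d') * Q e)"
    using P Q by (intro polyfam_mult polyfam_monom polyfam_coeff)
  moreover have "polyfam (Suc d) (\<lambda>e. Polynomial.smult (coeff (Q e) d') (P e))"
    using P Q by (intro polyfam_smult polyfam_coeff)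
  ultimately show "polyfam (Suc d) (\<lambda>e. Polynomial.smult (coeff (Q e) d') (P e) - monom (coeff (P e) (Suc d)) (Suc d - d') * Q e)"
    using polyfam_diff[of "Suc d" "\<lambda>e. Polynomial.smult (coeff (Q e) d') (P e)" "Suc d"] le by simp
next
  fix e show "coeff (Polynomial.smult (coeff (Q e) d') (P e) - monom (coeff (P e) (Suc d)) (Suc d - d') * Q e) (Suc d) = 0"
    using le by (simp add: coeff_monom_mult)
qed

text \<open>Where the leading coefficient of \<open>P e\<close> is nonzero it is a unit, so a
  pseudo-division step does not change whether \<open>P e\<close> divides. Once the formal degree of
  \<open>G\<close> is below that of \<open>P\<close>, divisibility means that all coefficients of
  \<open>G e\<close> vanish.\<close>

lemma constructible_dvd:
  assumes P: "polyfam (Suc d) P" and "polyfam m G"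
  shows "constructible (\<lambda>e. coeff (P e) (Suc d) \<noteq> 0 \<and> P e dvd G e)"
  using assms(2)
proof (induction m arbitrary: G)
  case (0 G)
  have *: "P e dvd G e \<longleftrightarrow> coeff (G e) 0 = 0" if "coeff (P e) (Suc d) \<noteq> 0" for e
  proof -
    have "degree (G e) = 0" using 0 by (simp add: polyfam_def)
    then obtain c where c: "G e = [:c:]" using degree_eq_zeroE by blast
    have "degree (P e) \<ge> Suc d" using that le_degree by blast
    then show ?thesis using c dvd_imp_degree_le[of "P e" "G e"] by auto
  qed
  have "constructible (\<lambda>e. coeff (P e) (Suc d) \<noteq> 0 \<and> coeff (G e) 0 = 0)"
    using P 0 by (intro constructible.intros) (auto simp: polyfam_def)
  then show ?case by (simp add: * cong: conj_cong)
next
  case (Suc m G)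
  show ?case
  proof (cases "Suc d \<le> Suc m")
    case True
    define G' where "G' e = Polynomial.smult (coeff (P e) (Suc d)) (G e) - monom (coeff (G e) (Suc m)) (Suc m - Suc d) * P e" for e
    have "polyfam m G'" unfolding G'_def using polyfam_cancel[OF Suc.prems P True] .
    moreover have "P e dvd G' e \<longleftrightarrow> P e dvd G e" if "coeff (P e) (Suc d) \<noteq> 0" for e
      unfolding G'_def using that by (metis dvd_diff_left_iff dvd_smult_iff dvd_triv_right)
    ultimately show ?thesis using Suc.IH[of G'] by (simp cong: conj_cong)
  next
    case False
    have *: "P e dvd G e \<longleftrightarrow> (\<forall>j\<in>{..Suc m}. coeff (G e) j = 0)" if "coeff (P e) (Suc d) \<noteq> 0" for e
    proof -
      have dG: "degree (G e) \<le> Suc m" using Suc.prems by (simp add: polyfam_def)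
      have "degree (P e) \<ge> Suc d" using that le_degree by blast
      then have "P e dvd G e \<longleftrightarrow> G e = 0" using dG False
        using dvd_imp_degree_le[of "P e" "G e"] by auto
      also have "\<dots> \<longleftrightarrow> (\<forall>j\<in>{..Suc m}. coeff (G e) j = 0)" using dG
        by (metis atMost_iff coeff_0 leading_coeff_0_iff)
      finally show ?thesis .
    qed
    have "constructible (\<lambda>e. coeff (P e) (Suc d) \<noteq> 0 \<and> (\<forall>j\<in>{..Suc m}. coeff (G e) j = 0))"
      using P Suc.prems by (intro constructible.intros constructible_ball) (auto simp: polyfam_def)
    then show ?thesis by (simp add: * cong: conj_cong)
  qed
qed

lemma constructible_not: "constructible p \<Longrightarrow> constructible (\<lambda>e. \<not> p e)"
proof (induction rule: constructible.induct)
  case (conj p q) then show ?case using constructible.disj by fastforce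
next
  case (disj p q) then show ?case using constructible.conj by fastforce
qed (auto intro: constructible.intros)

text \<open>
  Pseudo-division lowers the degrees until a single polynomial \<open>P\<close> is left; it has a root outside the
  zeros of \<open>Q\<close> iff it does not divide \<open>Q ^ degree P\<close>.
\<close>

lemma constructible_common_root:
  assumes "\<forall>(d, P)\<in>set Ps. polyfam d P" and "polyfam m Q"
  shows "constructible (\<lambda>e. \<exists>y. (\<forall>(d, P)\<in>set Ps. poly (P e) y = 0) \<and> poly (Q e) y \<noteq> 0)"
  using assms(1)
\<comment> \<open>An entry counts \<open>Suc d\<close>, so that dropping a constant polynomial
  lowers the measure as well.\<close>
proof (induction "\<Sum>(d, P)\<leftarrow>Ps. Suc d" arbitrary: Ps rule: less_induct)
  case less
  define \<phi> where "\<phi> Ps e = (\<exists>y. (\<forall>(d, P)\<in>set Ps. poly (P e) y = 0) \<and> poly (Q e) y \<noteq> 0)"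
    for Ps :: "(nat \<times> (('a \<Rightarrow> complex) \<Rightarrow> complex poly)) list" and e
  have \<phi>_cong: "\<phi> ((d, P) # Ps) e \<longleftrightarrow> \<phi> ((d', P') # Ps) e" if "P e = P' e" for d P d' P' Ps e
    using that by (simp add: \<phi>_def)
  have IH: "constructible (\<phi> Ps')" if "(\<Sum>(d, P)\<leftarrow>Ps'. Suc d) < (\<Sum>(d, P)\<leftarrow>Ps. Suc d)" "\<forall>(d, P)\<in>set Ps'. polyfam d P" for Ps'
    using less.hyps[OF that] unfolding \<phi>_def .
  have zero_head: "constructible (\<phi> ((0, P) # r))" if "polyfam 0 P" "constructible (\<phi> r)" for P r
  proof -
    have "poly (P e) y = coeff (P e) 0" for e y
    proof -
      have "degree (P e) = 0" using that(1) by (simp add: polyfam_def)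
      then show ?thesis by (simp add: poly_altdef)
    qed
    then have "\<phi> ((0, P) # r) e \<longleftrightarrow> coeff (P e) 0 = 0 \<and> \<phi> r e" for e
      by (simp add: \<phi>_def)
    moreover have "constructible (\<lambda>e. coeff (P e) 0 = 0 \<and> \<phi> r e)"
      using that by (intro constructible.intros) (auto simp: polyfam_def)
    ultimately show ?thesis by presburger
  qed
  have trunc: "polyfam d (\<lambda>e. P e - monom (coeff (P e) (Suc d)) (Suc d))" if "polyfam (Suc d) P"
    for d and P :: "('a \<Rightarrow> complex) \<Rightarrow> complex poly"
  proof (rule polyfam_degree_less)
    show "polyfam (Suc d) (\<lambda>e. P e - monom (coeff (P e) (Suc d)) (Suc d))"
      using polyfam_diff[OF that polyfam_monom[OF polyfam_coeff[OF that], of "Suc d" "Suc d"]] by simp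
  qed simp
  \<comment> \<open>If a leading coefficient vanishes, the truncation replaces that polynomial. If
    neither does, the pseudo-remainder \<open>R\<close> replaces \<open>P\<close>: at a root of
    \<open>P'\<close> it is a nonzero multiple of \<open>P\<close>. The formal degree drops in all
    three cases.\<close>
  have step: "constructible (\<phi> ((Suc d, P) # (Suc d', P') # r))"
    if fam: "polyfam (Suc d) P" "polyfam (Suc d') P'" "\<forall>(d, P)\<in>set r. polyfam d P" and le: "d' \<le> d"
      and meas: "Suc (Suc d) + Suc (Suc d') + (\<Sum>(d, P)\<leftarrow>r. Suc d) \<le> (\<Sum>(d, P)\<leftarrow>Ps. Suc d)"
    for d P d' P' r
  proof -
    define T where "T e = P e - monom (coeff (P e) (Suc d)) (Suc d)" for e
    define T' where "T' e = P' e - monom (coeff (P' e) (Suc d')) (Suc d')" for e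
    define R where "R e = Polynomial.smult (coeff (P' e) (Suc d')) (P e) - monom (coeff (P e) (Suc d)) (Suc d - Suc d') * P' e" for e
    have fams: "polyfam d T" "polyfam d' T'" "polyfam d R"
      unfolding T_def T'_def R_def using trunc fam polyfam_cancel[of d P "Suc d'" P'] le by auto
    have "\<phi> ((Suc d, P) # (Suc d', P') # r) e \<longleftrightarrow>
        (coeff (P e) (Suc d) = 0 \<and> \<phi> ((d, T) # (Suc d', P') # r) e) \<or>
        (coeff (P' e) (Suc d') = 0 \<and> \<phi> ((Suc d, P) # (d', T') # r) e) \<or>
        ((coeff (P e) (Suc d) \<noteq> 0 \<and> coeff (P' e) (Suc d') \<noteq> 0) \<and> \<phi> ((d, R) # (Suc d', P') # r) e)" for e
    proof -
      have "coeff (P e) (Suc d) = 0 \<Longrightarrow> T e = P e" by (simp add: T_def)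
      moreover have "coeff (P' e) (Suc d') = 0 \<Longrightarrow> T' e = P' e" by (simp add: T'_def)
      moreover have "coeff (P' e) (Suc d') \<noteq> 0 \<Longrightarrow> poly (P' e) y = 0 \<Longrightarrow> poly (R e) y = 0 \<longleftrightarrow> poly (P e) y = 0" for y
        by (simp add: R_def)
      ultimately show ?thesis unfolding \<phi>_def
        by (cases "coeff (P e) (Suc d) = 0"; cases "coeff (P' e) (Suc d') = 0") auto
    qed
    moreover have "constructible (\<lambda>e. (coeff (P e) (Suc d) = 0 \<and> \<phi> ((d, T) # (Suc d', P') # r) e) \<or>
        (coeff (P' e) (Suc d') = 0 \<and> \<phi> ((Suc d, P) # (d', T') # r) e) \<or>
        ((coeff (P e) (Suc d) \<noteq> 0 \<and> coeff (P' e) (Suc d') \<noteq> 0) \<and> \<phi> ((d, R) # (Suc d', P') # r) e))"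
      using fam fams meas by (intro constructible.intros polyfam_coeff IH) auto
    ultimately show ?thesis by presburger
  qed
  have fam: "polyfam d P" if "(d, P) \<in> set Ps" for d P
    using less.prems that by auto
  consider "Ps = []" | P r where "Ps = (0, P) # r" | d P where "Ps = [(Suc d, P)]"
    | d P P' r where "Ps = (Suc d, P) # (0, P') # r"
    | d P d' P' r where "Ps = (Suc d, P) # (Suc d', P') # r" "d' \<le> d"
    | d P d' P' r where "Ps = (Suc d, P) # (Suc d', P') # r" "d \<le> d'"
  proof (cases Ps)
    case (Cons p r)
    obtain d P where p: "p = (d, P)" by fastforce
    show ?thesis
    proof (cases d)
      case 0 then show ?thesis using that(2) Cons p by simp
    next
      case (Suc d1)
      show ?thesis
      proof (cases r)
        case Nil then show ?thesis using that(3) Cons p Suc by simp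
      next
        case (Cons p' r')
        obtain d' P' where p': "p' = (d', P')" by fastforce
        show ?thesis
        proof (cases d')
          case 0 then show ?thesis using that(4) \<open>Ps = p # r\<close> Cons p p' Suc by simp
        next
          case (Suc d2) then show ?thesis
            using that(5,6) \<open>Ps = p # r\<close> Cons p p' \<open>d = Suc d1\<close> nat_le_linear[of d1 d2] by blast
        qed
      qed
    qed
  qed (use that(1) in simp)
  then have "constructible (\<phi> Ps)"
  proof cases
    \<comment> \<open>Without equations, a point outside the zeros of \<open>Q e\<close> exists as
      soon as \<open>Q e\<close> is not the zero polynomial.\<close>
    case 1
    have "\<phi> Ps e \<longleftrightarrow> (\<exists>j\<in>{..m}. coeff (Q e) j \<noteq> 0)" for e
    proof -
      have "degree (Q e) \<le> m" using assms(2) by (simp add: polyfam_def)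
      then have "Q e \<noteq> 0 \<longleftrightarrow> (\<exists>j\<in>{..m}. coeff (Q e) j \<noteq> 0)"
        by (metis atMost_iff coeff_0 leading_coeff_0_iff)
      then show ?thesis using 1 poly_all_0_iff_0[of "Q e"] by (auto simp: \<phi>_def)
    qed
    moreover have "constructible (\<lambda>e. \<exists>j\<in>{..m}. coeff (Q e) j \<noteq> 0)"
      using assms(2) by (intro constructible_bex constructible.nonzero polyfam_coeff) auto
    ultimately show ?thesis by presburger
  next
    case (2 P r)
    have "polyfam 0 P" by (rule fam) (simp add: 2)
    moreover have "constructible (\<phi> r)" by (rule IH) (use 2 less.prems in auto)
    ultimately show ?thesis unfolding 2 by (rule zero_head)
  next
    case (3 d P)
    define T where "T e = P e - monom (coeff (P e) (Suc d)) (Suc d)" for e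
    have P: "polyfam (Suc d) P" using fam 3 by auto
    have T: "polyfam d T" unfolding T_def using trunc[OF P] .
    \<comment> \<open>The nonvanishing condition is repeated under the negation to give exactly the
      shape of \<open>constructible_dvd\<close>. Under it \<open>Suc d\<close> is the true degree,
      as the univariate Nullstellensatz demands of the exponent.\<close>
    have "\<phi> Ps e \<longleftrightarrow> (coeff (P e) (Suc d) = 0 \<and> \<phi> [(d, T)] e) \<or>
        (coeff (P e) (Suc d) \<noteq> 0 \<and> \<not> (coeff (P e) (Suc d) \<noteq> 0 \<and> P e dvd Q e ^ Suc d))" for e
    proof (cases "coeff (P e) (Suc d) = 0")
      case True then show ?thesis by (simp add: \<phi>_def T_def 3)
    next
      case False
      moreover have "degree (P e) = Suc d" using P False unfolding polyfam_def by (metis le_antisym le_degree)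
      moreover have "P e \<noteq> 0" using False by auto
      ultimately show ?thesis using nullstellensatz_univariate[of "P e" "Q e"] by (auto simp: \<phi>_def 3)
    qed
    moreover have "constructible (\<lambda>e. (coeff (P e) (Suc d) = 0 \<and> \<phi> [(d, T)] e) \<or>
        (coeff (P e) (Suc d) \<noteq> 0 \<and> \<not> (coeff (P e) (Suc d) \<noteq> 0 \<and> P e dvd (Q e ^ Suc d))))"
    proof (intro constructible.disj constructible.conj)
      show "constructible (\<lambda>e. \<not> (coeff (P e) (Suc d) \<noteq> 0 \<and> P e dvd Q e ^ Suc d))"
        using constructible_not[OF constructible_dvd[OF P polyfam_power[OF assms(2)]]] .
    qed (use P T 3 in \<open>auto intro!: constructible.zero constructible.nonzero polyfam_coeff IH\<close>)
    ultimately show ?thesis by presburger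
  next
    case (4 d P P' r)
    have "\<phi> Ps = \<phi> ((0, P') # (Suc d, P) # r)" unfolding 4 \<phi>_def by (auto intro!: ext)
    moreover have "constructible (\<phi> ((0, P') # (Suc d, P) # r))"
      by (intro zero_head IH) (use 4 less.prems in auto)
    ultimately show ?thesis by simp
  next
    case (5 d P d' P' r)
    then show ?thesis unfolding 5 by (intro step) (use 5 less.prems in auto)
  next
    case (6 d P d' P' r)
    have "\<phi> Ps = \<phi> ((Suc d', P') # (Suc d, P) # r)" unfolding 6 \<phi>_def by (auto intro!: ext)
    moreover have "constructible (\<phi> ((Suc d', P') # (Suc d, P) # r))"
      by (intro step) (use 6 less.prems in auto)
    ultimately show ?thesis by simp
  qed
  then show ?case unfolding \<phi>_def .
qed

text \<open>A single inequation is enough, since several of them amount to one for the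
  product.\<close>

definition basic_cond :: "(('w \<Rightarrow> complex) \<Rightarrow> complex) list \<times> (('w \<Rightarrow> complex) \<Rightarrow> complex) \<Rightarrow> ('w \<Rightarrow> complex) \<Rightarrow> bool" where
  "basic_cond c e \<longleftrightarrow> (\<forall>f\<in>set (fst c). f e = 0) \<and> snd c e \<noteq> 0"

lemma constructible_dnf:
  assumes "constructible p"
  shows "\<exists>C. finite C \<and> C \<subseteq> lists polyfuns \<times> polyfuns \<and> (\<forall>e. p e \<longleftrightarrow> (\<exists>c\<in>C. basic_cond c e))"
  using assms
proof induction
  case (zero f)
  then show ?case
    by (intro exI[of _ "{([f], \<lambda>_. 1)}"]) (simp add: polyfuns.const basic_cond_def)
next
  case (nonzero f)
  then show ?case by (intro exI[of _ "{([], f)}"]) (simp add: basic_cond_def)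
next
  case (conj p q)
  obtain C where C: "finite C" "C \<subseteq> lists polyfuns \<times> polyfuns" "\<And>e. p e \<longleftrightarrow> (\<exists>c\<in>C. basic_cond c e)"
    using conj.IH(1) by blast
  obtain C' where C': "finite C'" "C' \<subseteq> lists polyfuns \<times> polyfuns" "\<And>e. q e \<longleftrightarrow> (\<exists>c\<in>C'. basic_cond c e)"
    using conj.IH(2) by blast
  define m :: "_ \<Rightarrow> (('a \<Rightarrow> complex) \<Rightarrow> complex) list \<times> (('a \<Rightarrow> complex) \<Rightarrow> complex)"
    where "m = (\<lambda>((fs, g), (fs', g')). (fs @ fs', \<lambda>e. g e * g' e))"
  have m: "basic_cond (m (c, c')) e \<longleftrightarrow> basic_cond c e \<and> basic_cond c' e" for c c' e
    by (auto simp: m_def basic_cond_def split_beta)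
  show ?case
  proof (intro exI[of _ "m ` (C \<times> C')"] conjI allI)
    show "m ` (C \<times> C') \<subseteq> lists polyfuns \<times> polyfuns"
    proof
      fix x assume "x \<in> m ` (C \<times> C')"
      then obtain c c' where x: "x = m (c, c')" "c \<in> C" "c' \<in> C'" by auto
      obtain fs g where c: "c = (fs, g)" by fastforce
      obtain fs' g' where c': "c' = (fs', g')" by fastforce
      have "(fs, g) \<in> lists polyfuns \<times> polyfuns" "(fs', g') \<in> lists polyfuns \<times> polyfuns"
        using x(2,3) C(2) C'(2) unfolding c c' by blast+
      then show "x \<in> lists polyfuns \<times> polyfuns"
        by (simp add: x(1) c c' m_def polyfuns.mult)
    qed
    show "(p e \<and> q e) \<longleftrightarrow> (\<exists>c\<in>m ` (C \<times> C'). basic_cond c e)" for e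
      unfolding C(3) C'(3) bex_simps(7) using m by fastforce
  qed (use C(1) C'(1) in simp)
next
  case (disj p q)
  obtain C where C: "finite C" "C \<subseteq> lists polyfuns \<times> polyfuns" "\<And>e. p e \<longleftrightarrow> (\<exists>c\<in>C. basic_cond c e)"
    using disj.IH(1) by blast
  obtain C' where C': "finite C'" "C' \<subseteq> lists polyfuns \<times> polyfuns" "\<And>e. q e \<longleftrightarrow> (\<exists>c\<in>C'. basic_cond c e)"
    using disj.IH(2) by blast
  show ?case
    by (intro exI[of _ "C \<union> C'"] conjI allI) (use C C' in \<open>simp_all add: bex_Un\<close>)
qed

text \<open>The existential quantifier commutes with disjunction, so the disjunctive normal form
  leaves finitely many equations and one inequation in the coordinate \<open>v\<close>, with the
  other coordinates as parameters.\<close>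

lemma constructible_ex:
  assumes "constructible p"
  shows "constructible (\<lambda>e. \<exists>y. p (e(v := y)))"
proof -
  obtain C where C: "finite C" "C \<subseteq> lists polyfuns \<times> polyfuns" "\<And>e. p e \<longleftrightarrow> (\<exists>c\<in>C. basic_cond c e)"
    using constructible_dnf[OF assms] by blast
  have "constructible (\<lambda>e. \<exists>y. basic_cond c (e(v := y)))" if "c \<in> C" for c
  proof -
    obtain fs g where c: "c = (fs, g)" by fastforce
    have "(fs, g) \<in> lists polyfuns \<times> polyfuns" using that C(2) c by blast
    then have fs: "set fs \<subseteq> polyfuns" "g \<in> polyfuns" by auto
    have "\<forall>f\<in>set fs. \<exists>dP. polyfam (fst dP) (snd dP) \<and> (\<forall>e y. poly (snd dP e) y = f (e(v := y)))"
    proof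
      fix f assume "f \<in> set fs"
      then obtain d P where "polyfam d P" "\<forall>e y. poly (P e) y = f (e(v := y))"
        using polyfuns_polyfam[of f v] fs by blast
      then show "\<exists>dP. polyfam (fst dP) (snd dP) \<and> (\<forall>e y. poly (snd dP e) y = f (e(v := y)))"
        by (intro exI[of _ "(d, P)"]) simp
    qed
    then obtain F where F: "\<And>f. f \<in> set fs \<Longrightarrow> polyfam (fst (F f)) (snd (F f))"
        "\<And>f e y. f \<in> set fs \<Longrightarrow> poly (snd (F f) e) y = f (e(v := y))"
      using bchoice[of "set fs" "\<lambda>f dP. polyfam (fst dP) (snd dP) \<and> (\<forall>e y. poly (snd dP e) y = f (e(v := y)))"]
      by blast
    obtain m Q where Q: "polyfam m Q" "\<And>e y. poly (Q e) y = g (e(v := y))"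
      using polyfuns_polyfam[of g v] fs by blast
    have "constructible (\<lambda>e. \<exists>y. (\<forall>(d, P)\<in>set (map F fs). poly (P e) y = 0) \<and> poly (Q e) y \<noteq> 0)"
      by (intro constructible_common_root) (use F Q(1) in \<open>simp_all add: split_beta\<close>)
    moreover have "(\<forall>(d, P)\<in>set (map F fs). poly (P e) y = 0) \<longleftrightarrow> (\<forall>f\<in>set fs. f (e(v := y)) = 0)" for e y
      using F(2) by (simp add: split_beta)
    ultimately show ?thesis by (simp add: Q(2) c basic_cond_def)
  qed
  then have "constructible (\<lambda>e. \<exists>c\<in>C. \<exists>y. basic_cond c (e(v := y)))"
    using C(1) by (intro constructible_bex)
  moreover have "(\<lambda>e. \<exists>c\<in>C. \<exists>y. basic_cond c (e(v := y))) = (\<lambda>e. \<exists>y. p (e(v := y)))"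
    unfolding C(3) by blast
  ultimately show ?thesis by simp
qed

lemma constructible_exs:
  assumes "finite W" "constructible p"
  shows "constructible (\<lambda>e. \<exists>e'. (\<forall>w. w \<notin> W \<longrightarrow> e' w = e w) \<and> p e')"
  using assms
proof (induction W arbitrary: p rule: finite_induct)
  case empty
  have "(\<lambda>e. \<exists>e'. (\<forall>w. w \<notin> {} \<longrightarrow> e' w = e w) \<and> p e') = p"
    by (auto intro!: ext) (metis ext)
  then show ?case using empty by simp
next
  case (insert v W)
  have "constructible (\<lambda>e. \<exists>e'. (\<forall>w. w \<notin> W \<longrightarrow> e' w = e w) \<and> (\<exists>y. p (e'(v := y))))"
    by (intro insert.IH constructible_ex insert.prems)
  moreover have "(\<exists>e'. (\<forall>w. w \<notin> W \<longrightarrow> e' w = e w) \<and> (\<exists>y. p (e'(v := y)))) \<longleftrightarrow>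
      (\<exists>e'. (\<forall>w. w \<notin> insert v W \<longrightarrow> e' w = e w) \<and> p e')" for e
  proof
    assume "\<exists>e'. (\<forall>w. w \<notin> W \<longrightarrow> e' w = e w) \<and> (\<exists>y. p (e'(v := y)))"
    then obtain e' y where "\<forall>w. w \<notin> W \<longrightarrow> e' w = e w" "p (e'(v := y))" by auto
    then show "\<exists>e'. (\<forall>w. w \<notin> insert v W \<longrightarrow> e' w = e w) \<and> p e'"
      by (intro exI[of _ "e'(v := y)"]) auto
  next
    assume "\<exists>e'. (\<forall>w. w \<notin> insert v W \<longrightarrow> e' w = e w) \<and> p e'"
    then obtain e' where e': "\<forall>w. w \<notin> insert v W \<longrightarrow> e' w = e w" "p e'" by auto
    then show "\<exists>e'. (\<forall>w. w \<notin> W \<longrightarrow> e' w = e w) \<and> (\<exists>y. p (e'(v := y)))"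
      by (intro exI[of _ "e'(v := e v)"] conjI exI[of _ "e' v"]) auto
  qed
  ultimately show ?case by simp
qed

section \<open>Determinants indexed by finite sets\<close>

definition fmat :: "nat set \<Rightarrow> (nat \<Rightarrow> nat \<Rightarrow> 'a) \<Rightarrow> 'a mat" where
  "fmat V M = mat (card V) (card V) (\<lambda>(a, b). M (sorted_list_of_set V ! a) (sorted_list_of_set V ! b))"

definition fdet :: "nat set \<Rightarrow> (nat \<Rightarrow> nat \<Rightarrow> 'a::comm_ring_1) \<Rightarrow> 'a" where
  "fdet V M = det (fmat V M)"

lemma fmat_carrier [simp]: "fmat V M \<in> carrier_mat (card V) (card V)"
  by (simp add: fmat_def)

lemma bij_betw_sorted_list:
  "finite V \<Longrightarrow> bij_betw (\<lambda>a. sorted_list_of_set V ! a) {..<card V} V"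
  using bij_betw_nth[of "sorted_list_of_set V" "{..<card V}" V] by simp

lemma sum_sorted_list:
  "finite V \<Longrightarrow> (\<Sum>a<card V. f (sorted_list_of_set V ! a)) = (\<Sum>v\<in>V. f v)"
  by (rule sum.reindex_bij_betw[OF bij_betw_sorted_list])

lemma permutes_lessThan: "p permutes {0..<n::nat} \<Longrightarrow> i < n \<Longrightarrow> p i < n"
  using permutes_in_image[of p "{0..<n}" i] by simp

lemma det_closed:
  fixes A :: "'a::comm_ring_1 mat"
  assumes A: "A \<in> carrier_mat n n" and S: "1 \<in> S" "0 \<in> S" "\<And>x y. x \<in> S \<Longrightarrow> y \<in> S \<Longrightarrow> x + y \<in> S"
      "\<And>x y. x \<in> S \<Longrightarrow> y \<in> S \<Longrightarrow> x * y \<in> S" "\<And>x. x \<in> S \<Longrightarrow> - x \<in> S"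
    and entries: "\<And>i j. i < n \<Longrightarrow> j < n \<Longrightarrow> A $$ (i, j) \<in> S"
  shows "det A \<in> S"
proof -
  have sum: "sum f I \<in> S" if "\<And>i. i \<in> I \<Longrightarrow> f i \<in> S" for f :: "(nat \<Rightarrow> nat) \<Rightarrow> 'a" and I
    using that by (induction I rule: infinite_finite_induct) (auto intro: S)
  have prod: "prod f I \<in> S" if "\<And>i. i \<in> I \<Longrightarrow> f i \<in> S" for f :: "nat \<Rightarrow> 'a" and I
    using that by (induction I rule: infinite_finite_induct) (auto intro: S)
  have "signof p \<in> S" for p :: "nat \<Rightarrow> nat"
    by (auto simp: sign_def S)
  moreover have "(\<Prod>i=0..<n. A $$ (i, p i)) \<in> S" if "p permutes {0..<n}" for p
    by (intro prod entries) (use that in \<open>auto simp: permutes_lessThan\<close>)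
  ultimately show ?thesis
    unfolding det_def'[OF A] by (intro sum S(4)) auto
qed

text \<open>Entries of the adjugate are signed minors and so stay in the subring \<open>S\<close>.
  With \<open>S = cpolys V\<close> this is Cramer's rule without denominators, for the local ring;
  with \<open>S = UNIV\<close> it yields inverses over a field.\<close>

lemma fdet_adjugate:
  fixes M :: "nat \<Rightarrow> nat \<Rightarrow> 'a::comm_ring_1"
  assumes V: "finite V" and S: "1 \<in> S" "0 \<in> S" "\<And>x y. x \<in> S \<Longrightarrow> y \<in> S \<Longrightarrow> x + y \<in> S"
      "\<And>x y. x \<in> S \<Longrightarrow> y \<in> S \<Longrightarrow> x * y \<in> S" "\<And>x. x \<in> S \<Longrightarrow> - x \<in> S"
    and entries: "\<And>v w. v \<in> V \<Longrightarrow> w \<in> V \<Longrightarrow> M v w \<in> S"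
  obtains B where "\<And>v w. v \<in> V \<Longrightarrow> w \<in> V \<Longrightarrow> B v w \<in> S"
    "\<And>v w. v \<in> V \<Longrightarrow> w \<in> V \<Longrightarrow> (\<Sum>e\<in>V. B v e * M e w) = (if v = w then fdet V M else 0)"
    "\<And>v w. v \<in> V \<Longrightarrow> w \<in> V \<Longrightarrow> (\<Sum>e\<in>V. M v e * B e w) = (if v = w then fdet V M else 0)"
proof -
  define l where "l a = sorted_list_of_set V ! a" for a
  define n where "n = card V"
  define idx where "idx = the_inv_into {..<n} l"
  have bij: "bij_betw l {..<n} V" unfolding l_def n_def by (rule bij_betw_sorted_list[OF V])
  have l: "a < n \<Longrightarrow> l a \<in> V" for a using bij by (auto simp: bij_betw_def)
  have idx: "v \<in> V \<Longrightarrow> idx v < n" "v \<in> V \<Longrightarrow> l (idx v) = v" for v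
    using bij_betw_the_inv_into[OF bij] f_the_inv_into_f_bij_betw[OF bij]
    by (auto simp: idx_def bij_betw_def)
  have idxl: "a < n \<Longrightarrow> idx (l a) = a" for a
    unfolding idx_def using bij by (simp add: the_inv_into_f_f bij_betw_def)
  define A where "A = fmat V M"
  have A: "A \<in> carrier_mat n n" by (simp add: A_def n_def)
  have Aij: "i < n \<Longrightarrow> j < n \<Longrightarrow> A $$ (i, j) = M (l i) (l j)" for i j
    by (simp add: A_def fmat_def n_def l_def)
  have adjS: "adj_mat A $$ (i, j) \<in> S" if "i < n" "j < n" for i j
  proof -
    have "det (mat_delete A j i) \<in> S"
    proof (rule det_closed[OF mat_delete_carrier[OF A] S])
      fix a b assume ab: "a < n - 1" "b < n - 1"
      then have "mat_delete A j i $$ (a, b) = A $$ (if a < j then a else Suc a, if b < i then b else Suc b)"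
        using A by (simp add: mat_delete_def)
      then show "mat_delete A j i $$ (a, b) \<in> S"
        using ab by (auto simp: Aij intro!: entries l)
    qed auto
    moreover have "(-1) ^ m \<in> S" for m by (induction m) (auto intro: S)
    ultimately show ?thesis using that A by (simp add: adj_mat_def cofactor_def S(4))
  qed
  show ?thesis
  proof (rule that[of "\<lambda>v e. adj_mat A $$ (idx v, idx e)"])
    fix v w assume vw: "v \<in> V" "w \<in> V"
    show "adj_mat A $$ (idx v, idx w) \<in> S" using vw idx by (intro adjS)
    have "(\<Sum>e\<in>V. adj_mat A $$ (idx v, idx e) * M e w)
        = (\<Sum>a<n. adj_mat A $$ (idx v, idx (l a)) * M (l a) w)"
      using sum_sorted_list[OF V, of "\<lambda>e. adj_mat A $$ (idx v, idx e) * M e w"] by (simp add: l_def n_def)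
    also have "\<dots> = (\<Sum>a<n. adj_mat A $$ (idx v, a) * A $$ (a, idx w))"
      using idx vw by (intro sum.cong refl) (simp add: idxl Aij)
    also have "\<dots> = (adj_mat A * A) $$ (idx v, idx w)"
      using A idx vw adj_mat(1)[OF A]
      by (auto simp: scalar_prod_def atLeast0LessThan[symmetric] intro!: sum.cong)
    also have "\<dots> = (if v = w then fdet V M else 0)"
      using idx vw by (auto simp: adj_mat(3)[OF A] fdet_def A_def[symmetric]) metis
    finally show "(\<Sum>e\<in>V. adj_mat A $$ (idx v, idx e) * M e w) = (if v = w then fdet V M else 0)" .
    have "(\<Sum>e\<in>V. M v e * adj_mat A $$ (idx e, idx w))
        = (\<Sum>a<n. M v (l a) * adj_mat A $$ (idx (l a), idx w))"
      using sum_sorted_list[OF V, of "\<lambda>e. M v e * adj_mat A $$ (idx e, idx w)"] by (simp add: l_def n_def)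
    also have "\<dots> = (\<Sum>a<n. A $$ (idx v, a) * adj_mat A $$ (a, idx w))"
      using idx vw by (intro sum.cong refl) (simp add: idxl Aij)
    also have "\<dots> = (A * adj_mat A) $$ (idx v, idx w)"
      using A idx vw adj_mat(1)[OF A]
      by (auto simp: scalar_prod_def atLeast0LessThan[symmetric] intro!: sum.cong)
    also have "\<dots> = (if v = w then fdet V M else 0)"
      using idx vw by (auto simp: adj_mat(2)[OF A] fdet_def A_def[symmetric]) metis
    finally show "(\<Sum>e\<in>V. M v e * adj_mat A $$ (idx e, idx w)) = (if v = w then fdet V M else 0)" .
  qed
qed

lemma fdet_inverse:
  fixes M :: "nat \<Rightarrow> nat \<Rightarrow> 'a::field"
  assumes "finite V" "fdet V M \<noteq> 0"
  shows "\<exists>B. (\<forall>v\<in>V. \<forall>w\<in>V. (\<Sum>e\<in>V. B v e * M e w) = (if v = w then 1 else 0)) \<and>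
    (\<forall>v\<in>V. \<forall>w\<in>V. (\<Sum>e\<in>V. M v e * B e w) = (if v = w then 1 else 0))"
proof -
  obtain B where B: "\<And>v w. v \<in> V \<Longrightarrow> w \<in> V \<Longrightarrow> (\<Sum>e\<in>V. B v e * M e w) = (if v = w then fdet V M else 0)"
    "\<And>v w. v \<in> V \<Longrightarrow> w \<in> V \<Longrightarrow> (\<Sum>e\<in>V. M v e * B e w) = (if v = w then fdet V M else 0)"
    by (rule fdet_adjugate[OF assms(1), of UNIV M]) auto
  show ?thesis
  proof (intro exI[of _ "\<lambda>v e. B v e / fdet V M"] conjI ballI)
    fix v w assume "v \<in> V" "w \<in> V"
    then show "(\<Sum>e\<in>V. B v e / fdet V M * M e w) = (if v = w then 1 else 0)"
      and "(\<Sum>e\<in>V. M v e * (B e w / fdet V M)) = (if v = w then 1 else 0)"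
      using B[of v w] assms(2) by (simp_all add: sum_divide_distrib[symmetric])
  qed
qed

lemma fdet_eq_0_kernel:
  fixes M :: "nat \<Rightarrow> nat \<Rightarrow> 'a::field"
  assumes V: "finite V" and "fdet V M = 0"
  shows "\<exists>y. (\<forall>e\<in>V. (\<Sum>v\<in>V. M e v * y v) = 0) \<and> (\<exists>v\<in>V. y v \<noteq> 0)"
proof -
  define l where "l a = sorted_list_of_set V ! a" for a
  define n where "n = card V"
  have bij: "bij_betw l {..<n} V" unfolding l_def n_def by (rule bij_betw_sorted_list[OF V])
  obtain x where x: "x \<in> carrier_vec n" "x \<noteq> 0\<^sub>v n" "fmat V M *\<^sub>v x = 0\<^sub>v n"
    using assms(2) det_0_iff_vec_prod_zero[of "fmat V M" n] by (auto simp: fdet_def n_def)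
  obtain a where a: "a < n" "x $ a \<noteq> 0"
    using x(1,2) by (metis carrier_vecD eq_vecI index_zero_vec(1) index_zero_vec(2))
  define y where "y v = x $ the_inv_into {..<n} l v" for v
  have y: "b < n \<Longrightarrow> y (l b) = x $ b" for b
    unfolding y_def using bij by (simp add: the_inv_into_f_f bij_betw_def)
  show ?thesis
  proof (intro exI[of _ y] conjI ballI)
    show "\<exists>v\<in>V. y v \<noteq> 0" using a y bij by (intro bexI[of _ "l a"]) (auto simp: bij_betw_def)
    fix e assume "e \<in> V"
    then obtain c where c: "c < n" "e = l c" using bij by (auto simp: bij_betw_def)
    have "(\<Sum>v\<in>V. M e v * y v) = (\<Sum>b<n. M e (l b) * x $ b)"
      using sum_sorted_list[OF V, of "\<lambda>v. M e v * y v"] y by (simp add: l_def n_def)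
    also have "\<dots> = (fmat V M *\<^sub>v x) $ c"
      using c x(1) by (auto simp: fmat_def scalar_prod_def atLeast0LessThan[symmetric] l_def n_def intro!: sum.cong)
    finally show "(\<Sum>v\<in>V. M e v * y v) = 0" using x(3) c by simp
  qed
qed

lemma fdet_cong:
  assumes "finite V" "\<And>e v. e \<in> V \<Longrightarrow> v \<in> V \<Longrightarrow> M e v = M' e v"
  shows "fdet V M = fdet V M'"
proof -
  have "fmat V M = fmat V M'"
    by (rule eq_matI) (use assms(2) bij_betw_sorted_list[OF assms(1)] in \<open>auto simp: fmat_def bij_betw_def\<close>)
  then show ?thesis by (simp add: fdet_def)
qed

lemma fdet_hom:
  assumes "comm_ring_hom h"
  shows "fdet V (\<lambda>v w. h (M v w)) = h (fdet V M)"
proof -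
  interpret comm_ring_hom h by fact
  have "fmat V (\<lambda>v w. h (M v w)) = map_mat h (fmat V M)"
    by (rule eq_matI) (auto simp: fmat_def)
  then show ?thesis by (simp add: fdet_def)
qed

lemma fdet_polyfuns:
  assumes "finite V" "\<And>v w. v \<in> V \<Longrightarrow> w \<in> V \<Longrightarrow> (\<lambda>e. M e v w) \<in> polyfuns"
  shows "(\<lambda>e. fdet V (M e)) \<in> polyfuns"
proof -
  have "(\<lambda>e. fdet V (M e)) = (\<lambda>e. \<Sum>p\<in>{p. p permutes {0..<card V}}. signof p *
      (\<Prod>i=0..<card V. M e (sorted_list_of_set V ! i) (sorted_list_of_set V ! p i)))"
    unfolding fdet_def det_def'[OF fmat_carrier]
    by (intro ext sum.cong refl arg_cong2[of _ _ _ _ "(*)"] prod.cong)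
       (auto simp: fmat_def permutes_lessThan)
  moreover have "\<dots> \<in> polyfuns"
  proof (intro polyfuns_sum polyfuns.mult polyfuns.const polyfuns_prod assms(2))
    fix p i assume "p \<in> {p. p permutes {0..<card V}}" "i \<in> {0..<card V}"
    then show "sorted_list_of_set V ! i \<in> V" "sorted_list_of_set V ! p i \<in> V"
      using bij_betw_sorted_list[OF assms(1)] by (auto simp: bij_betw_def permutes_lessThan)
  qed
  ultimately show ?thesis by simp
qed

section \<open>Multiplicity of a nondegenerate zero\<close>

lemma cpoly_sum_monomials:
  "P = (\<Sum>m\<in>Poly_Mapping.keys P. Poly_Mapping.single m (Poly_Mapping.lookup P m))"
proof (rule poly_mapping_eqI)
  fix n
  have "(\<Sum>m\<in>Poly_Mapping.keys P. Poly_Mapping.lookup (Poly_Mapping.single m (Poly_Mapping.lookup P m)) n)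
      = (\<Sum>m\<in>Poly_Mapping.keys P. if m = n then Poly_Mapping.lookup P n else 0)"
    by (intro sum.cong refl) (simp add: lookup_single when_def)
  then show "Poly_Mapping.lookup P n =
      Poly_Mapping.lookup (\<Sum>m\<in>Poly_Mapping.keys P. Poly_Mapping.single m (Poly_Mapping.lookup P m)) n"
    by (simp add: lookup_sum in_keys_iff)
qed

definition monom_eval :: "('v \<Rightarrow>\<^sub>0 nat) \<Rightarrow> ('v \<Rightarrow> complex) \<Rightarrow> complex" where
  "monom_eval m x = (\<Prod>v \<in> Poly_Mapping.keys m. x v ^ Poly_Mapping.lookup m v)"

lemma monom_eval_superset:
  assumes "finite A" "Poly_Mapping.keys m \<subseteq> A"
  shows "monom_eval m x = (\<Prod>v\<in>A. x v ^ Poly_Mapping.lookup m v)"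
  unfolding monom_eval_def by (rule prod.mono_neutral_left) (use assms in \<open>auto simp: in_keys_iff\<close>)

lemma monom_eval_add: "monom_eval (m + n) x = monom_eval m x * monom_eval n x"
proof -
  let ?A = "Poly_Mapping.keys m \<union> Poly_Mapping.keys n"
  have "monom_eval (m + n) x = (\<Prod>v\<in>?A. x v ^ Poly_Mapping.lookup (m + n) v)"
    by (intro monom_eval_superset keys_add) simp
  also have "\<dots> = (\<Prod>v\<in>?A. x v ^ Poly_Mapping.lookup m v) * (\<Prod>v\<in>?A. x v ^ Poly_Mapping.lookup n v)"
    by (simp add: lookup_add power_add prod.distrib)
  also have "\<dots> = monom_eval m x * monom_eval n x"
    by (simp add: monom_eval_superset[of ?A])
  finally show ?thesis .
qed

lemma cpeval_altdef: "cpeval P x = (\<Sum>m \<in> Poly_Mapping.keys P. Poly_Mapping.lookup P m * monom_eval m x)"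
  by (simp add: cpeval_def monom_eval_def)

lemma cpeval_add: "cpeval (P + Q) x = cpeval P x + cpeval Q x"
  unfolding cpeval_altdef by (rule setsum_keys_plus_distrib) (simp_all add: ring_distribs)

lemma cpeval_zero: "cpeval 0 x = 0"
  by (simp add: cpeval_def)

lemma cpeval_sum: "cpeval (\<Sum>i\<in>I. f i) x = (\<Sum>i\<in>I. cpeval (f i) x)"
  by (induction I rule: infinite_finite_induct) (simp_all add: cpeval_zero cpeval_add)

lemma cpeval_single: "cpeval (Poly_Mapping.single m c) x = c * monom_eval m x"
  by (simp add: cpeval_altdef)

lemma cpeval_mult: "cpeval (P * Q) x = cpeval P x * cpeval Q x"
proof -
  have 1: "cpeval (Poly_Mapping.single m c * Poly_Mapping.single n d) x
      = cpeval (Poly_Mapping.single m c) x * cpeval (Poly_Mapping.single n d) x" for m n :: "'a \<Rightarrow>\<^sub>0 nat" and c d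
    by (simp add: mult_single cpeval_single monom_eval_add)
  let ?s = "\<lambda>P m. Poly_Mapping.single m (Poly_Mapping.lookup P m) :: 'a cpoly"
  have "cpeval (P * Q) x = cpeval ((\<Sum>m\<in>Poly_Mapping.keys P. ?s P m) * (\<Sum>n\<in>Poly_Mapping.keys Q. ?s Q n)) x"
    using cpoly_sum_monomials by metis
  also have "\<dots> = cpeval (\<Sum>m\<in>Poly_Mapping.keys P. ?s P m) x * cpeval (\<Sum>n\<in>Poly_Mapping.keys Q. ?s Q n) x"
    by (simp add: sum_product cpeval_sum 1)
  also have "\<dots> = cpeval P x * cpeval Q x"
    using cpoly_sum_monomials by metis
  finally show ?thesis .
qed

lemma cpeval_cconst [simp]: "cpeval (cconst c) x = c"
  by (simp add: cconst_def cpeval_single monom_eval_def)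

lemma cpeval_cvar [simp]: "cpeval (cvar v) x = x v"
  by (simp add: cvar_def cpeval_single monom_eval_def)

lemma cconst_0: "cconst 0 = 0" and cconst_1: "cconst 1 = 1"
  and cconst_add: "cconst (a + b) = cconst a + cconst b"
  and cconst_mult: "cconst (a * b) = cconst a * cconst b"
  and cconst_minus: "cconst (- a) = - cconst a"
  by (simp_all add: cconst_def single_add mult_single single_uminus)

lemma cpeval_one: "cpeval 1 x = 1"
  using cpeval_cconst[of 1 x] by (simp add: cconst_1)

lemma cpeval_minus: "cpeval (- P) x = - cpeval P x"
  using cpeval_add[of P "- P" x] by (simp add: cpeval_zero eq_neg_iff_add_eq_0 add.commute)

lemma cpeval_diff: "cpeval (P - Q) x = cpeval P x - cpeval Q x"
  using cpeval_add[of P "- Q" x] by (simp add: cpeval_minus)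

lemma cpeval_prod: "cpeval (\<Prod>i\<in>I. f i) x = (\<Prod>i\<in>I. cpeval (f i) x)"
  by (induction I rule: infinite_finite_induct) (simp_all add: cpeval_one cpeval_mult)

lemma comm_ring_hom_cpeval: "comm_ring_hom (\<lambda>P. cpeval P x)"
  by unfold_locales (simp_all add: cpeval_zero cpeval_one cpeval_add cpeval_mult)

lemma cpolys_cconst: "cconst c \<in> cpolys V"
  by (auto simp: cpolys_def cconst_def split: if_splits)

lemma cpolys_cvar: "v \<in> V \<Longrightarrow> cvar v \<in> cpolys V"
  by (auto simp: cpolys_def cvar_def)

lemma cpolys_add: "P \<in> cpolys V \<Longrightarrow> Q \<in> cpolys V \<Longrightarrow> P + Q \<in> cpolys V"
  using keys_add[of P Q] by (auto simp: cpolys_def)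

lemma cpolys_mult:
  assumes "P \<in> cpolys V" "Q \<in> cpolys V"
  shows "P * Q \<in> cpolys V"
  unfolding cpolys_def
proof (intro CollectI ballI)
  fix m assume "m \<in> Poly_Mapping.keys (P * Q)"
  then obtain a b where "m = a + b" "a \<in> Poly_Mapping.keys P" "b \<in> Poly_Mapping.keys Q"
    using keys_mult[of P Q] by auto
  then show "Poly_Mapping.keys m \<subseteq> V"
    using assms keys_add[of a b] unfolding cpolys_def by blast
qed

lemma cpolys_0: "0 \<in> cpolys V" and cpolys_1: "1 \<in> cpolys V"
  using cpolys_cconst[of 0 V] cpolys_cconst[of 1 V] by (simp_all add: cconst_0 cconst_1)

lemma cpolys_minus: "P \<in> cpolys V \<Longrightarrow> - P \<in> cpolys V"
  using cpolys_mult[OF cpolys_cconst[of "-1" V], of P] by (simp add: cconst_minus cconst_1)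

lemma cpolys_diff: "P \<in> cpolys V \<Longrightarrow> Q \<in> cpolys V \<Longrightarrow> P - Q \<in> cpolys V"
  using cpolys_add[OF _ cpolys_minus, of P V Q] by simp

lemma cpolys_sum: "(\<And>i. i \<in> I \<Longrightarrow> f i \<in> cpolys V) \<Longrightarrow> (\<Sum>i\<in>I. f i) \<in> cpolys V"
  by (induction I rule: infinite_finite_induct) (auto intro: cpolys_add cpolys_0)

lemma cpolys_prod: "(\<And>i. i \<in> I \<Longrightarrow> f i \<in> cpolys V) \<Longrightarrow> (\<Prod>i\<in>I. f i) \<in> cpolys V"
  by (induction I rule: infinite_finite_induct) (auto intro: cpolys_mult cpolys_1)

text \<open>The expansion into monomials, each a constant times a product of powers of
  \<open>cvar\<close>, supplies a structural induction for polynomials that are finitely supported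
  maps.\<close>

lemma cpolys_induct [consumes 1, case_names cconst cvar add mult]:
  assumes "P \<in> cpolys V" and cconst: "\<And>c. Pr (cconst c)" and cvar: "\<And>v. v \<in> V \<Longrightarrow> Pr (cvar v)"
    and add: "\<And>P Q. Pr P \<Longrightarrow> Pr Q \<Longrightarrow> Pr (P + Q)" and mult: "\<And>P Q. Pr P \<Longrightarrow> Pr Q \<Longrightarrow> Pr (P * Q)"
  shows "Pr P"
proof -
  have sum: "Pr (\<Sum>i\<in>I. f i)" if "\<And>i. i \<in> I \<Longrightarrow> Pr (f i)" for I and f :: "('a \<Rightarrow>\<^sub>0 nat) \<Rightarrow> 'a cpoly"
    using that by (induction I rule: infinite_finite_induct) (auto intro: add cconst[of 0, unfolded cconst_0])
  have prod: "Pr (\<Prod>i\<in>I. f i)" if "\<And>i. i \<in> I \<Longrightarrow> Pr (f i)" for I and f :: "'a \<Rightarrow> 'a cpoly"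
    using that by (induction I rule: infinite_finite_induct) (auto intro: mult cconst[of 1, unfolded cconst_1])
  have pow: "Pr (Q ^ n)" if "Pr Q" for Q n
    using that by (induction n) (auto intro: mult cconst[of 1, unfolded cconst_1])
  have power: "cvar v ^ n = Poly_Mapping.single (Poly_Mapping.single v n) 1" for v :: 'a and n
    by (induction n) (simp_all add: cvar_def mult_single single_add[symmetric])
  have prod_single: "(\<Prod>i\<in>I. Poly_Mapping.single (h i) 1) = Poly_Mapping.single (\<Sum>i\<in>I. h i) (1::complex)"
    for I and h :: "'a \<Rightarrow> 'a \<Rightarrow>\<^sub>0 nat"
    by (induction I rule: infinite_finite_induct) (simp_all add: mult_single)
  have mono: "m = (\<Sum>v\<in>Poly_Mapping.keys m. Poly_Mapping.single v (Poly_Mapping.lookup m v))" for m :: "'a \<Rightarrow>\<^sub>0 nat"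
    by (rule poly_mapping_eqI)
      (simp add: lookup_sum lookup_single when_def in_keys_iff)
  have "Pr (Poly_Mapping.single m (Poly_Mapping.lookup P m))" if "m \<in> Poly_Mapping.keys P" for m
  proof -
    have "Poly_Mapping.single m (Poly_Mapping.lookup P m) = cconst (Poly_Mapping.lookup P m) * Poly_Mapping.single m 1"
      by (simp add: cconst_def mult_single)
    also have "Poly_Mapping.single m 1 = (\<Prod>v\<in>Poly_Mapping.keys m. cvar v ^ Poly_Mapping.lookup m v)"
      unfolding power prod_single using mono[of m] by simp
    finally have eq: "Poly_Mapping.single m (Poly_Mapping.lookup P m) =
      cconst (Poly_Mapping.lookup P m) * (\<Prod>v\<in>Poly_Mapping.keys m. cvar v ^ Poly_Mapping.lookup m v)" .
    show ?thesis unfolding eq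
      by (intro mult cconst prod pow cvar) (use that assms(1) in \<open>auto simp: cpolys_def\<close>)
  qed
  then show ?thesis using sum[of "Poly_Mapping.keys P"] cpoly_sum_monomials[of P] by metis
qed

lemma polyfuns_power: "f \<in> polyfuns \<Longrightarrow> (\<lambda>e. f e ^ n) \<in> polyfuns"
  by (induction n) (auto intro: polyfuns.intros)

lemma cpeval_polyfuns: "(\<lambda>x. cpeval P x) \<in> polyfuns"
  unfolding cpeval_def
  by (intro polyfuns_sum polyfuns.mult polyfuns.const polyfuns_prod polyfuns_power polyfuns.var)

lemma polyfuns_cpoly:
  assumes "f \<in> polyfuns"
  shows "\<exists>P\<in>cpolys V. \<forall>x\<in>affine_space V. cpeval P x = f x"
  using assms
proof induction
  case (const c) show ?case by (rule bexI[of _ "cconst c"]) (simp_all add: cpolys_cconst)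
next
  case (var w)
  show ?case
  proof (cases "w \<in> V")
    case True then show ?thesis by (intro bexI[of _ "cvar w"]) (simp_all add: cpolys_cvar)
  next
    \<comment> \<open>Points of \<open>affine_space V\<close> take the value
      \<open>undefined\<close> off \<open>V\<close>, so there the coordinate is a constant.\<close>
    case False
    then show ?thesis
      by (intro bexI[of _ "cconst undefined"]) (auto simp: cpolys_cconst affine_space_def PiE_def extensional_def)
  qed
next
  case (add f g)
  then obtain P Q where "P \<in> cpolys V" "\<forall>x\<in>affine_space V. cpeval P x = f x"
    "Q \<in> cpolys V" "\<forall>x\<in>affine_space V. cpeval Q x = g x" by blast
  then show ?case by (intro bexI[of _ "P + Q"]) (simp_all add: cpeval_add cpolys_add)
next
  case (mult f g)
  then obtain P Q where "P \<in> cpolys V" "\<forall>x\<in>affine_space V. cpeval P x = f x"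
    "Q \<in> cpolys V" "\<forall>x\<in>affine_space V. cpeval Q x = g x" by blast
  then show ?case by (intro bexI[of _ "P * Q"]) (simp_all add: cpeval_mult cpolys_mult)
qed

text \<open>The polynomials that vanish at \<open>p\<close> form the ideal generated by the
  \<open>cvar v - cconst (p v)\<close>. The cofactors evaluated at \<open>p\<close> are the partial
  derivatives, which connects the Jacobian matrix with ideal membership.\<close>

lemma cpolys_taylor:
  assumes "finite V" "P \<in> cpolys V"
  shows "\<exists>A. (\<forall>v\<in>V. A v \<in> cpolys V) \<and> P - cconst (cpeval P p) = (\<Sum>v\<in>V. A v * (cvar v - cconst (p v)))"
proof -
  have "P \<in> cpolys V \<and> (\<exists>A. (\<forall>v\<in>V. A v \<in> cpolys V) \<and> P - cconst (cpeval P p) = (\<Sum>v\<in>V. A v * (cvar v - cconst (p v))))"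
    using assms(2)
  proof (induction rule: cpolys_induct)
    case (cconst c)
    show ?case by (intro conjI exI[of _ "\<lambda>_. 0"]) (simp_all add: cpolys_0 cpolys_cconst)
  next
    case (cvar w)
    have "(\<Sum>v\<in>V. (if v = w then 1 else 0) * (cvar v - cconst (p v))) = cvar w - cconst (p w)"
      using assms(1) cvar by (simp add: if_distrib[of "\<lambda>x. x * _"] cong: if_cong)
    then show ?case
      using cvar by (intro conjI exI[of _ "\<lambda>v. if v = w then 1 else 0"]) (auto simp: cpolys_0 cpolys_1 cpolys_cvar)
  next
    case (add P Q)
    then obtain A B where A: "\<forall>v\<in>V. A v \<in> cpolys V" "P - cconst (cpeval P p) = (\<Sum>v\<in>V. A v * (cvar v - cconst (p v)))"
      and B: "\<forall>v\<in>V. B v \<in> cpolys V" "Q - cconst (cpeval Q p) = (\<Sum>v\<in>V. B v * (cvar v - cconst (p v)))" by auto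
    show ?case
    proof (intro conjI exI[of _ "\<lambda>v. A v + B v"])
      have "P + Q - cconst (cpeval (P + Q) p) = (P - cconst (cpeval P p)) + (Q - cconst (cpeval Q p))"
        by (simp add: cpeval_add cconst_add)
      also have "\<dots> = (\<Sum>v\<in>V. (A v + B v) * (cvar v - cconst (p v)))"
        unfolding A(2) B(2) by (simp add: sum.distrib distrib_right)
      finally show "P + Q - cconst (cpeval (P + Q) p) = \<dots>" .
    qed (use A(1) B(1) add in \<open>auto intro: cpolys_add\<close>)
  next
    case (mult P Q)
    then obtain A B where A: "\<forall>v\<in>V. A v \<in> cpolys V" "P - cconst (cpeval P p) = (\<Sum>v\<in>V. A v * (cvar v - cconst (p v)))"
      and B: "\<forall>v\<in>V. B v \<in> cpolys V" "Q - cconst (cpeval Q p) = (\<Sum>v\<in>V. B v * (cvar v - cconst (p v)))" by auto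
    show ?case
    proof (intro conjI exI[of _ "\<lambda>v. Q * A v + cconst (cpeval P p) * B v"])
      have "P * Q - cconst (cpeval (P * Q) p) = Q * (P - cconst (cpeval P p)) + cconst (cpeval P p) * (Q - cconst (cpeval Q p))"
        by (simp add: cpeval_mult cconst_mult algebra_simps)
      also have "\<dots> = (\<Sum>v\<in>V. (Q * A v + cconst (cpeval P p) * B v) * (cvar v - cconst (p v)))"
        unfolding A(2) B(2) by (simp add: sum.distrib distrib_right sum_distrib_left mult.assoc)
      finally show "P * Q - cconst (cpeval (P * Q) p) = \<dots>" .
    qed (use A(1) B(1) mult in \<open>auto intro: cpolys_add cpolys_mult cpolys_cconst\<close>)
  qed
  then show ?thesis by blast
qed

section \<open>The local ring at a point and its ideals\<close>

lemma local_ring_memI: "g \<in> cpolys V \<Longrightarrow> h \<in> cpolys V \<Longrightarrow> cpeval h p \<noteq> 0 \<Longrightarrow> Fract g h \<in> local_ring V p"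
  by (auto simp: local_ring_def)

lemma cpeval_neq_0D: "cpeval h p \<noteq> 0 \<Longrightarrow> h \<noteq> 0"
  by (auto simp: cpeval_zero)

lemma local_ring_add: "a \<in> local_ring V p \<Longrightarrow> b \<in> local_ring V p \<Longrightarrow> a + b \<in> local_ring V p"
  by (auto simp: local_ring_def cpeval_neq_0D)
     (metis cpeval_mult cpolys_add cpolys_mult mult_eq_0_iff)

lemma local_ring_mult: "a \<in> local_ring V p \<Longrightarrow> b \<in> local_ring V p \<Longrightarrow> a * b \<in> local_ring V p"
  by (auto simp: local_ring_def) (metis cpeval_mult cpolys_mult mult_eq_0_iff)

lemma local_ring_poly: "g \<in> cpolys V \<Longrightarrow> Fract g 1 \<in> local_ring V p"
  by (rule local_ring_memI) (simp_all add: cpolys_1 cpeval_one)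

lemma local_ring_0: "0 \<in> local_ring V p" and local_ring_1: "1 \<in> local_ring V p"
  using local_ring_poly[OF cpolys_0] local_ring_poly[OF cpolys_1]
  by (simp_all add: Zero_fract_def One_fract_def)

lemma local_ideal_0: "0 \<in> local_ideal V p F"
  by (auto simp: local_ideal_def local_ring_0 intro!: exI[of _ "\<lambda>_. 0"])

lemma local_ideal_add:
  assumes "a \<in> local_ideal V p F" "b \<in> local_ideal V p F"
  shows "a + b \<in> local_ideal V p F"
proof -
  obtain r s where "a = (\<Sum>f\<in>F. r f * Fract f 1)" "r ` F \<subseteq> local_ring V p"
    "b = (\<Sum>f\<in>F. s f * Fract f 1)" "s ` F \<subseteq> local_ring V p"
    using assms by (auto simp: local_ideal_def)
  then show ?thesis unfolding local_ideal_def
    by (intro CollectI exI[of _ "\<lambda>f. r f + s f"])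
       (auto simp: sum.distrib distrib_right intro: local_ring_add)
qed

lemma local_ideal_mult:
  assumes "a \<in> local_ring V p" "b \<in> local_ideal V p F"
  shows "a * b \<in> local_ideal V p F"
proof -
  obtain s where "b = (\<Sum>f\<in>F. s f * Fract f 1)" "s ` F \<subseteq> local_ring V p"
    using assms by (auto simp: local_ideal_def)
  then show ?thesis unfolding local_ideal_def using assms(1)
    by (intro CollectI exI[of _ "\<lambda>f. a * s f"])
       (auto simp: sum_distrib_left mult.assoc intro: local_ring_mult)
qed

lemma local_ideal_sum: "(\<And>i. i \<in> I \<Longrightarrow> f i \<in> local_ideal V p F) \<Longrightarrow> (\<Sum>i\<in>I. f i) \<in> local_ideal V p F"
  by (induction I rule: infinite_finite_induct) (auto intro: local_ideal_add local_ideal_0)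

lemma local_ideal_generator:
  assumes "finite F" "f \<in> F"
  shows "Fract f 1 \<in> local_ideal V p F"
proof -
  have "Fract f 1 = (\<Sum>g\<in>F. (if g = f then 1 else 0) * Fract g 1)"
    using assms by (simp add: if_distrib[of "\<lambda>x. x * _"] cong: if_cong)
  then show ?thesis unfolding local_ideal_def
    by (intro CollectI exI[of _ "\<lambda>g. if g = f then 1 else 0"]) (auto simp: local_ring_0 local_ring_1)
qed

text \<open>The ideal is proper at a common zero: each of its elements is a fraction with numerator
  vanishing at \<open>p\<close> and denominator not. This gives multiplicity at least one.\<close>

lemma local_ideal_const:
  assumes "finite F" "\<And>f. f \<in> F \<Longrightarrow> cpeval f p = 0" "Fract (cconst c) 1 \<in> local_ideal V p F"
  shows "c = 0"
proof -
  obtain r where r: "Fract (cconst c) 1 = (\<Sum>f\<in>F. r f * Fract f 1)" "r ` F \<subseteq> local_ring V p"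
    using assms(3) by (auto simp: local_ideal_def)
  have *: "\<exists>g h. (\<Sum>f\<in>G. r f * Fract f 1) = Fract g h \<and> cpeval h p \<noteq> 0 \<and> cpeval g p = 0" if "G \<subseteq> F" for G
    using finite_subset[OF that assms(1)] that
  proof (induction G rule: finite_induct)
    case empty
    show ?case by (intro exI[of _ 0] exI[of _ 1]) (simp add: Zero_fract_def cpeval_one cpeval_zero)
  next
    case (insert f G)
    then obtain g h where gh: "(\<Sum>f\<in>G. r f * Fract f 1) = Fract g h" "cpeval h p \<noteq> 0" "cpeval g p = 0" by auto
    have "r f \<in> local_ring V p" using r(2) insert.prems by auto
    then obtain g' h' where gh': "r f = Fract g' h'" "cpeval h' p \<noteq> 0"
      unfolding local_ring_def by blast
    have "(\<Sum>f\<in>insert f G. r f * Fract f 1) = Fract ((g' * f) * h + g * h') (h' * h)"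
      unfolding sum.insert[OF insert.hyps] gh(1) gh'(1) mult_fract mult_1_right
      by (rule add_fract[OF cpeval_neq_0D[OF gh'(2)] cpeval_neq_0D[OF gh(2)]])
    moreover have "cpeval (h' * h) p \<noteq> 0" using gh(2) gh'(2) by (simp add: cpeval_mult)
    moreover have "cpeval ((g' * f) * h + g * h') p = 0"
      using gh(3) assms(2)[of f] insert.prems by (simp add: cpeval_mult cpeval_add)
    ultimately show ?case by blast
  qed
  then obtain g h where gh: "Fract (cconst c) 1 = Fract g h" "cpeval h p \<noteq> 0" "cpeval g p = 0" using *[OF order_refl] unfolding r(1)[symmetric] by blast
  then have "cconst c * h = g" by (simp add: eq_fract cpeval_neq_0D)
  then have "c * cpeval h p = 0" using gh(3) by (metis cpeval_cconst cpeval_mult)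
  then show ?thesis using gh by simp
qed

text \<open>Writing \<open>f e\<close> as the sum of the \<open>A e v * y v\<close>, the matrix
  \<open>A\<close> at \<open>p\<close> is the Jacobian, so \<open>fdet V A\<close> is a unit of the
  local ring. The adjugate turns the \<open>f e\<close> into \<open>fdet V A * y v\<close>, so every
  \<open>y v\<close> lies in the ideal and every element of the local ring is congruent to its value
  at \<open>p\<close>.\<close>

theorem multiplicity_at_nondegenerate:
  fixes V :: "nat set"
  assumes V: "finite V" and F: "finite F" and f: "\<And>e. e \<in> V \<Longrightarrow> f e \<in> F" "\<And>g. g \<in> F \<Longrightarrow> g \<in> cpolys V"
    and zero: "\<And>g. g \<in> F \<Longrightarrow> cpeval g p = 0"
    and nondeg: "fdet V (\<lambda>e v. deriv (\<lambda>z. cpeval (f e) (p(v := z))) (p v)) \<noteq> 0"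
  shows "multiplicity_at V F p = 1"
proof -
  define y where "y v = cvar v - cconst (p v)" for v
  have y: "v \<in> V \<Longrightarrow> y v \<in> cpolys V" for v unfolding y_def by (intro cpolys_diff cpolys_cvar cpolys_cconst)
  have "\<forall>e\<in>V. \<exists>A. (\<forall>v\<in>V. A v \<in> cpolys V) \<and> f e = (\<Sum>v\<in>V. A v * y v)"
  proof
    fix e assume "e \<in> V"
    then show "\<exists>A. (\<forall>v\<in>V. A v \<in> cpolys V) \<and> f e = (\<Sum>v\<in>V. A v * y v)"
      using cpolys_taylor[OF V f(2)[OF f(1)], of e p] zero[OF f(1), of e] by (simp add: y_def cconst_0)
  qed
  then obtain A where A: "\<And>e v. e \<in> V \<Longrightarrow> v \<in> V \<Longrightarrow> A e v \<in> cpolys V" "\<And>e. e \<in> V \<Longrightarrow> f e = (\<Sum>v\<in>V. A e v * y v)"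
    by metis
  \<comment> \<open>Along the coordinate \<open>v\<close> all other \<open>y w\<close> vanish, so
    \<open>f e\<close> equals \<open>A e v\<close> times \<open>z - p v\<close>; this is
    Caratheodory's form of the derivative.\<close>
  have deriv: "deriv (\<lambda>z. cpeval (f e) (p(v := z))) (p v) = cpeval (A e v) p" if "e \<in> V" "v \<in> V" for e v
  proof (rule DERIV_imp_deriv, unfold CARAT_DERIV, intro exI conjI allI)
    fix z
    have *: "cpeval (f e) (p(v := z)) = cpeval (A e v) (p(v := z)) * (z - p v)" for z
    proof -
      have "cpeval (f e) (p(v := z)) = (\<Sum>w\<in>V. cpeval (A e w) (p(v := z)) * ((p(v := z)) w - p w))"
        by (simp add: A(2) that cpeval_sum cpeval_mult cpeval_diff y_def)
      also have "\<dots> = (\<Sum>w\<in>V. if w = v then cpeval (A e v) (p(v := z)) * (z - p v) else 0)"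
        by (intro sum.cong) auto
      also have "\<dots> = cpeval (A e v) (p(v := z)) * (z - p v)" using V that by simp
      finally show ?thesis .
    qed
    show "cpeval (f e) (p(v := z)) - cpeval (f e) (p(v := p v)) = cpeval (A e v) (p(v := z)) * (z - p v)"
      using *[of z] *[of "p v"] by simp
    show "isCont (\<lambda>z. cpeval (A e v) (p(v := z))) (p v)"
      unfolding isCont_def fun_upd_triv
    proof (rule polyfuns_tendsto[OF cpeval_polyfuns])
      show "((\<lambda>z. (p(v := z)) w) \<longlongrightarrow> p w) (at (p v))" for w
        by (cases "w = v") simp_all
    qed
  qed simp
  have "fdet V (\<lambda>e v. deriv (\<lambda>z. cpeval (f e) (p(v := z))) (p v)) = fdet V (\<lambda>e v. cpeval (A e v) p)"
    by (intro fdet_cong V deriv)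
  also have "\<dots> = cpeval (fdet V A) p"
    by (rule fdet_hom[OF comm_ring_hom_cpeval])
  finally have det: "cpeval (fdet V A) p \<noteq> 0" using nondeg by simp
  obtain B where B: "\<And>v w. v \<in> V \<Longrightarrow> w \<in> V \<Longrightarrow> B v w \<in> cpolys V"
      "\<And>v w. v \<in> V \<Longrightarrow> w \<in> V \<Longrightarrow> (\<Sum>e\<in>V. B v e * A e w) = (if v = w then fdet V A else 0)"
    by (rule fdet_adjugate[OF V, of "cpolys V" A])
       (use A in \<open>auto intro: cpolys_0 cpolys_1 cpolys_add cpolys_mult cpolys_minus\<close>)
  \<comment> \<open>The product of \<open>B\<close> and \<open>A\<close> shows the determinant as a
    diagonal entry, which needs some index; for empty \<open>V\<close> the determinant is 1.\<close>
  have detV: "fdet V A \<in> cpolys V"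
  proof (cases "V = {}")
    case True then show ?thesis by (simp add: fdet_def fmat_def cpolys_1)
  next
    case False
    then obtain v where "v \<in> V" by auto
    then have "(\<Sum>e\<in>V. B v e * A e v) \<in> cpolys V"
      by (intro cpolys_sum cpolys_mult A(1) B(1))
    then show ?thesis using B(2)[of v v] \<open>v \<in> V\<close> by simp
  qed
  have By: "(\<Sum>e\<in>V. B v e * f e) = fdet V A * y v" if "v \<in> V" for v
  proof -
    have "(\<Sum>e\<in>V. B v e * f e) = (\<Sum>e\<in>V. \<Sum>w\<in>V. B v e * A e w * y w)"
      by (simp add: A(2) sum_distrib_left mult.assoc)
    also have "\<dots> = (\<Sum>w\<in>V. (\<Sum>e\<in>V. B v e * A e w) * y w)"
      by (subst sum.swap) (simp add: sum_distrib_right)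
    also have "\<dots> = (\<Sum>w\<in>V. if v = w then fdet V A * y w else 0)"
      using that by (intro sum.cong) (auto simp: B(2))
    finally show ?thesis using V that by simp
  qed
  have FractSum: "(\<Sum>i\<in>I. Fract (g i) 1) = Fract (\<Sum>i\<in>I. g i) 1" for I and g :: "nat \<Rightarrow> nat cpoly"
    by (induction I rule: infinite_finite_induct) (auto simp: Zero_fract_def)
  have y_ideal: "Fract (y v) 1 \<in> local_ideal V p F" if "v \<in> V" for v
  proof -
    have "Fract (y v) 1 = Fract 1 (fdet V A) * Fract (fdet V A * y v) 1"
      using cpeval_neq_0D[OF det] by (simp add: eq_fract)
    also have "Fract (fdet V A * y v) 1 = (\<Sum>e\<in>V. Fract (B v e) 1 * Fract (f e) 1)"
      by (simp add: By[OF that, symmetric] FractSum)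
    finally have eq: "Fract (y v) 1 = Fract 1 (fdet V A) * (\<Sum>e\<in>V. Fract (B v e) 1 * Fract (f e) 1)" .
    show ?thesis unfolding eq
      by (intro local_ideal_mult local_ideal_sum local_ideal_generator F f local_ring_memI[OF cpolys_1 detV det]
          local_ring_poly B(1) that)
  qed
  define K where "K c = Fract (cconst c :: nat cpoly) 1" for c
  have K: "K c \<in> local_ring V p" for c unfolding K_def by (intro local_ring_poly cpolys_cconst)
  have Kmult: "K (a * b) = K a * K b" for a b by (simp add: K_def cconst_mult)
  have Kminus: "K (- a) = - K a" for a by (simp add: K_def cconst_minus)
  have K1: "K 1 = 1" by (simp add: K_def cconst_1 One_fract_def)
  have K0: "K 0 = 0" by (simp add: K_def cconst_0 Zero_fract_def)
  have reduce: "\<exists>c. a - K c \<in> local_ideal V p F" if a: "a \<in> local_ring V p" for a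
  proof -
    obtain g h where gh: "a = Fract g h" "g \<in> cpolys V" "h \<in> cpolys V" "cpeval h p \<noteq> 0"
      using a unfolding local_ring_def by blast
    \<comment> \<open>The residue of \<open>a\<close> at \<open>p\<close>: the numerator
      \<open>q\<close> of \<open>a - K c\<close> vanishes at \<open>p\<close>, so its Taylor
      expansion puts it into the ideal.\<close>
    define c where "c = cpeval g p / cpeval h p"
    define q where "q = g - cconst c * h"
    have q: "q \<in> cpolys V" "cpeval q p = 0"
      using gh unfolding q_def c_def by (auto intro!: cpolys_diff cpolys_mult cpolys_cconst simp: cpeval_diff cpeval_mult)
    obtain D where D: "\<And>v. v \<in> V \<Longrightarrow> D v \<in> cpolys V" "q = (\<Sum>v\<in>V. D v * y v)"
      using cpolys_taylor[OF V q(1), of p] q(2) by (auto simp: y_def cconst_0)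
    have h0: "h \<noteq> 0" using gh by (simp add: cpeval_neq_0D)
    have "a - K c = Fract q h"
      using h0 by (simp add: gh(1) K_def q_def)
    also have "\<dots> = Fract 1 h * Fract q 1" using h0 by (simp add: eq_fract)
    also have "Fract q 1 = (\<Sum>v\<in>V. Fract (D v) 1 * Fract (y v) 1)"
      by (simp add: D(2) FractSum)
    finally have "a - K c = Fract 1 h * (\<Sum>v\<in>V. Fract (D v) 1 * Fract (y v) 1)" .
    moreover have "\<dots> \<in> local_ideal V p F"
      by (intro local_ideal_mult local_ideal_sum local_ring_memI local_ring_poly y_ideal) (use gh D cpolys_1 in auto)
    ultimately show ?thesis by metis
  qed
  let ?ok = "\<lambda>B. finite B \<and> B \<subseteq> local_ring V p \<and>
     (\<forall>c. (\<Sum>b\<in>B. Fract (cconst (c b)) 1 * b) \<in> local_ideal V p F \<longrightarrow> (\<forall>b\<in>B. c b = 0))"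
  have "?ok {1}"
    using local_ideal_const[OF F zero, where V = V] by (auto simp: local_ring_1)
  then have lower: "1 \<in> {enat (card B) | B. ?ok B}"
    by (intro CollectI exI[of _ "{1}"]) (auto simp: one_enat_def)
  have upper: "card B \<le> 1" if B: "?ok B" for B
  proof (rule ccontr)
    assume "\<not> card B \<le> 1"
    then obtain b1 b2 where b: "b1 \<in> B" "b2 \<in> B" "b1 \<noteq> b2"
      using B card_le_Suc0_iff_eq[of B] by auto
    have mem: "b1 \<in> local_ring V p" "b2 \<in> local_ring V p" using B b(1,2) by auto
    from reduce[OF mem(1)] obtain c1 where c1: "b1 - K c1 \<in> local_ideal V p F" ..
    from reduce[OF mem(2)] obtain c2 where c2: "b2 - K c2 \<in> local_ideal V p F" ..
    note c = c1 c2
    have two: "(\<Sum>b\<in>B. K (if b = b1 then s else if b = b2 then t else 0) * b) = K s * b1 + K t * b2" for s t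
    proof -
      have "(\<Sum>b\<in>B. K (if b = b1 then s else if b = b2 then t else 0) * b)
        = (\<Sum>b\<in>{b1, b2}. K (if b = b1 then s else if b = b2 then t else 0) * b)"
        by (rule sum.mono_neutral_right) (use B b in \<open>auto simp: K0\<close>)
      then show ?thesis using b by simp
    qed
    have ok: "s = 0 \<and> t = 0" if "K s * b1 + K t * b2 \<in> local_ideal V p F" for s t
    proof -
      have "(\<Sum>b\<in>B. Fract (cconst (if b = b1 then s else if b = b2 then t else 0)) 1 * b) \<in> local_ideal V p F"
        using two[of s t] that unfolding K_def by simp
      then have *: "\<forall>b\<in>B. (if b = b1 then s else if b = b2 then t else 0) = 0"
        using B[THEN conjunct2, THEN conjunct2, THEN spec, of "\<lambda>b. if b = b1 then s else if b = b2 then t else 0"]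
        by (rule rev_mp)
      show ?thesis using bspec[OF * b(1)] bspec[OF * b(2)] b(3) by auto
    qed
    \<comment> \<open>Modulo the ideal \<open>b1\<close> and \<open>b2\<close> are the constants
      \<open>c1\<close> and \<open>c2\<close>, so \<open>c2 b1 - c1 b2\<close> is a dependence. It
      is nontrivial if \<open>c1\<close> is not 0; otherwise \<open>b1\<close> itself lies in the
      ideal.\<close>
    show False
    proof (cases "c1 = 0")
      case True
      then show False using ok[of 1 0] c(1) by (simp add: K0 K1)
    next
      case False
      have "K c2 * (b1 - K c1) + K (- c1) * (b2 - K c2) \<in> local_ideal V p F"
        by (intro local_ideal_add local_ideal_mult K c)
      moreover have "K c2 * (b1 - K c1) + K (- c1) * (b2 - K c2) = K c2 * b1 + K (- c1) * b2"
        by (simp add: Kminus right_diff_distrib mult.commute)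
      ultimately have "c2 = 0 \<and> - c1 = 0" by (intro ok) simp
      then show False using False by simp
    qed
  qed
  show ?thesis unfolding multiplicity_at_def
  proof (rule antisym[OF Sup_least Sup_upper[OF lower]])
    fix x assume "x \<in> {enat (card B) | B. ?ok B}"
    then obtain B where B: "x = enat (card B) \<and> ?ok B" unfolding mem_Collect_eq ..
    then show "x \<le> 1" using upper[OF conjunct2[OF B]] by (simp add: one_enat_def)
  qed
qed

section \<open>Persistence of nondegenerate zeros\<close>

abbreviation join :: "('p \<Rightarrow> complex) \<Rightarrow> ('v \<Rightarrow> complex) \<Rightarrow> 'p + 'v \<Rightarrow> complex" where
  "join \<equiv> case_sum"

lemma polyfuns_join:
  assumes "\<And>p. (\<lambda>e. S e p) \<in> polyfuns" "\<And>v. (\<lambda>e. T e v) \<in> polyfuns"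
  shows "(\<lambda>e. join (S e) (T e) w) \<in> polyfuns"
  using assms by (cases w) simp_all

text \<open>Polynomial divided differences; the environment of \<open>A v\<close> holds the
  parameters and both points. On the diagonal \<open>x = y\<close> they are the partial derivatives,
  and off it they give Lipschitz estimates without any integration.\<close>

definition divdiff :: "'v set \<Rightarrow> (('p + 'v \<Rightarrow> complex) \<Rightarrow> complex) \<Rightarrow> ('v \<Rightarrow> ('p + 'v + 'v \<Rightarrow> complex) \<Rightarrow> complex) \<Rightarrow> bool" where
  "divdiff V f A \<longleftrightarrow> (\<forall>v. A v \<in> polyfuns) \<and> (\<forall>u x y. (\<forall>v. v \<notin> V \<longrightarrow> x v = y v) \<longrightarrow>
    f (join u x) - f (join u y) = (\<Sum>v\<in>V. A v (join u (join x y)) * (x v - y v)))"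

lemma divdiffI:
  assumes "\<And>v. A v \<in> polyfuns" and "\<And>u x y. \<forall>v. v \<notin> V \<longrightarrow> x v = y v \<Longrightarrow>
    f (join u x) - f (join u y) = (\<Sum>v\<in>V. A v (join u (join x y)) * (x v - y v))"
  shows "divdiff V f A"
  using assms by (simp add: divdiff_def)

lemma divdiffD:
  assumes "divdiff V f A"
  shows "A v \<in> polyfuns" and "\<forall>v. v \<notin> V \<longrightarrow> x v = y v \<Longrightarrow>
    f (join u x) - f (join u y) = (\<Sum>v\<in>V. A v (join u (join x y)) * (x v - y v))"
  using assms by (simp_all add: divdiff_def)

lemma polyfuns_divided_difference:
  fixes f :: "('p + 'v \<Rightarrow> complex) \<Rightarrow> complex"
  assumes V: "finite V" and "f \<in> polyfuns"
  shows "\<exists>A. divdiff V f A"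
  using assms(2)
proof induction
  case (const c)
  have "divdiff V (\<lambda>_ :: 'p + 'v \<Rightarrow> complex. c) (\<lambda>_ _. 0)" by (rule divdiffI) (simp_all add: polyfuns.const)
  then show ?case by (intro exI[of _ "\<lambda>_ _. 0"])
next
  case (var w)
  have "divdiff V (\<lambda>e. e w) (\<lambda>v _. if w = Inr v then 1 else 0)"
  proof (rule divdiffI)
    fix u :: "'p \<Rightarrow> complex" and x y :: "'v \<Rightarrow> complex" assume eq: "\<forall>v. v \<notin> V \<longrightarrow> x v = y v"
    show "join u x w - join u y w = (\<Sum>v\<in>V. (if w = Inr v then 1 else 0) * (x v - y v))"
    proof (cases w)
      case (Inr v0)
      have "(\<Sum>v\<in>V. (if w = Inr v then 1 else 0) * (x v - y v)) = (\<Sum>v\<in>V. if v0 = v then x v - y v else 0)"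
        by (intro sum.cong) (auto simp: Inr)
      then show ?thesis using V eq Inr by simp
    qed simp
  qed (rule polyfuns.const)
  then show ?case by blast
next
  case (add f g)
  then obtain A B where A: "divdiff V f A" and B: "divdiff V g B" by auto
  have "divdiff V (\<lambda>e. f e + g e) (\<lambda>v e. A v e + B v e)"
  proof (rule divdiffI)
    fix u :: "'p \<Rightarrow> complex" and x y :: "'v \<Rightarrow> complex" assume eq: "\<forall>v. v \<notin> V \<longrightarrow> x v = y v"
    show "f (join u x) + g (join u x) - (f (join u y) + g (join u y))
        = (\<Sum>v\<in>V. (A v (join u (join x y)) + B v (join u (join x y))) * (x v - y v))"
      unfolding distrib_right sum.distrib divdiffD(2)[OF A eq, symmetric] divdiffD(2)[OF B eq, symmetric] by simp
  qed (intro polyfuns.add divdiffD(1)[OF A] divdiffD(1)[OF B])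
  then show ?case by blast
next
  case (mult f g)
  then obtain A B where A: "divdiff V f A" and B: "divdiff V g B" by auto
  define gx where "gx e = g (join (\<lambda>p. e (Inl p)) (\<lambda>v. e (Inr (Inl v))))" for e :: "'p + 'v + 'v \<Rightarrow> complex"
  define fy where "fy e = f (join (\<lambda>p. e (Inl p)) (\<lambda>v. e (Inr (Inr v))))" for e :: "'p + 'v + 'v \<Rightarrow> complex"
  have "gx \<in> polyfuns" "fy \<in> polyfuns"
    unfolding gx_def fy_def
    by (rule polyfuns_comp[OF mult.hyps(2)] polyfuns_comp[OF mult.hyps(1)], rule polyfuns_join; rule polyfuns.var)+
  have "divdiff V (\<lambda>e. f e * g e) (\<lambda>v e. A v e * gx e + fy e * B v e)"
  proof (rule divdiffI)
    fix u :: "'p \<Rightarrow> complex" and x y :: "'v \<Rightarrow> complex" assume eq: "\<forall>v. v \<notin> V \<longrightarrow> x v = y v"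
    have "f (join u x) * g (join u x) - f (join u y) * g (join u y)
      = (f (join u x) - f (join u y)) * g (join u x) + f (join u y) * (g (join u x) - g (join u y))"
      by (simp add: algebra_simps)
    also have "\<dots> = (\<Sum>v\<in>V. (A v (join u (join x y)) * g (join u x) + f (join u y) * B v (join u (join x y))) * (x v - y v))"
      unfolding divdiffD(2)[OF A eq] divdiffD(2)[OF B eq]
      by (simp add: sum.distrib[symmetric] sum_distrib_left sum_distrib_right algebra_simps)
    finally show "f (join u x) * g (join u x) - f (join u y) * g (join u y)
      = (\<Sum>v\<in>V. (A v (join u (join x y)) * gx (join u (join x y)) + fy (join u (join x y)) * B v (join u (join x y))) * (x v - y v))"
      by (simp add: gx_def fy_def)
  qed (intro polyfuns.add polyfuns.mult divdiffD(1)[OF A] divdiffD(1)[OF B] \<open>gx \<in> polyfuns\<close> \<open>fy \<in> polyfuns\<close>)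
  then show ?case by blast
qed

definition partial :: "(('p + 'v \<Rightarrow> complex) \<Rightarrow> complex) \<Rightarrow> 'v \<Rightarrow> ('p \<Rightarrow> complex) \<Rightarrow> ('v \<Rightarrow> complex) \<Rightarrow> complex" where
  "partial f v u x = deriv (\<lambda>z. f (join u (x(v := z)))) (x v)"

lemma partial_eq_divided_difference:
  assumes "finite V" and A: "divdiff V f A" and v: "v \<in> V"
  shows "partial f v u x = A v (join u (join x x))"
  unfolding partial_def
proof (rule DERIV_imp_deriv, unfold CARAT_DERIV, intro exI conjI allI)
  fix z
  have "f (join u (x(v := z))) - f (join u x) = (\<Sum>w\<in>V. A w (join u (join (x(v := z)) x)) * ((x(v := z)) w - x w))"
    by (rule divdiffD(2)[OF A]) (use v in auto)
  also have "\<dots> = (\<Sum>w\<in>V. if w = v then A v (join u (join (x(v := z)) x)) * (z - x v) else 0)"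
    by (intro sum.cong) auto
  also have "\<dots> = A v (join u (join (x(v := z)) x)) * (z - x v)" using assms(1) v by simp
  finally show "f (join u (x(v := z))) - f (join u (x(v := x v))) = A v (join u (join (x(v := z)) x)) * (z - x v)"
    by simp
  show "isCont (\<lambda>z. A v (join u (join (x(v := z)) x))) (x v)"
    unfolding isCont_def fun_upd_triv
  proof (rule polyfuns_tendsto[OF divdiffD(1)[OF A]])
    have "((\<lambda>z. (x(v := z)) w) \<longlongrightarrow> x w) (at (x v))" for w by (cases "w = v") simp_all
    then show "((\<lambda>z. join u (join (x(v := z)) x) w) \<longlongrightarrow> join u (join x x) w) (at (x v))" for w
      by (cases w; cases "projr w") simp_all
  qed
qed simp

text \<open>Taking \<open>{v}\<close> for the set of moving variables leaves a single divided
  difference, whose diagonal is the derivative. Thus vanishing of the Jacobian determinant is a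
  polynomial condition on payoffs and point jointly.\<close>

lemma partial_polyfuns:
  fixes f :: "('p + 'v \<Rightarrow> complex) \<Rightarrow> complex"
  assumes "f \<in> polyfuns"
    and "\<And>p. (\<lambda>e. S e p) \<in> polyfuns" "\<And>v. (\<lambda>e. T e v) \<in> polyfuns"
  shows "(\<lambda>e. partial f v (S e) (T e)) \<in> polyfuns"
proof -
  from polyfuns_divided_difference[of "{v}", OF _ assms(1)] obtain A where A: "divdiff {v} f A" by auto
  have "partial f v u x = A v (join u (join x x))" for u x
    by (rule partial_eq_divided_difference[OF _ A]) simp_all
  moreover have "(\<lambda>e. A v (join (S e) (join (T e) (T e)))) \<in> polyfuns"
    by (rule polyfuns_comp[OF divdiffD(1)[OF A]]) (intro polyfuns_join assms(2,3))
  ultimately show ?thesis by simp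
qed

definition nearby :: "'w set \<Rightarrow> ('w \<Rightarrow> complex) \<Rightarrow> ('w \<Rightarrow> complex) \<Rightarrow> real \<Rightarrow> ('w \<Rightarrow> complex) set" where
  "nearby W s a \<epsilon> = {e. (\<forall>w. w \<notin> W \<longrightarrow> e w = s w) \<and> (\<forall>w\<in>W. dist (e w) (a w) \<le> \<epsilon>)}"

text \<open>Here \<open>s n\<close> carries the moving parameters and \<open>W\<close> the unknowns.
  Otherwise there would be bad points with ever later index and radius \<open>1 / (m + 1)\<close>;
  they converge to \<open>a\<close> in each coordinate, against the continuity of the finitely many
  \<open>g i\<close>.\<close>

lemma polyfuns_uniform:
  fixes g :: "'i \<Rightarrow> ('w \<Rightarrow> complex) \<Rightarrow> complex"
  assumes I: "finite I" and g: "\<And>i. i \<in> I \<Longrightarrow> g i \<in> polyfuns" and s: "\<And>w. w \<notin> W \<Longrightarrow> (\<lambda>n. s n w) \<longlonglongrightarrow> a w"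
    and c: "c > 0"
  shows "\<exists>\<epsilon>>0. \<forall>\<^sub>F n in sequentially. \<forall>e\<in>nearby W (s n) a \<epsilon>. \<forall>i\<in>I. dist (g i e) (g i a) < c"
proof (rule ccontr)
  define ok where "ok n \<epsilon> e \<longleftrightarrow> e \<in> nearby W (s n) a \<epsilon>" for n \<epsilon> e
  define C where "C e \<longleftrightarrow> (\<forall>i\<in>I. dist (g i e) (g i a) < c)" for e
  assume "\<not> ?thesis"
  then have neg: "\<not> (\<exists>\<epsilon>>0. \<forall>\<^sub>F n in sequentially. \<forall>e. ok n \<epsilon> e \<longrightarrow> C e)"
    by (simp add: ok_def C_def Ball_def)
  have "\<forall>m. \<exists>q. fst q \<ge> m \<and> ok (fst q) (inverse (real (Suc m))) (snd q) \<and> \<not> C (snd q)"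
  proof
    fix m
    have "inverse (real (Suc m)) > 0" by simp
    then have "\<not> (\<forall>\<^sub>F n in sequentially. \<forall>e. ok n (inverse (real (Suc m))) e \<longrightarrow> C e)"
      using neg by blast
    then show "\<exists>q. fst q \<ge> m \<and> ok (fst q) (inverse (real (Suc m))) (snd q) \<and> \<not> C (snd q)"
      by (auto simp: eventually_sequentially)
  qed
  from choice[OF this] obtain q where
    q: "\<forall>m. fst (q m) \<ge> m \<and> ok (fst (q m)) (inverse (real (Suc m))) (snd (q m)) \<and> \<not> C (snd (q m))" ..
  define n where "n m = fst (q m)" for m
  define e where "e m = snd (q m)" for m
  have n: "n m \<ge> m" and e: "ok (n m) (inverse (real (Suc m))) (e m)" and bad: "\<not> C (e m)" for m
    using q by (simp_all add: n_def e_def)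
  have nlim: "filterlim n sequentially sequentially"
    by (rule filterlim_at_top_mono[OF filterlim_ident]) (use n in auto)
  have "(\<lambda>m. e m w) \<longlonglongrightarrow> a w" for w
  proof (cases "w \<in> W")
    case True
    have "(\<lambda>m. dist (e m w) (a w)) \<longlonglongrightarrow> 0"
    proof (rule tendsto_sandwich[OF _ _ tendsto_const LIMSEQ_inverse_real_of_nat])
      have "dist (e m w) (a w) \<le> inverse (real (Suc m))" for m
        using e[of m] True by (simp add: ok_def nearby_def del: of_nat_Suc)
      then show "\<forall>\<^sub>F m in sequentially. dist (e m w) (a w) \<le> inverse (real (Suc m))" by simp
    qed simp
    then show ?thesis by (rule tendsto_dist_iff[THEN iffD2])
  next
    case False
    then have "(\<lambda>m. e m w) = (\<lambda>m. s (n m) w)" using e by (auto simp: ok_def nearby_def)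
    then show ?thesis using filterlim_compose[OF s[OF False] nlim] by simp
  qed
  then have "(\<lambda>m. g i (e m)) \<longlonglongrightarrow> g i a" if "i \<in> I" for i
    by (rule polyfuns_tendsto[OF g[OF that]])
  then have "\<forall>i\<in>I. \<forall>\<^sub>F m in sequentially. dist (g i (e m)) (g i a) < c"
    using c by (auto intro: tendstoD)
  then have "\<forall>\<^sub>F m in sequentially. \<forall>i\<in>I. dist (g i (e m)) (g i a) < c"
    by (rule eventually_ball_finite[OF I])
  then obtain m where "\<forall>i\<in>I. dist (g i (e m)) (g i a) < c"
    unfolding eventually_sequentially by blast
  then show False using bad[of m] by (simp add: C_def)
qed

text \<open>
  Applied to \<open>h = B f\<close>, where \<open>B\<close> inverts the Jacobian matrix of \<open>f\<close> at the unperturbed zero, so that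
  \<open>x - h x\<close> is the simplified Newton step.
\<close>

lemma contraction_zero:
  fixes p :: "nat \<Rightarrow> complex" and h :: "nat \<Rightarrow> (nat \<Rightarrow> complex) \<Rightarrow> complex"
  assumes V: "finite V" and \<epsilon>: "\<epsilon> > 0"
    and near_def: "near = {x. (\<forall>v. v \<notin> V \<longrightarrow> x v = p v) \<and> (\<forall>v\<in>V. dist (x v) (p v) \<le> \<epsilon>)}"
    and lip: "\<And>x y b v. x \<in> near \<Longrightarrow> y \<in> near \<Longrightarrow> (\<And>v. v \<in> V \<Longrightarrow> dist (x v) (y v) \<le> b) \<Longrightarrow> v \<in> V \<Longrightarrow>
      dist (x v - h v x) (y v - h v y) \<le> b / 2"
    and small: "\<And>v. v \<in> V \<Longrightarrow> norm (h v p) \<le> \<epsilon> / 2"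
  shows "\<exists>x\<in>near. \<forall>v\<in>V. h v x = 0"
proof -
  define S where "S x v = (if v \<in> V then x v - h v x else p v)" for x v
  define X where "X n = (S ^^ n) p" for n
  have X: "X 0 = p" "X (Suc n) = S (X n)" for n by (simp_all add: X_def)
  \<comment> \<open>The first step has length at most \<open>\<epsilon> / 2\<close> and the bound
    halves each time, so the partial sums \<open>\<epsilon> * (1 - (1/2) ^ n)\<close> keep the
    iterates in \<open>near\<close>.\<close>
  have step: "X n \<in> near \<and> (\<forall>v\<in>V. dist (X (Suc n) v) (X n v) \<le> \<epsilon> * (1/2) ^ Suc n) \<and>
      (\<forall>v\<in>V. dist (X n v) (p v) \<le> \<epsilon> * (1 - (1/2) ^ n))" for n
  proof (induction n)
    case 0
    show ?case using small \<epsilon> by (auto simp: X S_def near_def dist_norm)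
  next
    case (Suc n)
    have dist_p: "dist (X (Suc n) v) (p v) \<le> \<epsilon> * (1 - (1/2) ^ Suc n)" if "v \<in> V" for v
    proof -
      have "dist (X (Suc n) v) (p v) \<le> dist (X (Suc n) v) (X n v) + dist (X n v) (p v)" by (rule dist_triangle)
      also have "\<dots> \<le> \<epsilon> * (1/2) ^ Suc n + \<epsilon> * (1 - (1/2) ^ n)" using Suc that by (intro add_mono) auto
      finally show ?thesis by (simp add: algebra_simps)
    qed
    have "\<epsilon> * (1 - (1/2) ^ Suc n) \<le> \<epsilon>" using \<epsilon> by (simp add: algebra_simps)
    then have near: "X (Suc n) \<in> near"
      using dist_p unfolding near_def by (auto simp: X S_def intro: order_trans)
    moreover have "dist (X (Suc (Suc n)) v) (X (Suc n) v) \<le> \<epsilon> * (1/2) ^ Suc (Suc n)" if "v \<in> V" for v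
    proof -
      have "dist (X (Suc n) v - h v (X (Suc n))) (X n v - h v (X n)) \<le> (\<epsilon> * (1/2) ^ Suc n) / 2"
        by (rule lip[OF near _ _ that]) (use Suc in auto)
      then show ?thesis using that by (simp add: X(2)[of "Suc n"] X(2)[of n] S_def)
    qed
    ultimately show ?case using dist_p by blast
  qed
  have conv: "convergent (\<lambda>n. X n v)" if "v \<in> V" for v
  proof -
    have "summable (\<lambda>n. \<epsilon> * (1/2) ^ Suc n)" by (intro summable_mult summable_mult2 summable_geometric summable_ignore_initial_segment[where k = 1, simplified]) simp
    then have "summable (\<lambda>n. X (Suc n) v - X n v)"
      by (rule summable_comparison_test') (use step that in \<open>auto simp: dist_norm\<close>)
    then have "convergent (\<lambda>n. \<Sum>i<n. X (Suc i) v - X i v)"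
      by (simp add: summable_iff_convergent)
    then have "convergent (\<lambda>n. p v + (\<Sum>i<n. X (Suc i) v - X i v))"
      by (intro convergent_add convergent_const)
    moreover have "(\<Sum>i<n. X (Suc i) v - X i v) = X n v - p v" for n
      using sum_lessThan_telescope[of "\<lambda>i. X i v" n] by (simp add: X(1))
    ultimately show ?thesis by simp
  qed
  define x where "x v = (if v \<in> V then lim (\<lambda>n. X n v) else p v)" for v
  have lim: "(\<lambda>n. X n v) \<longlonglongrightarrow> x v" if "v \<in> V" for v
    using conv[OF that] that by (simp add: x_def convergent_LIMSEQ_iff)
  have near: "x \<in> near"
    unfolding near_def
  proof (intro CollectI conjI allI impI ballI)
    fix v assume v: "v \<in> V"
    have "(\<lambda>n. dist (X n v) (p v)) \<longlonglongrightarrow> dist (x v) (p v)" by (intro tendsto_intros lim v)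
    then show "dist (x v) (p v) \<le> \<epsilon>"
      by (rule LIMSEQ_le_const2) (use step v in \<open>auto simp: near_def\<close>)
  qed (simp add: x_def)
  have "h v x = 0" if v: "v \<in> V" for v
  proof -
    have "(\<lambda>n. \<Sum>w\<in>V. dist (x w) (X n w)) \<longlonglongrightarrow> (\<Sum>w\<in>V. dist (x w) (x w))"
      by (intro tendsto_intros lim)
    then have b: "(\<lambda>n. (\<Sum>w\<in>V. dist (x w) (X n w)) / 2) \<longlonglongrightarrow> 0"
      using tendsto_divide[OF _ tendsto_const[of 2]] by fastforce
    have bound: "dist (X (Suc n) v) (x v - h v x) \<le> (\<Sum>w\<in>V. dist (x w) (X n w)) / 2" for n
    proof -
      have "dist (x v - h v x) (X n v - h v (X n)) \<le> (\<Sum>w\<in>V. dist (x w) (X n w)) / 2"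
      proof (rule lip[OF near _ _ v])
        show "X n \<in> near" using step by simp
        show "dist (x w) (X n w) \<le> (\<Sum>w\<in>V. dist (x w) (X n w))" if "w \<in> V" for w
          by (rule member_le_sum[OF that _ V]) simp
      qed
      then show ?thesis using v by (simp add: X S_def dist_commute)
    qed
    have "(\<lambda>n. dist (X (Suc n) v) (x v - h v x)) \<longlonglongrightarrow> 0"
      by (rule tendsto_sandwich[OF _ _ tendsto_const b]) (use bound in simp_all)
    then have "(\<lambda>n. X (Suc n) v) \<longlonglongrightarrow> x v - h v x" by (rule tendsto_dist_iff[THEN iffD2])
    moreover have "(\<lambda>n. X (Suc n) v) \<longlonglongrightarrow> x v" using lim[OF v] by (rule LIMSEQ_Suc)
    ultimately have "x v - h v x = x v" by (rule LIMSEQ_unique)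
    then show ?thesis by simp
  qed
  with near show ?thesis by blast
qed

theorem nondegenerate_zero_persists:
  fixes f :: "nat \<Rightarrow> ('p + nat \<Rightarrow> complex) \<Rightarrow> complex"
  assumes V: "finite V" and f: "\<And>e. e \<in> V \<Longrightarrow> f e \<in> polyfuns"
    and zero: "\<And>e. e \<in> V \<Longrightarrow> f e (join u0 p) = 0"
    and nondeg: "fdet V (\<lambda>e v. partial (f e) v u0 p) \<noteq> 0"
    and u: "\<And>i. (\<lambda>n. u n i) \<longlonglongrightarrow> u0 i"
  defines "near \<epsilon> \<equiv> {x. (\<forall>v. v \<notin> V \<longrightarrow> x v = p v) \<and> (\<forall>v\<in>V. dist (x v) (p v) \<le> \<epsilon>)}"
  shows "\<exists>\<epsilon>0>0. \<forall>\<epsilon>. 0 < \<epsilon> \<longrightarrow> \<epsilon> \<le> \<epsilon>0 \<longrightarrow> (\<forall>\<^sub>F n in sequentially.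
    (\<exists>x\<in>near \<epsilon>. \<forall>e\<in>V. f e (join (u n) x) = 0) \<and>
    (\<forall>x\<in>near \<epsilon>. \<forall>y\<in>near \<epsilon>. (\<forall>e\<in>V. f e (join (u n) x) = 0) \<longrightarrow> (\<forall>e\<in>V. f e (join (u n) y) = 0) \<longrightarrow> x = y) \<and>
    (\<forall>x\<in>near \<epsilon>. fdet V (\<lambda>e v. partial (f e) v (u n) x) \<noteq> 0))"
proof -
  have "\<forall>e\<in>V. \<exists>A. divdiff V (f e) A" using polyfuns_divided_difference[OF V f] by blast
  from bchoice[OF this] obtain A where A': "\<forall>e\<in>V. divdiff V (f e) (A e)" ..
  note Apoly = divdiffD(1)[OF A'[rule_format]] and A = divdiffD(2)[OF A'[rule_format]]
    and partial = partial_eq_divided_difference[OF V A'[rule_format]]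
  define J where "J e v = A e v (join u0 (join p p))" for e v
  have "fdet V J \<noteq> 0" using nondeg unfolding J_def by (subst fdet_cong[OF V, of _ "\<lambda>e v. partial (f e) v u0 p"]) (simp_all add: partial)
  then obtain B where B: "\<forall>v\<in>V. \<forall>w\<in>V. (\<Sum>e\<in>V. B v e * J e w) = (if v = w then 1 else 0)"
    and B': "\<forall>v\<in>V. \<forall>w\<in>V. (\<Sum>e\<in>V. J v e * B e w) = (if v = w then 1 else 0)"
    using fdet_inverse[OF V, of J] by blast
  define h where "h n v x = (\<Sum>e\<in>V. B v e * f e (join (u n) x))" for n v x
  have h_zero: "(\<forall>v\<in>V. h n v x = 0) \<longleftrightarrow> (\<forall>e\<in>V. f e (join (u n) x) = 0)" for n x
  proof
    assume *: "\<forall>v\<in>V. h n v x = 0"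
    show "\<forall>e\<in>V. f e (join (u n) x) = 0"
    proof
      fix e assume e: "e \<in> V"
      have "0 = (\<Sum>v\<in>V. J e v * h n v x)" using * by simp
      also have "\<dots> = (\<Sum>v\<in>V. \<Sum>w\<in>V. J e v * B v w * f w (join (u n) x))"
        by (simp add: h_def sum_distrib_left mult.assoc)
      also have "\<dots> = (\<Sum>w\<in>V. (\<Sum>v\<in>V. J e v * B v w) * f w (join (u n) x))"
        by (subst sum.swap) (simp add: sum_distrib_right)
      also have "\<dots> = (\<Sum>w\<in>V. if e = w then f w (join (u n) x) else 0)"
        using e by (intro sum.cong) (auto simp: B')
      also have "\<dots> = f e (join (u n) x)" using V e by simp
      finally show "f e (join (u n) x) = 0" by simp
    qed
  qed (simp add: h_def)
  \<comment> \<open>The identity matrix minus \<open>B\<close> times the divided differences. At the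
    unperturbed zero this is 0, as \<open>B\<close> inverts \<open>J\<close>; small entries nearby
    make \<open>x - h x\<close> a contraction.\<close>
  define G where "G = (\<lambda>(v, w) e. (if v = w then 1 else 0) - (\<Sum>i\<in>V. B v i * A i w e))"
  have Gpoly: "G i \<in> polyfuns" if "i \<in> V \<times> V" for i
    using that unfolding G_def by (auto intro!: polyfuns_diff polyfuns.const polyfuns_sum polyfuns.mult Apoly)
  have G0: "G i (join u0 (join p p)) = 0" if "i \<in> V \<times> V" for i
    using that B by (auto simp: G_def J_def)
  define D where "D e = fdet V (\<lambda>i v. A i v e)" for e
  have Dpoly: "D \<in> polyfuns" unfolding D_def by (intro fdet_polyfuns V Apoly)
  have "J = (\<lambda>e v. A e v (join u0 (join p p)))" by (intro ext) (simp add: J_def)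
  then have D0: "D (join u0 (join p p)) \<noteq> 0" using \<open>fdet V J \<noteq> 0\<close> by (simp add: D_def)
  define W :: "('p + nat + nat) set" where "W = {w. case w of Inl _ \<Rightarrow> False | Inr (Inl v) \<Rightarrow> v \<in> V | Inr (Inr v) \<Rightarrow> v \<in> V}"
  define s where "s n = join (u n) (join p p)" for n
  have s: "(\<lambda>n. s n w) \<longlonglongrightarrow> join u0 (join p p) w" if "w \<notin> W" for w
    unfolding s_def using u by (simp split: sum.split)
  define E where "E n \<epsilon> = nearby W (s n) (join u0 (join p p)) \<epsilon>" for n \<epsilon>
  have njoin: "join (u n) (join x y) \<in> E n \<epsilon>" if "x \<in> near \<epsilon>" "y \<in> near \<epsilon>" for n x y \<epsilon>
    using that unfolding E_def W_def s_def near_def nearby_def by (auto split: sum.splits)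
  \<comment> \<open>Entries below \<open>c\<close> make every row sum at most 1/2, the contraction
    factor. The summand 1 keeps the denominator positive for empty \<open>V\<close>.\<close>
  define c where "c = 1 / (2 * (real (card V) + 1))"
  have c: "c > 0" "real (card V) * c \<le> 1/2" by (auto simp: c_def field_simps)
  have "\<exists>\<epsilon>>0. \<forall>\<^sub>F n in sequentially. \<forall>e\<in>E n \<epsilon>. \<forall>i\<in>V \<times> V. dist (G i e) (G i (join u0 (join p p))) < c"
    unfolding E_def by (rule polyfuns_uniform[OF _ Gpoly s c(1)]) (use V in simp)
  then obtain \<epsilon>1 where \<epsilon>1: "\<epsilon>1 > 0"
      "\<forall>\<^sub>F n in sequentially. \<forall>e\<in>E n \<epsilon>1. \<forall>i\<in>V \<times> V. dist (G i e) (G i (join u0 (join p p))) < c"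
    by auto
  \<comment> \<open>The singleton index set stands for the one function \<open>D\<close>; a
    deviation smaller than the norm of its limit value excludes \<open>D e = 0\<close>.\<close>
  have "\<exists>\<epsilon>>0. \<forall>\<^sub>F n in sequentially. \<forall>e\<in>E n \<epsilon>. \<forall>i\<in>{()}. dist (D e) (D (join u0 (join p p))) < norm (D (join u0 (join p p)))"
    unfolding E_def by (rule polyfuns_uniform[OF _ Dpoly s]) (use D0 in simp_all)
  then obtain \<epsilon>2 where \<epsilon>2: "\<epsilon>2 > 0"
      "\<forall>\<^sub>F n in sequentially. \<forall>e\<in>E n \<epsilon>2. dist (D e) (D (join u0 (join p p))) < norm (D (join u0 (join p p)))"
    by auto
  show ?thesis
  proof (intro exI[of _ "min \<epsilon>1 \<epsilon>2"] conjI allI impI)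
    show "min \<epsilon>1 \<epsilon>2 > 0" using \<epsilon>1 \<epsilon>2 by simp
    fix \<epsilon> assume \<epsilon>: "0 < \<epsilon>" "\<epsilon> \<le> min \<epsilon>1 \<epsilon>2"
    have hlim: "(\<lambda>n. h n v p) \<longlonglongrightarrow> 0" if "v \<in> V" for v
    proof -
      have "(\<lambda>n. f e (join (u n) p)) \<longlonglongrightarrow> f e (join u0 p)" if "e \<in> V" for e
      proof (rule polyfuns_tendsto[OF f[OF that]])
        show "(\<lambda>n. join (u n) p w) \<longlonglongrightarrow> join u0 p w" for w using u by (cases w) auto
      qed
      then have "(\<lambda>n. h n v p) \<longlonglongrightarrow> (\<Sum>e\<in>V. B v e * f e (join u0 p))"
        unfolding h_def by (intro tendsto_sum tendsto_mult tendsto_const)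
      then show ?thesis using zero by simp
    qed
    have "\<forall>\<^sub>F n in sequentially. \<forall>v\<in>V. norm (h n v p) \<le> \<epsilon> / 2"
    proof (intro eventually_ball_finite V ballI)
      fix v assume "v \<in> V"
      have "\<forall>\<^sub>F n in sequentially. dist (h n v p) 0 < \<epsilon> / 2"
        using hlim[OF \<open>v \<in> V\<close>] \<epsilon>(1) by (intro tendstoD) auto
      then show "\<forall>\<^sub>F n in sequentially. norm (h n v p) \<le> \<epsilon> / 2"
        by (rule eventually_mono) simp
    qed
    with \<epsilon>1(2) \<epsilon>2(2) show "\<forall>\<^sub>F n in sequentially.
      (\<exists>x\<in>near \<epsilon>. \<forall>e\<in>V. f e (join (u n) x) = 0) \<and>
      (\<forall>x\<in>near \<epsilon>. \<forall>y\<in>near \<epsilon>. (\<forall>e\<in>V. f e (join (u n) x) = 0) \<longrightarrow> (\<forall>e\<in>V. f e (join (u n) y) = 0) \<longrightarrow> x = y) \<and>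
      (\<forall>x\<in>near \<epsilon>. fdet V (\<lambda>e v. partial (f e) v (u n) x) \<noteq> 0)"
    proof eventually_elim
      case (elim n)
      have near_mono: "x \<in> near \<epsilon>1" "x \<in> near \<epsilon>2" if "x \<in> near \<epsilon>" for x
        using that \<epsilon>(2) unfolding near_def by force+
      have small: "norm (G (v, w) (join (u n) (join x y))) \<le> c"
        if "x \<in> near \<epsilon>" "y \<in> near \<epsilon>" "v \<in> V" "w \<in> V" for x y v w
      proof -
        have "\<forall>i\<in>V \<times> V. dist (G i (join (u n) (join x y))) (G i (join u0 (join p p))) < c"
          using elim(1) njoin[OF near_mono(1) near_mono(1), OF that(1,2)] by blast
        then show ?thesis using that(3,4) G0[of "(v, w)"] by force
      qed
      have diff: "(x v - h n v x) - (y v - h n v y) = (\<Sum>w\<in>V. G (v, w) (join (u n) (join x y)) * (x w - y w))"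
        if "x \<in> near \<epsilon>" "y \<in> near \<epsilon>" "v \<in> V" for x y v
      proof -
        have eq: "x w = y w" if "w \<notin> V" for w using that \<open>x \<in> near \<epsilon>\<close> \<open>y \<in> near \<epsilon>\<close> by (simp add: near_def)
        have "h n v x - h n v y = (\<Sum>e\<in>V. B v e * (f e (join (u n) x) - f e (join (u n) y)))"
          by (simp add: h_def sum_subtractf right_diff_distrib)
        also have "\<dots> = (\<Sum>e\<in>V. \<Sum>w\<in>V. B v e * A e w (join (u n) (join x y)) * (x w - y w))"
          by (intro sum.cong refl) (simp add: A eq sum_distrib_left mult.assoc)
        also have "\<dots> = (\<Sum>w\<in>V. (\<Sum>e\<in>V. B v e * A e w (join (u n) (join x y))) * (x w - y w))"
          by (subst sum.swap) (simp add: sum_distrib_right)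
        finally have 1: "h n v x - h n v y = \<dots>" .
        have 2: "x v - y v = (\<Sum>w\<in>V. (if v = w then 1 else 0) * (x w - y w))"
          using V that(3) by (simp add: if_distrib[of "\<lambda>a. a * _"] cong: if_cong)
        have "(x v - h n v x) - (y v - h n v y) = (x v - y v) - (h n v x - h n v y)" by simp
        also have "\<dots> = (\<Sum>w\<in>V. G (v, w) (join (u n) (join x y)) * (x w - y w))"
          unfolding 1 2 by (simp add: G_def left_diff_distrib sum_subtractf)
        finally show ?thesis .
      qed
      have lip: "dist (x v - h n v x) (y v - h n v y) \<le> b / 2"
        if "x \<in> near \<epsilon>" "y \<in> near \<epsilon>" "\<And>v. v \<in> V \<Longrightarrow> dist (x v) (y v) \<le> b" "v \<in> V" for x y b v
      proof -
        have b: "b \<ge> 0" using that(3)[OF that(4)] by (meson order_trans zero_le_dist)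
        have "dist (x v - h n v x) (y v - h n v y) \<le> (\<Sum>w\<in>V. norm (G (v, w) (join (u n) (join x y)) * (x w - y w)))"
          unfolding dist_norm diff[OF that(1,2,4)] by (rule norm_sum)
        also have "\<dots> \<le> (\<Sum>w\<in>V. c * b)"
          unfolding norm_mult
          by (intro sum_mono mult_mono small that) (use that(3) c b in \<open>auto simp: dist_norm\<close>)
        also have "\<dots> = real (card V) * c * b" by simp
        also have "\<dots> \<le> 1/2 * b" using c(2) b by (intro mult_right_mono)
        finally show ?thesis by simp
      qed
      have "\<exists>x\<in>near \<epsilon>. \<forall>v\<in>V. h n v x = 0"
        by (rule contraction_zero[OF V \<epsilon>(1), of "near \<epsilon>" p])
           (use lip elim(3) in \<open>auto simp: near_def\<close>)
      moreover have "x = y" if xy: "x \<in> near \<epsilon>" "y \<in> near \<epsilon>" "\<forall>v\<in>V. h n v x = 0" "\<forall>v\<in>V. h n v y = 0" for x y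
      proof (cases "V = {}")
        case True
        then show ?thesis using xy(1,2) by (auto simp: near_def)
      next
        case False
        \<comment> \<open>The largest distance \<open>b\<close> is attained at some coordinate,
          where the contraction bounds it by \<open>b / 2\<close>.\<close>
        define b where "b = Max ((\<lambda>v. dist (x v) (y v)) ` V)"
        have b: "v \<in> V \<Longrightarrow> dist (x v) (y v) \<le> b" for v unfolding b_def using V by simp
        have "b \<in> (\<lambda>v. dist (x v) (y v)) ` V" unfolding b_def using V False by (intro Max_in) auto
        then obtain v where v: "v \<in> V" "b = dist (x v) (y v)" by auto
        have "dist (x v) (y v) \<le> b / 2" using lip[OF xy(1,2) b v(1)] xy(3,4) v(1) by simp
        then have "b \<le> 0" using v(2) by simp
        then have "x v = y v" if "v \<in> V" for v using b[OF that] by (meson dist_le_zero_iff order_trans)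
        moreover have "x v = y v" if "v \<notin> V" for v using that xy(1,2) by (simp add: near_def)
        ultimately show ?thesis by blast
      qed
      moreover have "fdet V (\<lambda>e v. partial (f e) v (u n) x) \<noteq> 0" if "x \<in> near \<epsilon>" for x
      proof -
        have "dist (D (join (u n) (join x x))) (D (join u0 (join p p))) < norm (D (join u0 (join p p)))"
          using elim(2) njoin[OF near_mono(2) near_mono(2), OF that that] by blast
        then have "D (join (u n) (join x x)) \<noteq> 0" by (auto simp: dist_norm)
        moreover have "fdet V (\<lambda>e v. partial (f e) v (u n) x) = D (join (u n) (join x x))"
          unfolding D_def by (intro fdet_cong V partial)
        ultimately show ?thesis by simp
      qed
      ultimately show ?case unfolding h_zero by blast
    qed
  qed
qed

section \<open>Balanced factors and assignments\<close>

text \<open>A product of multinomial coefficients, one for each fibre of \<open>\<pi>\<close>. When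
  \<open>e\<close> is added to the fibre of \<open>p0\<close>, the functions sending
  \<open>e\<close> to \<open>j\<close> make up the share \<open>c p0 j / Suc (n p0)\<close> of the
  total, and these shares sum to 1.\<close>

lemma multinomial_count:
  fixes \<pi> :: "'e \<Rightarrow> 'p" and J :: "'j set"
  assumes "finite I" "finite P" "finite J" "\<pi> ` I \<subseteq> P"
    and "\<And>p. p \<in> P \<Longrightarrow> (\<Sum>j\<in>J. c p j) = card {e\<in>I. \<pi> e = p}"
  shows "real (card {g \<in> PiE I (\<lambda>_. J). \<forall>p\<in>P. \<forall>j\<in>J. card {e\<in>I. \<pi> e = p \<and> g e = j} = c p j})
    = (\<Prod>p\<in>P. fact (card {e\<in>I. \<pi> e = p}) / (\<Prod>j\<in>J. fact (c p j)))"
  using assms(1,4,5)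
proof (induction I arbitrary: c rule: finite_induct)
  case empty
  then have "c p j = 0" if "p \<in> P" "j \<in> J" for p j
    using empty(2)[OF that(1)] assms(3) that(2) by simp
  then show ?case by simp
next
  case (insert e I)
  define G where "G I c = {g \<in> PiE I (\<lambda>_. J). \<forall>p\<in>P. \<forall>j\<in>J. card {e\<in>I. \<pi> e = p \<and> g e = j} = c p j}"
    for I :: "'e set" and c :: "'p \<Rightarrow> 'j \<Rightarrow> nat"
  define p0 where "p0 = \<pi> e"
  define n where "n p = card {e\<in>I. \<pi> e = p}" for p
  \<comment> \<open>What remains to be distributed once \<open>e\<close> is sent to
    \<open>j\<close>; restricting \<open>j\<close> to \<open>J'\<close> keeps the subtraction on
    naturals exact.\<close>
  define c' where "c' j = c(p0 := (c p0)(j := c p0 j - 1))" for j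
  define J' where "J' = {j\<in>J. c p0 j > 0}"
  define X where "X = (\<Prod>p\<in>P. fact (card {e'\<in>insert e I. \<pi> e' = p}) / (\<Prod>j\<in>J. fact (c p j)) :: real)"
  have p0: "p0 \<in> P" using insert.prems(1) by (simp add: p0_def)
  have card_insert_e: "card {e'\<in>insert e I. \<pi> e' = p \<and> Q e'} = (if \<pi> e = p \<and> Q e then 1 else 0) + card {e'\<in>I. \<pi> e' = p \<and> Q e'}"
    for p Q
  proof (cases "\<pi> e = p \<and> Q e")
    case True
    then have "{e'\<in>insert e I. \<pi> e' = p \<and> Q e'} = insert e {e'\<in>I. \<pi> e' = p \<and> Q e'}" by auto
    then show ?thesis using True insert.hyps by simp
  next
    case False
    then have "{e'\<in>insert e I. \<pi> e' = p \<and> Q e'} = {e'\<in>I. \<pi> e' = p \<and> Q e'}" by auto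
    then show ?thesis using False by simp
  qed
  have n_insert: "card {e'\<in>insert e I. \<pi> e' = p} = (if p = p0 then Suc (n p) else n p)" for p
    using card_insert_e[of p "\<lambda>_. True"] by (auto simp: n_def p0_def)
  have upd: "card {e'\<in>insert e I. \<pi> e' = p \<and> (g(e := j)) e' = i} = (if p = p0 \<and> i = j then 1 else 0) + card {e'\<in>I. \<pi> e' = p \<and> g e' = i}"
    for g p i j
  proof -
    have "{e'\<in>I. \<pi> e' = p \<and> (g(e := j)) e' = i} = {e'\<in>I. \<pi> e' = p \<and> g e' = i}" using insert.hyps(2) by auto
    then show ?thesis using card_insert_e[of p "\<lambda>e'. (g(e := j)) e' = i"] by (auto simp: p0_def)
  qed
  have mem: "g(e := j) \<in> G (insert e I) c \<longleftrightarrow> g \<in> G I (c' j)" if "j \<in> J'" "g \<in> PiE I (\<lambda>_. J)" for g j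
  proof -
    have "g(e := j) \<in> PiE (insert e I) (\<lambda>_. J)"
      using that by (auto simp: J'_def PiE_def extensional_def Pi_def)
    moreover have "(if p = p0 \<and> i = j then 1 else 0) + x = c p i \<longleftrightarrow> x = c' j p i" for p i x
      using that(1) by (auto simp: c'_def J'_def)
    ultimately show ?thesis using that(2) unfolding G_def mem_Collect_eq upd by simp
  qed
  have G_eq: "G (insert e I) c = (\<Union>j\<in>J'. (\<lambda>g. g(e := j)) ` G I (c' j))"
  proof (intro equalityI subsetI)
    fix g assume g: "g \<in> G (insert e I) c"
    define h where "h = g(e := undefined)"
    have h: "h \<in> PiE I (\<lambda>_. J)" using g insert.hyps(2) by (auto simp: G_def h_def PiE_def extensional_def Pi_def)
    have gh: "g = h(e := g e)" by (simp add: h_def)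
    have "g e \<in> J" using g by (auto simp: G_def)
    moreover have "c p0 (g e) > 0"
    proof -
      have "card {e'\<in>insert e I. \<pi> e' = p0 \<and> g e' = g e} = c p0 (g e)" using g p0 \<open>g e \<in> J\<close> by (simp add: G_def)
      moreover have "e \<in> {e'\<in>insert e I. \<pi> e' = p0 \<and> g e' = g e}" by (simp add: p0_def)
      ultimately show ?thesis using insert.hyps(1) by (metis (no_types, lifting) card_gt_0_iff empty_iff finite_insert finite_subset mem_Collect_eq subsetI)
    qed
    ultimately have "g e \<in> J'" by (simp add: J'_def)
    moreover have "h \<in> G I (c' (g e))" using mem[OF \<open>g e \<in> J'\<close> h] gh g by simp
    ultimately show "g \<in> (\<Union>j\<in>J'. (\<lambda>g. g(e := j)) ` G I (c' j))" using gh by blast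
  next
    fix g assume "g \<in> (\<Union>j\<in>J'. (\<lambda>g. g(e := j)) ` G I (c' j))"
    then obtain j h where "j \<in> J'" "h \<in> G I (c' j)" "g = h(e := j)" by blast
    moreover have "h \<in> PiE I (\<lambda>_. J)" using \<open>h \<in> G I (c' j)\<close> by (simp add: G_def)
    ultimately show "g \<in> G (insert e I) c" using mem by blast
  qed
  have fin: "finite (G I (c' j))" for j
    unfolding G_def using insert.hyps(1) assms(3) by (simp add: finite_PiE)
  have "card (G (insert e I) c) = (\<Sum>j\<in>J'. card ((\<lambda>g. g(e := j)) ` G I (c' j)))"
    unfolding G_eq
  proof (rule card_UN_disjoint)
    show "\<forall>i\<in>J'. \<forall>j\<in>J'. i \<noteq> j \<longrightarrow> (\<lambda>g. g(e := i)) ` G I (c' i) \<inter> (\<lambda>g. g(e := j)) ` G I (c' j) = {}"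
      by (auto dest: fun_cong[of _ _ e])
  qed (use assms(3) fin in \<open>auto simp: J'_def\<close>)
  also have "\<dots> = (\<Sum>j\<in>J'. card (G I (c' j)))"
  proof (intro sum.cong refl card_image inj_onI)
    fix j g h assume g: "g \<in> G I (c' j)" "h \<in> G I (c' j)" and eq: "g(e := j) = h(e := j)"
    show "g = h"
    proof
      fix x
      show "g x = h x"
      proof (cases "x = e")
        case True
        then show ?thesis using g insert.hyps(2) by (auto simp: G_def PiE_def extensional_def)
      next
        case False
        then show ?thesis using fun_cong[OF eq, of x] by simp
      qed
    qed
  qed
  finally have "real (card (G (insert e I) c)) = (\<Sum>j\<in>J'. real (card (G I (c' j))))" by simp
  also have "\<dots> = (\<Sum>j\<in>J'. X * (real (c p0 j) / real (Suc (n p0))))"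
  proof (intro sum.cong refl)
    fix j assume j: "j \<in> J'"
    have sum_c': "(\<Sum>i\<in>J. c' j p i) = card {e\<in>I. \<pi> e = p}" if "p \<in> P" for p
    proof (cases "p = p0")
      case True
      have "(\<Sum>i\<in>J. c p0 i) = Suc (n p0)" using insert.prems(2)[OF p0] n_insert by simp
      moreover have "(\<Sum>i\<in>J. c p0 i) = c p0 j + (\<Sum>i\<in>J-{j}. c p0 i)" "(\<Sum>i\<in>J. c' j p0 i) = (c p0 j - 1) + (\<Sum>i\<in>J-{j}. c p0 i)"
        using j assms(3) by (auto simp: J'_def c'_def sum.remove[of J j])
      ultimately show ?thesis using True j by (simp add: J'_def n_def)
    next
      case False
      then show ?thesis using insert.prems(2)[OF that] n_insert by (simp add: c'_def n_def)
    qed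
    have "real (card (G I (c' j))) = (\<Prod>p\<in>P. fact (n p) / (\<Prod>i\<in>J. fact (c' j p i)))"
      unfolding G_def n_def by (rule insert.IH) (use insert.prems(1) sum_c' in auto)
    also have "\<dots> = fact (n p0) / (\<Prod>i\<in>J. fact (c' j p0 i)) * (\<Prod>p\<in>P-{p0}. fact (n p) / (\<Prod>i\<in>J. fact (c' j p i)))"
      by (rule prod.remove[OF assms(2) p0])
    also have "(\<Prod>p\<in>P-{p0}. fact (n p) / (\<Prod>i\<in>J. fact (c' j p i))) = (\<Prod>p\<in>P-{p0}. fact (card {e'\<in>insert e I. \<pi> e' = p}) / (\<Prod>i\<in>J. fact (c p i)) :: real)"
    proof (intro prod.cong refl)
      fix p assume "p \<in> P - {p0}"
      then have "p \<noteq> p0" by simp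
      then show "fact (n p) / (\<Prod>i\<in>J. fact (c' j p i)) = (fact (card {e'\<in>insert e I. \<pi> e' = p}) / (\<Prod>i\<in>J. fact (c p i)) :: real)"
        by (simp add: n_insert c'_def del: insert_iff)
    qed
    also have "(\<Prod>i\<in>J. fact (c' j p0 i) :: real) = (\<Prod>i\<in>J. fact (c p0 i)) / real (c p0 j)"
    proof -
      have "(\<Prod>i\<in>J. fact (c' j p0 i) :: real) = fact (c p0 j - 1) * (\<Prod>i\<in>J-{j}. fact (c p0 i))"
        using j assms(3) by (simp add: J'_def c'_def prod.remove[of J j])
      moreover have "(\<Prod>i\<in>J. fact (c p0 i) :: real) = fact (c p0 j) * (\<Prod>i\<in>J-{j}. fact (c p0 i))"
        using j assms(3) by (simp add: J'_def prod.remove[of J j])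
      moreover have "fact (c p0 j) = real (c p0 j) * fact (c p0 j - 1)" using j by (simp add: J'_def fact_reduce)
      ultimately show ?thesis using j by (simp add: J'_def)
    qed
    also have "fact (n p0) / ((\<Prod>i\<in>J. fact (c p0 i)) / real (c p0 j))
        = fact (card {e'\<in>insert e I. \<pi> e' = p0}) / (\<Prod>i\<in>J. fact (c p0 i)) * (real (c p0 j) / real (Suc (n p0)))"
      by (simp add: n_insert del: of_nat_Suc insert_iff)
    finally have "real (card (G I (c' j))) = (fact (card {e'\<in>insert e I. \<pi> e' = p0}) / (\<Prod>i\<in>J. fact (c p0 i)) *
        (\<Prod>p\<in>P-{p0}. fact (card {e'\<in>insert e I. \<pi> e' = p}) / (\<Prod>i\<in>J. fact (c p i)))) * (real (c p0 j) / real (Suc (n p0)))"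
      by simp
    also have "\<dots> = X * (real (c p0 j) / real (Suc (n p0)))"
      unfolding X_def by (subst prod.remove[OF assms(2) p0]) (rule refl)
    finally show "real (card (G I (c' j))) = X * (real (c p0 j) / real (Suc (n p0)))" .
  qed
  also have "\<dots> = X * (real (\<Sum>j\<in>J'. c p0 j) / real (Suc (n p0)))"
    by (simp add: sum_distrib_left[symmetric] sum_divide_distrib[symmetric])
  also have "(\<Sum>j\<in>J'. c p0 j) = (\<Sum>j\<in>J. c p0 j)"
    by (rule sum.mono_neutral_left) (use assms(3) in \<open>auto simp: J'_def\<close>)
  also have "(\<Sum>j\<in>J. c p0 j) = Suc (n p0)" using insert.prems(2)[OF p0] n_insert by simp
  finally show ?case unfolding G_def X_def by (simp del: of_nat_Suc)
qed

definition eqs :: "nat \<Rightarrow> (nat \<Rightarrow> nat) \<Rightarrow> (nat \<times> nat) set" where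
  "eqs N k = {(i, s). i \<in> {1..N} \<and> s \<in> {1..k i}}"

text \<open>Choices of one summand in each factor of the product of the
  \<open>(\<Sum>j\<in>in_nbrs E i. z j) ^ k i\<close> that produce the monomial with exponent
  \<open>k\<close>; their number is the coefficient of that monomial.\<close>

definition assignments :: "nat \<Rightarrow> (nat \<Rightarrow> nat) \<Rightarrow> (nat \<times> nat) set \<Rightarrow> (nat \<times> nat \<Rightarrow> nat) set" where
  "assignments N k E = {\<sigma> \<in> PiE (eqs N k) (\<lambda>e. in_nbrs E (fst e)). \<forall>q\<in>{1..N}. card {e\<in>eqs N k. \<sigma> e = q} = k q}"

lemma eqs_Sigma: "eqs N k = Sigma {1..N} (\<lambda>i. {1..k i})"
  by (auto simp: eqs_def)

lemma finite_eqs: "finite (eqs N k)" and card_eqs: "card (eqs N k) = (\<Sum>i\<in>{1..N}. k i)"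
  by (simp_all add: eqs_Sigma)

lemma card_eqs_fst: "i \<in> {1..N} \<Longrightarrow> card {e\<in>eqs N k. fst e = i} = k i"
proof -
  assume "i \<in> {1..N}"
  then have "{e\<in>eqs N k. fst e = i} = Pair i ` {1..k i}" by (auto simp: eqs_def)
  then show ?thesis by (simp add: card_image inj_on_def)
qed

lemma in_nbrs_subset: "E \<subseteq> arcs N \<Longrightarrow> in_nbrs E i \<subseteq> {1..N} - {i}"
  by (auto simp: in_nbrs_def arcs_def)

lemma finite_in_nbrs: "E \<subseteq> arcs N \<Longrightarrow> finite (in_nbrs E i)"
  by (rule finite_subset[OF in_nbrs_subset]) auto

lemma finite_arcs: "finite (arcs N)"
  by (rule finite_subset[of _ "{1..N} \<times> {1..N}"]) (auto simp: arcs_def)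

lemma finite_balanced_factors: "finite (balanced_factors N k)"
proof (rule finite_subset)
  show "balanced_factors N k \<subseteq> PiE (arcs N) (\<lambda>(j, i). {..k i})"
  proof
    fix a assume a: "a \<in> balanced_factors N k"
    have "a (j, i) \<le> k i" if "(j, i) \<in> arcs N" for j i
    proof -
      have "(\<Sum>j\<in>{1..N} - {i}. a (j, i)) = k i" using a that by (simp add: balanced_factors_def arcs_def)
      moreover have "a (j, i) \<le> (\<Sum>j\<in>{1..N} - {i}. a (j, i))"
        by (rule member_le_sum) (use that in \<open>auto simp: arcs_def\<close>)
      ultimately show ?thesis by simp
    qed
    then show "a \<in> PiE (arcs N) (\<lambda>(j, i). {..k i})" using a by (auto simp: balanced_factors_def PiE_def)
  qed
qed (auto intro!: finite_PiE finite_arcs)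

text \<open>Once the counts are prescribed by \<open>a\<close>, the other conditions on an
  assignment are automatic: the support of \<open>a\<close> lies in \<open>E\<close>, which gives
  in-neighbours, and the sums of \<open>a\<close> over outgoing arcs give the usage
  \<open>k q\<close>. What remains is a multinomial count.\<close>

lemma card_assignments_factor:
  assumes E: "E \<subseteq> arcs N" and a: "a \<in> balanced_factors N k" "factor_support N a \<subseteq> E"
  shows "real (card {\<sigma> \<in> assignments N k E. \<forall>(j, i)\<in>arcs N. card {e\<in>eqs N k. fst e = i \<and> \<sigma> e = j} = a (j, i)})
    = factor_weight N k a"
proof -
  \<comment> \<open>Balanced factors have no loops; the zero diagonal lets the count run over the
    full square of players.\<close>
  define c where "c i j = (if i = j then 0 else a (j, i))" for i j
  have csum1: "(\<Sum>j\<in>{1..N}. c i j) = k i" if "i \<in> {1..N}" for i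
  proof -
    have "(\<Sum>j\<in>{1..N}. c i j) = (\<Sum>j\<in>{1..N}-{i}. a (j, i))"
      using that by (subst sum.remove[of _ i]) (auto simp: c_def intro!: sum.cong)
    then show ?thesis using a(1) that by (simp add: balanced_factors_def)
  qed
  have csum2: "(\<Sum>i\<in>{1..N}. c i j) = k j" if "j \<in> {1..N}" for j
  proof -
    have "(\<Sum>i\<in>{1..N}. c i j) = (\<Sum>i\<in>{1..N}-{j}. a (j, i))"
      using that by (subst sum.remove[of _ j]) (auto simp: c_def intro!: sum.cong)
    then show ?thesis using a(1) that by (simp add: balanced_factors_def)
  qed
  have "{\<sigma> \<in> assignments N k E. \<forall>(j, i)\<in>arcs N. card {e\<in>eqs N k. fst e = i \<and> \<sigma> e = j} = a (j, i)}
    = {g \<in> PiE (eqs N k) (\<lambda>_. {1..N}). \<forall>p\<in>{1..N}. \<forall>j\<in>{1..N}. card {e\<in>eqs N k. fst e = p \<and> g e = j} = c p j}"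
    (is "?L = ?R")
  proof (intro equalityI subsetI)
    fix g assume g: "g \<in> ?L"
    have nb: "g e \<in> in_nbrs E (fst e)" if "e \<in> eqs N k" for e using g that by (auto simp: assignments_def)
    have "g e \<in> {1..N}" if "e \<in> eqs N k" for e using nb[OF that] in_nbrs_subset[OF E, of "fst e"] by blast
    then have "g \<in> PiE (eqs N k) (\<lambda>_. {1..N})"
      using g unfolding assignments_def PiE_def Pi_def by blast
    moreover have "card {e\<in>eqs N k. fst e = p \<and> g e = j} = c p j" if "p \<in> {1..N}" "j \<in> {1..N}" for p j
    proof (cases "p = j")
      case True
      have "g e \<noteq> fst e" if "e \<in> eqs N k" for e using nb[OF that] in_nbrs_subset[OF E, of "fst e"] by auto
      then have "{e\<in>eqs N k. fst e = p \<and> g e = j} = {}" using True by auto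
      then have "card {e\<in>eqs N k. fst e = p \<and> g e = j} = 0" by (simp only: card.empty)
      then show ?thesis using True by (simp add: c_def)
    next
      case False
      then have "(j, p) \<in> arcs N" using that by (auto simp: arcs_def)
      then show ?thesis using g False by (auto simp: c_def)
    qed
    ultimately show "g \<in> ?R" by blast
  next
    fix g assume g: "g \<in> ?R"
    have gc: "card {e\<in>eqs N k. fst e = p \<and> g e = j} = c p j" if "p \<in> {1..N}" "j \<in> {1..N}" for p j
      using g that by blast
    have "g e \<in> in_nbrs E (fst e)" if e: "e \<in> eqs N k" for e
    proof -
      have 1: "fst e \<in> {1..N}" "g e \<in> {1..N}" using e g by (auto simp: eqs_def)
      have "e \<in> {e'\<in>eqs N k. fst e' = fst e \<and> g e' = g e}" using e by simp
      then have "{e'\<in>eqs N k. fst e' = fst e \<and> g e' = g e} \<noteq> {}" by blast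
      then have "card {e'\<in>eqs N k. fst e' = fst e \<and> g e' = g e} > 0"
        unfolding card_gt_0_iff using finite_eqs[of N k] by simp
      then have "c (fst e) (g e) > 0" using gc[OF 1] by simp
      then have "(g e, fst e) \<in> factor_support N a" using 1 by (auto simp: c_def factor_support_def arcs_def split: if_splits)
      then show ?thesis using a(2) by (auto simp: in_nbrs_def)
    qed
    moreover have "card {e\<in>eqs N k. g e = q} = k q" if q: "q \<in> {1..N}" for q
    proof -
      have "card {e\<in>eqs N k. g e = q} = card (\<Union>i\<in>{1..N}. {e\<in>eqs N k. fst e = i \<and> g e = q})"
        by (rule arg_cong[of _ _ card]) (auto simp: eqs_def)
      also have "\<dots> = (\<Sum>i\<in>{1..N}. card {e\<in>eqs N k. fst e = i \<and> g e = q})"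
        by (rule card_UN_disjoint) (use finite_eqs in auto)
      also have "\<dots> = k q" using csum2[OF q] gc q by simp
      finally show ?thesis .
    qed
    moreover have "card {e\<in>eqs N k. fst e = i \<and> g e = j} = a (j, i)" if "(j, i) \<in> arcs N" for j i
      using gc[of i j] that by (auto simp: arcs_def c_def)
    ultimately show "g \<in> ?L" using g by (auto simp: assignments_def PiE_def Pi_def)
  qed
  then have "real (card ?L) = real (card ?R)" by simp
  also have "real (card ?R) = (\<Prod>p\<in>{1..N}. fact (card {e\<in>eqs N k. fst e = p}) / (\<Prod>j\<in>{1..N}. fact (c p j)))"
  proof (rule multinomial_count[OF finite_eqs])
    show "fst ` eqs N k \<subseteq> {1..N}" by (auto simp: eqs_def)
    show "(\<Sum>j\<in>{1..N}. c p j) = card {e\<in>eqs N k. fst e = p}" if "p \<in> {1..N}" for p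
      by (simp only: csum1[OF that] card_eqs_fst[OF that])
  qed simp_all
  also have "\<dots> = factor_weight N k a"
    unfolding factor_weight_def
  proof (intro prod.cong refl)
    fix p assume p: "p \<in> {1..N}"
    have "(\<Prod>j\<in>{1..N}. fact (c p j) :: real) = (\<Prod>j\<in>{1..N}-{p}. fact (a (j, p)))"
      using p by (subst prod.remove[of _ p]) (auto simp: c_def intro!: prod.cong)
    then show "fact (card {e\<in>eqs N k. fst e = p}) / (\<Prod>j\<in>{1..N}. fact (c p j)) = fact (k p) / (\<Prod>j\<in>{1..N}-{p}. fact (a (j, p)) :: real)"
      by (simp only: card_eqs_fst[OF p])
  qed
  finally show ?thesis .
qed

lemma finite_assignments: "E \<subseteq> arcs N \<Longrightarrow> finite (assignments N k E)"
  unfolding assignments_def by (intro finite_subset[OF Collect_restrict] finite_PiE finite_eqs finite_in_nbrs)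

text \<open>Two groupings: assignments by their table \<open>cnt\<close>, which is a balanced factor
  supported in \<open>E\<close>, and these factors by their exact support.\<close>

lemma card_assignments:
  assumes E: "E \<subseteq> arcs N"
  shows "real (card (assignments N k E)) = (\<Sum>F\<in>Pow E. exact_support_coeff N k F)"
proof -
  define A where "A = {a \<in> balanced_factors N k. factor_support N a \<subseteq> E}"
  define cnt where "cnt \<sigma> = restrict (\<lambda>(j, i). card {e\<in>eqs N k. fst e = i \<and> \<sigma> e = j}) (arcs N)" for \<sigma> :: "nat \<times> nat \<Rightarrow> nat"
  have finA: "finite A" unfolding A_def using finite_balanced_factors by simp
  have cntA: "cnt \<sigma> \<in> A" if \<sigma>: "\<sigma> \<in> assignments N k E" for \<sigma>
  proof -
    have nb: "\<sigma> e \<in> in_nbrs E (fst e)" if "e \<in> eqs N k" for e using \<sigma> that by (auto simp: assignments_def)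
    have 1: "(\<Sum>j\<in>{1..N} - {i}. cnt \<sigma> (j, i)) = k i" if i: "i \<in> {1..N}" for i
    proof -
      have "(\<Sum>j\<in>{1..N} - {i}. cnt \<sigma> (j, i)) = (\<Sum>j\<in>{1..N} - {i}. card {e\<in>eqs N k. fst e = i \<and> \<sigma> e = j})"
        using i by (intro sum.cong) (auto simp: cnt_def arcs_def)
      also have "\<dots> = card (\<Union>j\<in>{1..N} - {i}. {e\<in>eqs N k. fst e = i \<and> \<sigma> e = j})"
        by (rule card_UN_disjoint[symmetric]) (use finite_eqs in auto)
      also have "(\<Union>j\<in>{1..N} - {i}. {e\<in>eqs N k. fst e = i \<and> \<sigma> e = j}) = {e\<in>eqs N k. fst e = i}"
        using nb in_nbrs_subset[OF E] by fastforce
      finally show ?thesis using card_eqs_fst[OF i] by simp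
    qed
    have 2: "(\<Sum>i\<in>{1..N} - {j}. cnt \<sigma> (j, i)) = k j" if j: "j \<in> {1..N}" for j
    proof -
      have "(\<Sum>i\<in>{1..N} - {j}. cnt \<sigma> (j, i)) = (\<Sum>i\<in>{1..N} - {j}. card {e\<in>eqs N k. fst e = i \<and> \<sigma> e = j})"
        using j by (intro sum.cong) (auto simp: cnt_def arcs_def)
      also have "\<dots> = card (\<Union>i\<in>{1..N} - {j}. {e\<in>eqs N k. fst e = i \<and> \<sigma> e = j})"
        by (rule card_UN_disjoint[symmetric]) (use finite_eqs in auto)
      also have "(\<Union>i\<in>{1..N} - {j}. {e\<in>eqs N k. fst e = i \<and> \<sigma> e = j}) = {e\<in>eqs N k. \<sigma> e = j}"
        using nb in_nbrs_subset[OF E] by (fastforce simp: eqs_def)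
      finally show ?thesis using \<sigma> j by (simp add: assignments_def)
    qed
    have "factor_support N (cnt \<sigma>) \<subseteq> E"
    proof
      fix x assume x: "x \<in> factor_support N (cnt \<sigma>)"
      obtain j i where ji: "x = (j, i)" by fastforce
      have "card {e\<in>eqs N k. fst e = i \<and> \<sigma> e = j} > 0" using x by (auto simp: factor_support_def cnt_def ji)
      then obtain e where "e \<in> eqs N k" "fst e = i" "\<sigma> e = j" by (auto simp: card_gt_0_iff)
      then show "x \<in> E" using nb[of e] by (auto simp: ji in_nbrs_def)
    qed
    then show ?thesis using 1 2 by (auto simp: A_def balanced_factors_def cnt_def)
  qed
  have fib: "{\<sigma> \<in> assignments N k E. cnt \<sigma> = a}
      = {\<sigma> \<in> assignments N k E. \<forall>(j, i)\<in>arcs N. card {e\<in>eqs N k. fst e = i \<and> \<sigma> e = j} = a (j, i)}" if "a \<in> A" for a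
  proof -
    have "cnt \<sigma> = a \<longleftrightarrow> (\<forall>(j, i)\<in>arcs N. card {e\<in>eqs N k. fst e = i \<and> \<sigma> e = j} = a (j, i))" for \<sigma>
    proof
      assume "\<forall>(j, i)\<in>arcs N. card {e\<in>eqs N k. fst e = i \<and> \<sigma> e = j} = a (j, i)"
      then show "cnt \<sigma> = a"
        using that by (intro extensionalityI[of _ "arcs N"]) (auto simp: cnt_def A_def balanced_factors_def PiE_def)
    qed (auto simp: cnt_def)
    then show ?thesis by simp
  qed
  have "real (card (assignments N k E)) = (\<Sum>\<sigma>\<in>assignments N k E. 1)" by simp
  also have "\<dots> = (\<Sum>a\<in>A. \<Sum>\<sigma>\<in>{\<sigma> \<in> assignments N k E. cnt \<sigma> = a}. 1)"
    by (rule sum.group[symmetric]) (use finA finite_assignments[OF E] cntA in auto)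
  also have "\<dots> = (\<Sum>a\<in>A. factor_weight N k a)"
  proof (intro sum.cong refl)
    fix a assume a: "a \<in> A"
    have "(\<Sum>\<sigma>\<in>{\<sigma> \<in> assignments N k E. cnt \<sigma> = a}. 1::real) = real (card {\<sigma> \<in> assignments N k E. cnt \<sigma> = a})" by simp
    also have "\<dots> = factor_weight N k a"
      unfolding fib[OF a] by (rule card_assignments_factor[OF E]) (use a in \<open>auto simp: A_def\<close>)
    finally show "(\<Sum>\<sigma>\<in>{\<sigma> \<in> assignments N k E. cnt \<sigma> = a}. 1) = factor_weight N k a" .
  qed
  also have "\<dots> = (\<Sum>F\<in>Pow E. \<Sum>a\<in>{a\<in>A. factor_support N a = F}. factor_weight N k a)"
    by (rule sum.group[symmetric]) (use finA finite_subset[OF E finite_arcs] in \<open>auto simp: A_def\<close>)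
  also have "\<dots> = (\<Sum>F\<in>Pow E. exact_support_coeff N k F)"
    unfolding exact_support_coeff_def by (intro sum.cong) (auto simp: A_def)
  finally show ?thesis .
qed

section \<open>The special system\<close>

definition coord :: "(nat \<Rightarrow> nat) \<Rightarrow> (nat \<Rightarrow> complex) \<Rightarrow> nat \<Rightarrow> nat \<Rightarrow> complex" where
  "coord k x q t = (if t = 0 then 1 - (\<Sum>r\<in>{1..k q}. x (prod_encode (q, r))) else x (prod_encode (q, t)))"

text \<open>The multihomogeneous form of the indifference equation. The coordinates \<open>h\<close>
  need not sum to 1 in a block, so points at infinity, where such a sum is 0, are included.\<close>

definition hform :: "(nat \<Rightarrow> nat) \<Rightarrow> (nat \<times> nat) set \<Rightarrow> (payoff_index \<Rightarrow> complex) \<Rightarrow> nat \<Rightarrow> nat \<Rightarrow> (nat \<Rightarrow> nat \<Rightarrow> complex) \<Rightarrow> complex" where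
  "hform k E u i s h = (\<Sum>\<alpha>\<in>profiles k E i. (u (i, s, \<alpha>) - u (i, 0, \<alpha>)) * (\<Prod>q\<in>in_nbrs E i. h q (\<alpha> q)))"

lemma cpeval_indifference_poly:
  "cpeval (indifference_poly k E u i s) x = hform k E u i s (coord k x)"
  by (simp add: indifference_poly_def hform_def cpeval_sum cpeval_mult cpeval_prod strategy_prob_def
      coord_def cpeval_diff cpeval_one if_distrib[of "\<lambda>P. cpeval P x"] cong: if_cong)

lemma sum_coord: "(\<Sum>t\<le>k q. coord k x q t) = 1"
proof -
  have "{..k q} = insert 0 {1..k q}" by auto
  then show ?thesis by (simp add: coord_def)
qed

lemma hform_scale: "hform k E u i s (\<lambda>q t. c q * h q t) = (\<Prod>q\<in>in_nbrs E i. c q) * hform k E u i s h"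
  by (simp add: hform_def prod.distrib sum_distrib_left mult_ac)

text \<open>The linear form on block q with coefficient vector (1, z, z^2, ...) on the moment curve.
  Read as a polynomial in z with coefficients \<open>h q t\<close>, it turns linear independence
  into counting roots; at z = 1 it is the coordinate sum.\<close>

definition blk :: "(nat \<Rightarrow> nat) \<Rightarrow> (nat \<Rightarrow> nat \<Rightarrow> complex) \<Rightarrow> nat \<Rightarrow> complex \<Rightarrow> complex" where
  "blk k h q z = (\<Sum>t\<le>k q. h q t * z ^ t)"

text \<open>The offset 2 makes the nodes positive and different from 1, the argument that is
  reserved for the normalization.\<close>

definition node :: "nat \<times> nat \<Rightarrow> complex" where
  "node e = of_nat (prod_encode e + 2)"

text \<open>
  At these payoffs every equation is a product of linear forms, one for each neighbour, and the
  coefficient vectors of the linear forms lie on the moment curve.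
\<close>

definition special_payoff :: "(nat \<times> nat) set \<Rightarrow> payoff_index \<Rightarrow> complex" where
  "special_payoff E = (\<lambda>(i, s, \<alpha>). if s = 0 then 0 else \<Prod>q\<in>in_nbrs E i. node (i, s) ^ \<alpha> q)"

lemma inj_node: "node e = node e' \<longleftrightarrow> e = e'"
  by (simp add: node_def prod_encode_eq del: of_nat_add)

lemma node_neq_1: "node e \<noteq> 1"
  unfolding node_def by (metis One_nat_def add_2_eq_Suc' of_nat_1_eq_iff one_eq_numeral_iff Suc_inject nat.distinct(1))

text \<open>Distributivity: the choice functions in the expanded product of block sums are exactly
  the profiles.\<close>

lemma hform_special:
  assumes E: "E \<subseteq> arcs N" and u: "\<And>w. w \<in> payoff_indices N k E \<Longrightarrow> u w = special_payoff E w"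
    and e: "(i, s) \<in> eqs N k"
  shows "hform k E u i s h = (\<Prod>q\<in>in_nbrs E i. blk k h q (node (i, s)))"
proof -
  have "hform k E u i s h = (\<Sum>\<alpha>\<in>profiles k E i. \<Prod>q\<in>in_nbrs E i. h q (\<alpha> q) * node (i, s) ^ \<alpha> q)"
    unfolding hform_def
  proof (intro sum.cong refl)
    fix \<alpha> assume "\<alpha> \<in> profiles k E i"
    then have "u (i, s, \<alpha>) - u (i, 0, \<alpha>) = (\<Prod>q\<in>in_nbrs E i. node (i, s) ^ \<alpha> q)"
      using e by (simp add: u payoff_indices_def eqs_def special_payoff_def)
    then show "(u (i, s, \<alpha>) - u (i, 0, \<alpha>)) * (\<Prod>q\<in>in_nbrs E i. h q (\<alpha> q))
        = (\<Prod>q\<in>in_nbrs E i. h q (\<alpha> q) * node (i, s) ^ \<alpha> q)"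
      by (simp add: prod.distrib)
  qed
  also have "\<dots> = (\<Prod>q\<in>in_nbrs E i. \<Sum>t\<in>{0..k q}. h q t * node (i, s) ^ t)"
    unfolding profiles_def by (rule prod_sum_PiE[symmetric]) (use finite_in_nbrs[OF E] in auto)
  finally show ?thesis by (simp add: blk_def atLeast0AtMost)
qed

text \<open>The general position of the linear forms: more than \<open>k q\<close> roots force a
  polynomial of degree at most \<open>k q\<close> to vanish identically.\<close>

lemma blk_eq_0:
  assumes "finite S" "card S > k q" "\<And>z. z \<in> S \<Longrightarrow> blk k h q z = 0" "t \<le> k q"
  shows "h q t = 0"
proof (rule ccontr)
  assume "h q t \<noteq> 0"
  then have *: "\<exists>t. t \<le> k q \<and> h q t \<noteq> 0" using assms(4) by blast
  have "card S \<le> card {z. (\<Sum>i\<le>k q. h q i * z ^ i) = 0}"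
    by (rule card_mono[OF polyfun_rootbound_finite[OF *]]) (use assms(3) in \<open>auto simp: blk_def\<close>)
  also have "\<dots> \<le> k q" by (rule polyfun_rootbound_card[OF *])
  finally show False using assms(2) by simp
qed

section \<open>Zeros of the special system\<close>

definition node_poly :: "(nat \<times> nat) set \<Rightarrow> complex poly" where
  "node_poly S = (\<Prod>e\<in>S. [:- node e, 1:])"

lemma poly_node_poly: "poly (node_poly S) z = (\<Prod>e\<in>S. z - node e)"
  by (simp add: node_poly_def poly_prod)

lemma degree_node_poly: "finite S \<Longrightarrow> degree (node_poly S) = card S"
  unfolding node_poly_def by (subst degree_prod_eq_sum_degree) auto

text \<open>All roots are positive, so the coefficients alternate in sign up to the degree and none
  of them vanishes. This places the zeros of the special system in the torus.\<close>

lemma coeff_node_poly_neq_0: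
  assumes "finite S" "t \<le> card S"
  shows "coeff (node_poly S) t \<noteq> 0"
proof -
  have "\<exists>r>0. coeff (node_poly S) t = (-1) ^ (card S - t) * of_real r"
    using assms
  proof (induction S arbitrary: t rule: finite_induct)
    case empty
    then show ?case by (intro exI[of _ 1]) (simp add: node_poly_def)
  next
    case (insert e S)
    define a where "a = real (prod_encode e + 2)"
    have a: "a > 0" "node e = of_real a" by (simp_all add: a_def node_def)
    have co: "coeff (node_poly (insert e S)) t = (if t = 0 then 0 else coeff (node_poly S) (t - 1)) - node e * coeff (node_poly S) t" for t
      using insert.hyps by (simp add: node_poly_def coeff_pCons split: nat.split)
    consider "t = 0" | "t = Suc (card S)" | "0 < t" "t \<le> card S" using insert.prems insert.hyps by fastforce
    then show ?case
    proof cases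
      case 1
      obtain r where "r > 0" "coeff (node_poly S) 0 = (-1) ^ card S * of_real r" using insert.IH[of 0] by auto
      then show ?thesis using a insert.hyps 1 by (intro exI[of _ "a * r"]) (simp add: co)
    next
      case 2
      obtain r where "r > 0" "coeff (node_poly S) (card S) = of_real r" using insert.IH[of "card S"] by auto
      moreover have "coeff (node_poly S) (Suc (card S)) = 0"
        by (rule coeff_eq_0) (simp add: degree_node_poly insert.hyps)
      ultimately show ?thesis using insert.hyps 2 by (intro exI[of _ r]) (simp add: co)
    next
      case 3
      obtain r where r: "r > 0" "coeff (node_poly S) t = (-1) ^ (card S - t) * of_real r" using insert.IH[of t] 3 by auto
      obtain r' where r': "r' > 0" "coeff (node_poly S) (t - 1) = (-1) ^ (card S - (t - 1)) * of_real r'"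
        using insert.IH[of "t - 1"] 3 by fastforce
      have e: "card S - (t - 1) = Suc (card S - t)" "card (insert e S) - t = Suc (card S - t)"
        using 3 insert.hyps by auto
      have "coeff (node_poly (insert e S)) t = coeff (node_poly S) (t - 1) - node e * coeff (node_poly S) t"
        using 3 by (simp add: co)
      also have "\<dots> = (-1) ^ (card (insert e S) - t) * of_real (r' + a * r)"
        unfolding r(2) r'(2) e a(2) by (simp add: algebra_simps)
      finally have "coeff (node_poly (insert e S)) t = (-1) ^ (card (insert e S) - t) * of_real (r' + a * r)" .
      moreover have "r' + a * r > 0" using r r' a by (simp add: add_pos_pos)
      ultimately show ?thesis by blast
    qed
  qed
  then show ?thesis by auto
qed

definition fib :: "nat \<Rightarrow> (nat \<Rightarrow> nat) \<Rightarrow> (nat \<times> nat \<Rightarrow> nat) \<Rightarrow> nat \<Rightarrow> (nat \<times> nat) set" where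
  "fib N k \<sigma> q = {e\<in>eqs N k. \<sigma> e = q}"

text \<open>Dividing by the value at \<open>1\<close> makes the homogeneous coordinates of each block sum up to \<open>1\<close>.\<close>

definition sol :: "nat \<Rightarrow> (nat \<Rightarrow> nat) \<Rightarrow> (nat \<times> nat \<Rightarrow> nat) \<Rightarrow> nat \<Rightarrow> nat \<Rightarrow> complex" where
  "sol N k \<sigma> q t = coeff (node_poly (fib N k \<sigma> q)) t / poly (node_poly (fib N k \<sigma> q)) 1"

definition solpt :: "nat \<Rightarrow> (nat \<Rightarrow> nat) \<Rightarrow> (nat \<times> nat \<Rightarrow> nat) \<Rightarrow> nat \<Rightarrow> complex" where
  "solpt N k \<sigma> = restrict (\<lambda>v. sol N k \<sigma> (fst (prod_decode v)) (snd (prod_decode v))) (strategy_vars N k)"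

lemma finite_fib: "finite (fib N k \<sigma> q)"
  by (simp add: fib_def finite_eqs)

lemma card_fib: "\<sigma> \<in> assignments N k E \<Longrightarrow> q \<in> {1..N} \<Longrightarrow> card (fib N k \<sigma> q) = k q"
  by (simp add: assignments_def fib_def)

lemma node_poly_1_neq_0: "finite S \<Longrightarrow> poly (node_poly S) 1 \<noteq> 0"
  using node_neq_1 by (auto simp: poly_node_poly)

lemma sol_neq_0:
  assumes "\<sigma> \<in> assignments N k E" "q \<in> {1..N}" "t \<le> k q"
  shows "sol N k \<sigma> q t \<noteq> 0"
  using coeff_node_poly_neq_0[OF finite_fib, of t N k \<sigma> q] node_poly_1_neq_0[OF finite_fib, of N k \<sigma> q] assms
  by (simp add: sol_def card_fib)

lemma blk_sol:
  assumes "\<sigma> \<in> assignments N k E" "q \<in> {1..N}"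
  shows "blk k (sol N k \<sigma>) q z = (\<Prod>e\<in>fib N k \<sigma> q. z - node e) / (\<Prod>e\<in>fib N k \<sigma> q. 1 - node e)"
proof -
  have "degree (node_poly (fib N k \<sigma> q)) = k q"
    using degree_node_poly[OF finite_fib] card_fib[OF assms] by simp
  then have "poly (node_poly (fib N k \<sigma> q)) z = (\<Sum>t\<le>k q. coeff (node_poly (fib N k \<sigma> q)) t * z ^ t)"
    by (simp add: poly_altdef)
  then show ?thesis
    by (simp add: blk_def sol_def sum_divide_distrib[symmetric] poly_node_poly)
qed

lemma blk_sol_1: "\<sigma> \<in> assignments N k E \<Longrightarrow> q \<in> {1..N} \<Longrightarrow> blk k (sol N k \<sigma>) q 1 = 1"
  using node_poly_1_neq_0[OF finite_fib, of N k \<sigma> q] by (simp add: blk_sol poly_node_poly)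

lemma blk_sol_node:
  assumes "\<sigma> \<in> assignments N k E" "q \<in> {1..N}" "e \<in> eqs N k"
  shows "blk k (sol N k \<sigma>) q (node e) = 0 \<longleftrightarrow> \<sigma> e = q"
proof -
  have "(\<Prod>e\<in>fib N k \<sigma> q. 1 - node e) \<noteq> 0" using node_poly_1_neq_0[OF finite_fib, of N k \<sigma> q] by (simp add: poly_node_poly)
  then have "blk k (sol N k \<sigma>) q (node e) = 0 \<longleftrightarrow> (\<Prod>e'\<in>fib N k \<sigma> q. node e - node e') = 0"
    unfolding blk_sol[OF assms(1,2)] by simp
  also have "\<dots> \<longleftrightarrow> \<sigma> e = q" using finite_fib[of N k \<sigma> q] assms(3) inj_node by (auto simp: fib_def)
  finally show ?thesis .
qed

lemma strategy_vars_eqs: "strategy_vars N k = prod_encode ` eqs N k"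
  by (auto simp: strategy_vars_def eqs_def)

lemma finite_strategy_vars: "finite (strategy_vars N k)"
  by (simp add: strategy_vars_eqs finite_eqs)

lemma solpt_encode: "q \<in> {1..N} \<Longrightarrow> t \<in> {1..k q} \<Longrightarrow> solpt N k \<sigma> (prod_encode (q, t)) = sol N k \<sigma> q t"
  by (auto simp: solpt_def strategy_vars_def)

lemma coord_solpt:
  assumes "\<sigma> \<in> assignments N k E" "q \<in> {1..N}" "t \<le> k q"
  shows "coord k (solpt N k \<sigma>) q t = sol N k \<sigma> q t"
proof (cases "t = 0")
  case True
  have "{..k q} = insert 0 {1..k q}" by auto
  then have "1 = sol N k \<sigma> q 0 + (\<Sum>r\<in>{1..k q}. sol N k \<sigma> q r)"
    using blk_sol_1[OF assms(1,2)] by (simp add: blk_def)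
  moreover have "(\<Sum>r\<in>{1..k q}. solpt N k \<sigma> (prod_encode (q, r))) = (\<Sum>r\<in>{1..k q}. sol N k \<sigma> q r)"
    using assms(2) by (intro sum.cong refl solpt_encode)
  moreover have "coord k (solpt N k \<sigma>) q t = 1 - (\<Sum>r\<in>{1..k q}. solpt N k \<sigma> (prod_encode (q, r)))"
    using True by (simp add: coord_def)
  ultimately have "coord k (solpt N k \<sigma>) q t = sol N k \<sigma> q 0 + (\<Sum>r\<in>{1..k q}. sol N k \<sigma> q r) - (\<Sum>r\<in>{1..k q}. sol N k \<sigma> q r)"
    by metis
  then show ?thesis using True by simp
next
  case False
  then show ?thesis using assms by (simp add: coord_def solpt_encode)
qed

lemma blk_cong: "(\<And>t. t \<le> k q \<Longrightarrow> h q t = h' q t) \<Longrightarrow> blk k h q z = blk k h' q z"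
  by (auto simp: blk_def intro!: sum.cong)

text \<open>Each equation has a vanishing factor. A nonzero block has at most \<open>k q\<close>
  vanishing forms, and the number of equations is the sum of the \<open>k q\<close>, so every block
  has exactly \<open>k q\<close> and is determined up to a scalar. Stated for homogeneous
  coordinates, this covers infinity.\<close>

lemma special_zero_cases:
  assumes E: "E \<subseteq> arcs N" and nz: "\<And>q. q \<in> {1..N} \<Longrightarrow> \<exists>t\<le>k q. h q t \<noteq> 0"
    and zero: "\<And>e. e \<in> eqs N k \<Longrightarrow> (\<Prod>q\<in>in_nbrs E (fst e). blk k h q (node e)) = 0"
  shows "\<exists>\<sigma>\<in>assignments N k E. \<forall>q\<in>{1..N}. \<exists>c. c \<noteq> 0 \<and> (\<forall>t\<le>k q. h q t = c * sol N k \<sigma> q t)"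
proof -
  have "\<forall>e\<in>eqs N k. \<exists>q. q \<in> in_nbrs E (fst e) \<and> blk k h q (node e) = 0"
    using zero finite_in_nbrs[OF E] by (simp add: prod_zero_iff Bex_def)
  from bchoice[OF this] obtain g where g: "\<forall>e\<in>eqs N k. g e \<in> in_nbrs E (fst e) \<and> blk k h (g e) (node e) = 0" ..
  define \<sigma> where "\<sigma> = restrict g (eqs N k)"
  have \<sigma>: "e \<in> eqs N k \<Longrightarrow> \<sigma> e \<in> in_nbrs E (fst e)" "e \<in> eqs N k \<Longrightarrow> blk k h (\<sigma> e) (node e) = 0" for e
    using g by (auto simp: \<sigma>_def)
  have roots: "blk k h q z = 0" if "z \<in> node ` fib N k \<sigma> q" for q z
    using that \<sigma> by (auto simp: fib_def)
  have card_node: "card (node ` S) = card S" for S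
    by (rule card_image) (simp add: inj_on_def inj_node)
  have le: "card (fib N k \<sigma> q) \<le> k q" if q: "q \<in> {1..N}" for q
  proof (rule ccontr)
    assume "\<not> ?thesis"
    then have "h q t = 0" if "t \<le> k q" for t
      by (intro blk_eq_0[of "node ` fib N k \<sigma> q" k q h t]) (use roots that finite_fib card_node in auto)
    then show False using nz[OF q] by blast
  qed
  have "(\<Sum>q\<in>{1..N}. card (fib N k \<sigma> q)) = card (\<Union>q\<in>{1..N}. fib N k \<sigma> q)"
    by (rule card_UN_disjoint[symmetric]) (use finite_fib in \<open>auto simp: fib_def\<close>)
  also have "(\<Union>q\<in>{1..N}. fib N k \<sigma> q) = eqs N k"
    using \<sigma>(1) in_nbrs_subset[OF E] by (fastforce simp: fib_def)
  also have "card (eqs N k) = (\<Sum>q\<in>{1..N}. k q)" by (rule card_eqs)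
  finally have sum_eq: "(\<Sum>q\<in>{1..N}. card (fib N k \<sigma> q)) = (\<Sum>q\<in>{1..N}. k q)" .
  have eq: "card (fib N k \<sigma> q) = k q" if q: "q \<in> {1..N}" for q
  proof (rule ccontr)
    assume "card (fib N k \<sigma> q) \<noteq> k q"
    then have "card (fib N k \<sigma> q) < k q" using le[OF q] by simp
    then have "(\<Sum>q\<in>{1..N}. card (fib N k \<sigma> q)) < (\<Sum>q\<in>{1..N}. k q)"
      by (intro sum_strict_mono_ex1) (use le q in auto)
    then show False using sum_eq by simp
  qed
  have \<sigma>A: "\<sigma> \<in> assignments N k E"
    using \<sigma>(1) eq by (auto simp: assignments_def fib_def \<sigma>_def)
  show ?thesis
  proof (intro bexI[OF _ \<sigma>A] ballI)
    fix q assume q: "q \<in> {1..N}"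
    \<comment> \<open>\<open>h\<close> and \<open>c\<close> times the solution agree at the
      \<open>k q\<close> nodes of the fibre and at 1, one point more than the degree allows for a
      nonzero difference. As the block is not zero, neither is its coordinate sum \<open>c\<close>:
      the point is not at infinity.\<close>
    define c where "c = blk k h q 1"
    define d where "d q t = h q t - c * sol N k \<sigma> q t" for q t
    have blk_d: "blk k d q z = blk k h q z - c * blk k (sol N k \<sigma>) q z" for z
      by (simp add: blk_def d_def left_diff_distrib sum_subtractf sum_distrib_left mult.assoc)
    have d0: "d q t = 0" if "t \<le> k q" for t
    proof (rule blk_eq_0[of "insert 1 (node ` fib N k \<sigma> q)"])
      have "1 \<notin> node ` fib N k \<sigma> q" using node_neq_1 by (metis imageE)
      then show "card (insert 1 (node ` fib N k \<sigma> q)) > k q"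
        using eq[OF q] card_node finite_fib by simp
      fix z assume z: "z \<in> insert 1 (node ` fib N k \<sigma> q)"
      show "blk k d q z = 0"
      proof (cases "z = 1")
        case True
        then show ?thesis using blk_sol_1[OF \<sigma>A q] by (simp add: blk_d c_def)
      next
        case False
        then have z: "z \<in> node ` fib N k \<sigma> q" using z by simp
        then obtain e where "e \<in> eqs N k" "\<sigma> e = q" "z = node e" by (auto simp: fib_def)
        then show ?thesis using roots[OF z] blk_sol_node[OF \<sigma>A q] by (simp add: blk_d)
      qed
    qed (use that finite_fib in auto)
    have "c \<noteq> 0"
    proof
      assume "c = 0"
      then show False using nz[OF q] d0 by (auto simp: d_def)
    qed
    then show "\<exists>c. c \<noteq> 0 \<and> (\<forall>t\<le>k q. h q t = c * sol N k \<sigma> q t)"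
      using d0 by (intro exI[of _ c]) (auto simp: d_def)
  qed
qed

text \<open>Among the nodes, a block of the solution point vanishes precisely at those of its fibre,
  so the point determines the assignment.\<close>

lemma solpt_inj:
  assumes "\<sigma> \<in> assignments N k E" "\<sigma>' \<in> assignments N k E" "solpt N k \<sigma> = solpt N k \<sigma>'" "E \<subseteq> arcs N"
  shows "\<sigma> = \<sigma>'"
proof (rule PiE_ext)
  show "\<sigma> \<in> PiE (eqs N k) (\<lambda>e. in_nbrs E (fst e))" "\<sigma>' \<in> PiE (eqs N k) (\<lambda>e. in_nbrs E (fst e))"
    using assms by (auto simp: assignments_def)
  fix e assume e: "e \<in> eqs N k"
  then have "\<sigma> e \<in> in_nbrs E (fst e)" using assms(1) by (auto simp: assignments_def)
  then have q: "\<sigma> e \<in> {1..N}" using in_nbrs_subset[OF assms(4)] by blast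
  have "blk k (sol N k \<sigma>') (\<sigma> e) (node e) = blk k (sol N k \<sigma>) (\<sigma> e) (node e)"
    by (rule blk_cong) (use coord_solpt[OF assms(1) q] coord_solpt[OF assms(2) q] assms(3) in simp)
  also have "\<dots> = 0" using blk_sol_node[OF assms(1) q e] by simp
  finally show "\<sigma> e = \<sigma>' e" using blk_sol_node[OF assms(2) q e] by simp
qed

section \<open>The Jacobian matrix at the special zeros\<close>

text \<open>An equation carries the code of its pair (i, s), so equations and unknowns share the
  index set \<open>strategy_vars\<close> and the Jacobian matrix is square.\<close>

definition sysfun :: "(nat \<Rightarrow> nat) \<Rightarrow> (nat \<times> nat) set \<Rightarrow> nat \<Rightarrow> (payoff_index + nat \<Rightarrow> complex) \<Rightarrow> complex" where
  "sysfun k E e w = hform k E (\<lambda>p. w (Inl p)) (fst (prod_decode e)) (snd (prod_decode e)) (coord k (\<lambda>v. w (Inr v)))"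

lemma sysfun_join: "sysfun k E e (join u x) = hform k E u (fst (prod_decode e)) (snd (prod_decode e)) (coord k x)"
  by (simp add: sysfun_def)

lemma sysfun_polyfuns: "sysfun k E e \<in> polyfuns"
proof -
  have "(\<lambda>w. coord k (\<lambda>v. w (Inr v)) q t) \<in> polyfuns" for q t
    unfolding coord_def by (intro polyfuns_if polyfuns_diff polyfuns.const polyfuns_sum polyfuns.var)
  then have "(\<lambda>w. sysfun k E e w) \<in> polyfuns"
    unfolding sysfun_def hform_def
    by (intro polyfuns_sum polyfuns.mult polyfuns_diff polyfuns.var polyfuns_prod)
  then show ?thesis by simp
qed

definition sysjac :: "nat \<Rightarrow> (nat \<Rightarrow> nat) \<Rightarrow> (nat \<times> nat) set \<Rightarrow> (payoff_index \<Rightarrow> complex) \<Rightarrow> (nat \<Rightarrow> complex) \<Rightarrow> complex" where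
  "sysjac N k E u x = fdet (strategy_vars N k) (\<lambda>e v. partial (sysfun k E e) v u x)"

lemma sysfun_special:
  assumes "E \<subseteq> arcs N" "\<And>w. w \<in> payoff_indices N k E \<Longrightarrow> u w = special_payoff E w" "e \<in> strategy_vars N k"
  shows "sysfun k E e (join u x) = (\<Prod>q\<in>in_nbrs E (fst (prod_decode e)). blk k (coord k x) q (node (prod_decode e)))"
proof -
  have "(fst (prod_decode e), snd (prod_decode e)) \<in> eqs N k" using assms(3) by (auto simp: strategy_vars_eqs)
  from hform_special[OF assms(1,2) this] show ?thesis by (simp add: sysfun_join)
qed

lemma solpt_zero:
  assumes "E \<subseteq> arcs N" "\<And>w. w \<in> payoff_indices N k E \<Longrightarrow> u w = special_payoff E w"
    "\<sigma> \<in> assignments N k E" "e \<in> strategy_vars N k"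
  shows "sysfun k E e (join u (solpt N k \<sigma>)) = 0"
proof -
  define d where "d = prod_decode e"
  have d: "d \<in> eqs N k" using assms(4) by (auto simp: strategy_vars_eqs d_def)
  then have nb: "\<sigma> d \<in> in_nbrs E (fst d)" using assms(3) by (auto simp: assignments_def)
  then have q: "\<sigma> d \<in> {1..N}" using in_nbrs_subset[OF assms(1)] by blast
  have "blk k (coord k (solpt N k \<sigma>)) (\<sigma> d) (node d) = blk k (sol N k \<sigma>) (\<sigma> d) (node d)"
    by (rule blk_cong) (rule coord_solpt[OF assms(3) q])
  then have "blk k (coord k (solpt N k \<sigma>)) (\<sigma> d) (node d) = 0" using blk_sol_node[OF assms(3) q d] by simp
  then show ?thesis
    using sysfun_special[OF assms(1) assms(2) assms(4), where x = "solpt N k \<sigma>"] nb finite_in_nbrs[OF assms(1)]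
    unfolding d_def[symmetric] by (auto intro: prod_zero)
qed

text \<open>In equation d only the factor of \<open>\<sigma> d\<close> vanishes at the point, so the
  derivative in direction y is that factor applied to y times something nonzero. For y in the
  kernel, each block of y thus vanishes at its \<open>k q\<close> nodes and, as the coordinate sum
  is fixed, at 1; hence y = 0.\<close>

lemma solpt_nondegenerate:
  assumes E: "E \<subseteq> arcs N" and u: "\<And>w. w \<in> payoff_indices N k E \<Longrightarrow> u w = special_payoff E w"
    and \<sigma>: "\<sigma> \<in> assignments N k E"
  shows "sysjac N k E u (solpt N k \<sigma>) \<noteq> 0"
  unfolding sysjac_def
proof
  let ?V = "strategy_vars N k" and ?p = "solpt N k \<sigma>"
  assume "fdet ?V (\<lambda>e v. partial (sysfun k E e) v u ?p) = 0"
  from fdet_eq_0_kernel[OF finite_strategy_vars this] obtain y where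
    y': "(\<forall>e\<in>?V. (\<Sum>v\<in>?V. partial (sysfun k E e) v u ?p * y v) = 0) \<and> (\<exists>v\<in>?V. y v \<noteq> 0)" ..
  then have y: "(\<Sum>v\<in>?V. partial (sysfun k E e) v u ?p * y v) = 0" if "e \<in> ?V" for e using that by simp
  from y' obtain v where v: "v \<in> ?V" "y v \<noteq> 0" by auto
  \<comment> \<open>\<open>y'\<close> is 0 off the variables, as the divided differences demand;
    \<open>yh\<close> is its homogeneous form, with sum 0 in each block because the coordinates sum
    to 1.\<close>
  define y' where "y' v = (if v \<in> ?V then y v else 0)" for v
  define yh where "yh q t = (if t = 0 then - (\<Sum>r\<in>{1..k q}. y' (prod_encode (q, r))) else y' (prod_encode (q, t)))" for q t
  have yh: "coord k (\<lambda>v. ?p v + z * y' v) q t = coord k ?p q t + z * yh q t" for z q t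
    by (simp add: coord_def yh_def sum.distrib sum_distrib_left)
  have blk_yh: "blk k (coord k (\<lambda>v. ?p v + z * y' v)) q a = blk k (coord k ?p) q a + z * blk k yh q a" for z q a
    by (simp add: blk_def yh sum.distrib sum_distrib_left distrib_right mult.assoc)
  have root: "blk k yh (\<sigma> d) (node d) = 0" if d: "d \<in> eqs N k" for d
  proof -
    define e where "e = prod_encode d"
    have e: "e \<in> ?V" "prod_decode e = d" using d by (auto simp: e_def strategy_vars_eqs)
    define B where "B = in_nbrs E (fst d)"
    have B: "finite B" "\<sigma> d \<in> B" "B \<subseteq> {1..N}"
      using finite_in_nbrs[OF E] \<sigma> d in_nbrs_subset[OF E] by (auto simp: B_def assignments_def)
    have bp: "blk k (coord k ?p) q a = blk k (sol N k \<sigma>) q a" if "q \<in> B" for q a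
      by (rule blk_cong) (use coord_solpt[OF \<sigma>] that B(3) in blast)
    have b0: "blk k (coord k ?p) (\<sigma> d) (node d) = 0"
      using blk_sol_node[OF \<sigma> _ d] B bp by auto
    have bn: "blk k (coord k ?p) q (node d) \<noteq> 0" if "q \<in> B - {\<sigma> d}" for q
      using blk_sol_node[OF \<sigma> _ d, of q] B bp[of q] that by auto
    from polyfuns_divided_difference[OF finite_strategy_vars sysfun_polyfuns, of N k k E e]
    obtain A where A: "divdiff ?V (sysfun k E e) A" ..
    have part: "partial (sysfun k E e) v u ?p = A v (join u (join ?p ?p))" if "v \<in> ?V" for v
      by (rule partial_eq_divided_difference[OF finite_strategy_vars A that])
    \<comment> \<open>\<open>L\<close> and \<open>R\<close> are the difference quotient of the
      equation along \<open>z * y'\<close>, computed from the factorization and from the divided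
      differences. Comparing their limits at 0 yields the derivative of the product.\<close>
    define L where "L z = blk k yh (\<sigma> d) (node d) * (\<Prod>q\<in>B-{\<sigma> d}. blk k (coord k ?p) q (node d) + z * blk k yh q (node d))" for z
    define R where "R z = (\<Sum>v\<in>?V. A v (join u (join (\<lambda>v. ?p v + z * y' v) ?p)) * y v)" for z
    have LR: "L z = R z" if z: "z \<noteq> 0" for z
    proof -
      have "z * R z = (\<Sum>v\<in>?V. A v (join u (join (\<lambda>v. ?p v + z * y' v) ?p)) * ((?p v + z * y' v) - ?p v))"
        by (simp add: R_def sum_distrib_left y'_def mult_ac)
      also have "\<dots> = sysfun k E e (join u (\<lambda>v. ?p v + z * y' v)) - sysfun k E e (join u ?p)"
        using divdiffD(2)[OF A, of "\<lambda>v. ?p v + z * y' v" ?p u] by (simp add: y'_def)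
      also have "sysfun k E e (join u ?p) = 0" by (rule solpt_zero[OF E u \<sigma> e(1)])
      also have "sysfun k E e (join u (\<lambda>v. ?p v + z * y' v)) = (\<Prod>q\<in>B. blk k (coord k ?p) q (node d) + z * blk k yh q (node d))"
        by (simp add: sysfun_special[OF E u e(1)] e(2) B_def blk_yh)
      also have "\<dots> = z * L z"
        by (simp add: L_def prod.remove[OF B(1,2)] b0)
      finally show ?thesis using z by simp
    qed
    have "(L \<longlongrightarrow> blk k yh (\<sigma> d) (node d) * (\<Prod>q\<in>B-{\<sigma> d}. blk k (coord k ?p) q (node d) + 0 * blk k yh q (node d))) (at 0)"
      unfolding L_def by (intro tendsto_intros)
    moreover have "(R \<longlongrightarrow> (\<Sum>v\<in>?V. A v (join u (join ?p ?p)) * y v)) (at 0)"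
      unfolding R_def
    proof (intro tendsto_sum tendsto_mult tendsto_const)
      fix v assume "v \<in> ?V"
      show "((\<lambda>z. A v (join u (join (\<lambda>v. ?p v + z * y' v) ?p))) \<longlongrightarrow> A v (join u (join ?p ?p))) (at 0)"
      proof (rule polyfuns_tendsto[where f = "A v"])
        have "((\<lambda>z. ?p w + z * y' w) \<longlongrightarrow> ?p w + 0 * y' w) (at 0)" for w by (intro tendsto_intros)
        then show "((\<lambda>z. join u (join (\<lambda>v. ?p v + z * y' v) ?p) w) \<longlongrightarrow> join u (join ?p ?p) w) (at 0)" for w
          by (simp split: sum.split)
      qed (rule divdiffD(1)[OF A])
    qed
    moreover have "eventually (\<lambda>z. R z = L z) (at 0)"
      using LR by (auto simp: eventually_at_filter)
    ultimately have "blk k yh (\<sigma> d) (node d) * (\<Prod>q\<in>B-{\<sigma> d}. blk k (coord k ?p) q (node d) + 0 * blk k yh q (node d))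
        = (\<Sum>v\<in>?V. A v (join u (join ?p ?p)) * y v)"
      using tendsto_unique[OF at_neq_bot] tendsto_cong by blast
    also have "\<dots> = 0" using y[OF e(1)] part by simp
    finally show ?thesis using bn B(1) by simp
  qed
  obtain q t where qt: "v = prod_encode (q, t)" "q \<in> {1..N}" "t \<in> {1..k q}" using v(1) by (auto simp: strategy_vars_def)
  have "yh q t = 0"
  proof (rule blk_eq_0[of "insert 1 (node ` fib N k \<sigma> q)"])
    have "1 \<notin> node ` fib N k \<sigma> q" using node_neq_1 by (metis imageE)
    moreover have "card (node ` fib N k \<sigma> q) = card (fib N k \<sigma> q)"
      by (rule card_image) (simp add: inj_on_def inj_node)
    ultimately show "card (insert 1 (node ` fib N k \<sigma> q)) > k q"
      using card_fib[OF \<sigma> qt(2)] finite_fib by simp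
    fix z assume "z \<in> insert 1 (node ` fib N k \<sigma> q)"
    moreover have "blk k yh q 1 = 0"
    proof -
      have "{..k q} = insert 0 {1..k q}" by auto
      then show ?thesis by (simp add: blk_def yh_def)
    qed
    ultimately show "blk k yh q z = 0" using root by (auto simp: fib_def)
  qed (use finite_fib qt in auto)
  then show False using v qt by (simp add: yh_def y'_def)
qed

section \<open>Compactness and the zeros of nearby systems\<close>

lemma bounded_family_subseq:
  fixes f :: "nat \<Rightarrow> 'i \<Rightarrow> complex"
  assumes "finite I" "\<And>n i. i \<in> I \<Longrightarrow> norm (f n i) \<le> 1"
  shows "\<exists>r. strict_mono r \<and> (\<forall>i\<in>I. convergent (\<lambda>n. f (r n) i))"
  using assms
proof (induction I rule: finite_induct)
  case empty
  show ?case by (intro exI[of _ id]) (simp add: strict_mono_def)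
next
  case (insert i I)
  then obtain r where r: "strict_mono r" "\<forall>i\<in>I. convergent (\<lambda>n. f (r n) i)" by auto
  have "bounded (range (\<lambda>n. f (r n) i))"
    using insert.prems by (auto simp: bounded_iff)
  from bounded_imp_convergent_subsequence[OF this] obtain l r' where
    r': "strict_mono r'" "((\<lambda>n. f (r n) i) \<circ> r') \<longlonglongrightarrow> l" by blast
  show ?case
  proof (intro exI[of _ "r \<circ> r'"] conjI ballI)
    show "strict_mono (r \<circ> r')" using r(1) r'(1) by (rule strict_mono_o)
    fix j assume "j \<in> insert i I"
    show "convergent (\<lambda>n. f ((r \<circ> r') n) j)"
    proof (cases "j = i")
      case True
      then show ?thesis using r'(2) by (auto simp: convergent_def o_def)
    next
      case False
      then have "convergent (\<lambda>n. f (r n) j)" using r(2) \<open>j \<in> insert i I\<close> by auto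
      from convergent_subseq_convergent[OF this r'(1)] show ?thesis by (simp add: o_def)
    qed
  qed
qed

text \<open>
  No zeros escape to infinity: normalize the homogeneous coordinates in each block, pass to a
  convergent subsequence, and recognize the limit among the projective zeros of the special system.
\<close>

lemma zeros_subconverge:
  assumes E: "E \<subseteq> arcs N" and u0: "\<And>w. w \<in> payoff_indices N k E \<Longrightarrow> u0 w = special_payoff E w"
    and u: "\<And>w. (\<lambda>n. u n w) \<longlonglongrightarrow> u0 w"
    and x: "\<And>n e. e \<in> strategy_vars N k \<Longrightarrow> sysfun k E e (join (u n) (x n)) = 0"
  shows "\<exists>r. strict_mono r \<and> (\<exists>\<sigma>\<in>assignments N k E. \<forall>v\<in>strategy_vars N k. (\<lambda>n. x (r n) v) \<longlonglongrightarrow> solpt N k \<sigma> v)"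
proof -
  define c where "c n q = (\<Sum>t\<le>k q. norm (coord k (x n) q t))" for n q
  have c: "c n q \<ge> 1" for n q
    using norm_sum[of "coord k (x n) q" "{..k q}"] by (simp add: sum_coord c_def)
  define g where "g n q t = inverse (of_real (c n q)) * coord k (x n) q t" for n q t
  have norm_g: "norm (g n q t) = norm (coord k (x n) q t) / c n q" for n q t
    using c[of n q] by (simp add: g_def norm_mult norm_inverse divide_inverse mult.commute)
  define I where "I = Sigma {1..N} (\<lambda>q. {..k q})"
  have "\<exists>r. strict_mono r \<and> (\<forall>i\<in>I. convergent (\<lambda>n. (\<lambda>n (q, t). g n q t) (r n) i))"
  proof (rule bounded_family_subseq)
    fix n i assume "i \<in> I"
    then obtain q t where i: "i = (q, t)" "t \<le> k q" by (auto simp: I_def)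
    have "norm (coord k (x n) q t) \<le> c n q"
      unfolding c_def by (rule member_le_sum) (use i in auto)
    then show "norm (case i of (q, t) \<Rightarrow> g n q t) \<le> 1" using c[of n q] by (simp add: i norm_g)
  qed (simp add: I_def)
  then obtain r where r: "strict_mono r" "\<forall>i\<in>I. convergent (\<lambda>n. (\<lambda>n (q, t). g n q t) (r n) i)" by auto
  define l where "l q t = lim (\<lambda>n. g (r n) q t)" for q t
  have l: "(\<lambda>n. g (r n) q t) \<longlonglongrightarrow> l q t" if "q \<in> {1..N}" "t \<le> k q" for q t
    using r(2) that unfolding l_def I_def convergent_LIMSEQ_iff[symmetric] by auto
  have "(\<Prod>q\<in>in_nbrs E (fst e). blk k l q (node e)) = 0" if e: "e \<in> eqs N k" for e
  proof -
    have nb: "in_nbrs E (fst e) \<subseteq> {1..N}" using in_nbrs_subset[OF E] by blast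
    have "hform k E (u n) (fst e) (snd e) (g n) = 0" for n
    proof -
      have "hform k E (u n) (fst e) (snd e) (coord k (x n)) = 0"
        using x[of "prod_encode e" n] e by (simp add: sysfun_join strategy_vars_eqs)
      then show ?thesis unfolding g_def hform_scale by simp
    qed
    moreover have "(\<lambda>n. hform k E (u (r n)) (fst e) (snd e) (g (r n))) \<longlonglongrightarrow> hform k E u0 (fst e) (snd e) l"
      unfolding hform_def
    proof (intro tendsto_intros)
      show "(\<lambda>n. u (r n) w) \<longlonglongrightarrow> u0 w" for w
        using LIMSEQ_subseq_LIMSEQ[OF u r(1)] by (simp add: o_def)
      then show "(\<lambda>n. u (r n) w) \<longlonglongrightarrow> u0 w" for w .
      fix \<alpha> q assume "\<alpha> \<in> profiles k E (fst e)" "q \<in> in_nbrs E (fst e)"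
      then show "(\<lambda>n. g (r n) q (\<alpha> q)) \<longlonglongrightarrow> l q (\<alpha> q)"
        using nb by (intro l) (auto simp: profiles_def)
    qed
    ultimately have "hform k E u0 (fst e) (snd e) l = 0" by (simp add: LIMSEQ_const_iff)
    then show ?thesis using hform_special[OF E u0, where i = "fst e" and s = "snd e" and h = l] e by simp
  qed
  \<comment> \<open>The norms in a block of \<open>g\<close> sum to 1, and this passes to the limit,
    so the limit is a point of the product of projective spaces.\<close>
  moreover have "\<exists>t\<le>k q. l q t \<noteq> 0" if q: "q \<in> {1..N}" for q
  proof (rule ccontr)
    assume "\<not> ?thesis"
    moreover have "(\<lambda>n. \<Sum>t\<le>k q. norm (g (r n) q t)) \<longlonglongrightarrow> (\<Sum>t\<le>k q. norm (l q t))"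
      by (intro tendsto_intros l q) simp
    moreover have "(\<Sum>t\<le>k q. norm (g n q t)) = 1" for n
      using c[of n q] by (simp add: norm_g sum_divide_distrib[symmetric] c_def[symmetric])
    ultimately show False by (simp add: LIMSEQ_const_iff)
  qed
  ultimately obtain \<sigma> where \<sigma>: "\<sigma> \<in> assignments N k E" "\<forall>q\<in>{1..N}. \<exists>c. c \<noteq> 0 \<and> (\<forall>t\<le>k q. l q t = c * sol N k \<sigma> q t)"
    using special_zero_cases[OF E, of k l] by blast
  show ?thesis
  proof (intro exI[of _ r] conjI bexI[OF _ \<sigma>(1)] ballI)
    fix v assume "v \<in> strategy_vars N k"
    then obtain q t where v: "v = prod_encode (q, t)" "q \<in> {1..N}" "t \<in> {1..k q}" by (auto simp: strategy_vars_def)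
    obtain a where a: "a \<noteq> 0" "\<And>t. t \<le> k q \<Longrightarrow> l q t = a * sol N k \<sigma> q t" using \<sigma>(2) v(2) by blast
    \<comment> \<open>The coordinate sum of the limit block is \<open>a\<close>, which is not 0;
      dividing by coordinate sums therefore commutes with the limit and leads back to
      \<open>x\<close>.\<close>
    have "(\<Sum>t\<le>k q. l q t) = a * blk k (sol N k \<sigma>) q 1"
      by (simp add: blk_def sum_distrib_left a(2))
    then have sum_l: "(\<Sum>t\<le>k q. l q t) = a" by (simp add: blk_sol_1[OF \<sigma>(1) v(2)])
    have "(\<lambda>n. \<Sum>t\<le>k q. g (r n) q t) \<longlonglongrightarrow> (\<Sum>t\<le>k q. l q t)"
      by (intro tendsto_sum l v(2)) simp
    then have "(\<lambda>n. \<Sum>t\<le>k q. g (r n) q t) \<longlonglongrightarrow> a" by (simp only: sum_l)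
    then have "(\<lambda>n. g (r n) q t / (\<Sum>t\<le>k q. g (r n) q t)) \<longlonglongrightarrow> l q t / a"
      using v(3) a(1) by (intro tendsto_divide l v(2)) auto
    moreover have "g n q t / (\<Sum>t\<le>k q. g n q t) = x n v" for n
    proof -
      have "(\<Sum>t\<le>k q. g n q t) = inverse (of_real (c n q))"
        unfolding g_def sum_distrib_left[symmetric] sum_coord by simp
      moreover have "of_real (c n q) \<noteq> (0::complex)" using c[of n q] by auto
      ultimately show ?thesis using v by (simp add: g_def coord_def)
    qed
    moreover have "l q t / a = solpt N k \<sigma> v"
      using a v by (simp add: solpt_encode)
    ultimately show "(\<lambda>n. x (r n) v) \<longlonglongrightarrow> solpt N k \<sigma> v" by simp
  qed (rule r(1))
qed

text \<open>Zeros at distance more than \<open>\<epsilon>\<close> from all special zeros, at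
  arbitrarily late n, would have a subsequence converging to one of them.\<close>

lemma zeros_near_solpt:
  assumes E: "E \<subseteq> arcs N" and u0: "\<And>w. w \<in> payoff_indices N k E \<Longrightarrow> u0 w = special_payoff E w"
    and u: "\<And>w. (\<lambda>n. u n w) \<longlonglongrightarrow> u0 w" and \<epsilon>: "\<epsilon> > 0"
  shows "\<forall>\<^sub>F n in sequentially. \<forall>x. (\<forall>e\<in>strategy_vars N k. sysfun k E e (join (u n) x) = 0) \<longrightarrow>
    (\<exists>\<sigma>\<in>assignments N k E. \<forall>v\<in>strategy_vars N k. dist (x v) (solpt N k \<sigma> v) \<le> \<epsilon>)"
proof (rule ccontr)
  define Z where "Z n x \<longleftrightarrow> (\<forall>e\<in>strategy_vars N k. sysfun k E e (join (u n) x) = 0)" for n x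
  define C where "C x \<longleftrightarrow> (\<exists>\<sigma>\<in>assignments N k E. \<forall>v\<in>strategy_vars N k. dist (x v) (solpt N k \<sigma> v) \<le> \<epsilon>)" for x
  assume "\<not> ?thesis"
  then have "\<not> (\<forall>\<^sub>F n in sequentially. \<forall>x. Z n x \<longrightarrow> C x)" unfolding Z_def C_def .
  from not_eventually_sequentiallyD[OF this] obtain s :: "nat \<Rightarrow> nat" where s: "strict_mono s" "\<forall>n. \<exists>x. Z (s n) x \<and> \<not> C x" by auto
  from choice[OF s(2)] obtain x where x: "\<forall>n. Z (s n) (x n) \<and> \<not> C (x n)" ..
  have "\<exists>r. strict_mono r \<and> (\<exists>\<sigma>\<in>assignments N k E. \<forall>v\<in>strategy_vars N k. (\<lambda>n. x (r n) v) \<longlonglongrightarrow> solpt N k \<sigma> v)"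
  proof (rule zeros_subconverge[OF E u0])
    show "(\<lambda>n. u (s n) w) \<longlonglongrightarrow> u0 w" for w using LIMSEQ_subseq_LIMSEQ[OF u s(1)] by (simp add: o_def)
  qed (use x in \<open>auto simp: Z_def\<close>)
  then obtain r \<sigma> where \<sigma>: "\<sigma> \<in> assignments N k E" "\<forall>v\<in>strategy_vars N k. (\<lambda>n. x (r n) v) \<longlonglongrightarrow> solpt N k \<sigma> v" by auto
  have "\<forall>\<^sub>F n in sequentially. \<forall>v\<in>strategy_vars N k. dist (x (r n) v) (solpt N k \<sigma> v) < \<epsilon>"
    using \<sigma>(2) \<epsilon> by (intro eventually_ball_finite finite_strategy_vars ballI tendstoD) auto
  then obtain n where "\<forall>v\<in>strategy_vars N k. dist (x (r n) v) (solpt N k \<sigma> v) < \<epsilon>"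
    unfolding eventually_sequentially by blast
  then have "C (x (r n))" unfolding C_def using \<sigma>(1) by (intro bexI[of _ \<sigma>]) (auto intro: less_imp_le)
  then show False using x by blast
qed

definition sys_zeros :: "nat \<Rightarrow> (nat \<Rightarrow> nat) \<Rightarrow> (nat \<times> nat) set \<Rightarrow> (payoff_index \<Rightarrow> complex) \<Rightarrow> (nat \<Rightarrow> complex) set" where
  "sys_zeros N k E u = {x \<in> torus (strategy_vars N k). \<forall>e\<in>strategy_vars N k. sysfun k E e (join u x) = 0}"

text \<open>For late n every zero lies in a polydisc about some special zero, and each polydisc
  contains exactly one zero. For a small radius these polydiscs are disjoint and keep off the
  coordinate hyperplanes, so the torus zeros are counted by the assignments.\<close>

theorem zeros_near_special:
  assumes E: "E \<subseteq> arcs N" and u0: "\<And>w. w \<in> payoff_indices N k E \<Longrightarrow> u0 w = special_payoff E w"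
    and u: "\<And>w. (\<lambda>n. u n w) \<longlonglongrightarrow> u0 w"
  shows "\<forall>\<^sub>F n in sequentially. (\<exists>\<psi>. bij_betw \<psi> (assignments N k E) (sys_zeros N k E (u n))) \<and>
    (\<forall>x\<in>sys_zeros N k E (u n). sysjac N k E (u n) x \<noteq> 0)"
proof -
  let ?V = "strategy_vars N k" and ?A = "assignments N k E" and ?p = "solpt N k"
  note fin = finite_strategy_vars[of N k] finite_assignments[OF E, of k]
  define near where "near \<sigma> \<epsilon> = {x. (\<forall>v. v \<notin> ?V \<longrightarrow> x v = ?p \<sigma> v) \<and> (\<forall>v\<in>?V. dist (x v) (?p \<sigma> v) \<le> \<epsilon>)}" for \<sigma> \<epsilon>
  define zero where "zero n x \<longleftrightarrow> (\<forall>e\<in>?V. sysfun k E e (join (u n) x) = 0)" for n x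
  define good where "good \<sigma> \<epsilon> n \<longleftrightarrow> (\<exists>x\<in>near \<sigma> \<epsilon>. zero n x) \<and>
      (\<forall>x\<in>near \<sigma> \<epsilon>. \<forall>y\<in>near \<sigma> \<epsilon>. zero n x \<longrightarrow> zero n y \<longrightarrow> x = y) \<and> (\<forall>x\<in>near \<sigma> \<epsilon>. sysjac N k E (u n) x \<noteq> 0)" for \<sigma> \<epsilon> n
  have "\<forall>\<sigma>\<in>?A. \<exists>\<epsilon>0>0. \<forall>\<epsilon>. 0 < \<epsilon> \<longrightarrow> \<epsilon> \<le> \<epsilon>0 \<longrightarrow> eventually (good \<sigma> \<epsilon>) sequentially"
  proof
    fix \<sigma> assume \<sigma>: "\<sigma> \<in> ?A"
    show "\<exists>\<epsilon>0>0. \<forall>\<epsilon>. 0 < \<epsilon> \<longrightarrow> \<epsilon> \<le> \<epsilon>0 \<longrightarrow> eventually (good \<sigma> \<epsilon>) sequentially"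
      unfolding good_def[abs_def] zero_def sysjac_def near_def
      by (rule nondegenerate_zero_persists[OF fin(1) sysfun_polyfuns solpt_zero[OF E u0 \<sigma>] solpt_nondegenerate[OF E u0 \<sigma>, unfolded sysjac_def] u])
  qed
  from bchoice[OF this] obtain \<epsilon>0 where \<epsilon>0: "\<forall>\<sigma>\<in>?A. \<epsilon>0 \<sigma> > 0 \<and> (\<forall>\<epsilon>. 0 < \<epsilon> \<longrightarrow> \<epsilon> \<le> \<epsilon>0 \<sigma> \<longrightarrow> eventually (good \<sigma> \<epsilon>) sequentially)" ..
  \<comment> \<open>The bounds on the radius: the persistence thresholds, half the modulus of each
    coordinate to stay in the torus, and a third of each distance between distinct coordinates to
    separate the polydiscs. Equal coordinates give 0 and are removed; the element 1 keeps the set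
    nonempty.\<close>
  define S where "S = insert 1 (\<epsilon>0 ` ?A \<union> (\<lambda>(\<sigma>, v). norm (?p \<sigma> v) / 2) ` (?A \<times> ?V) \<union>
      ((\<lambda>(\<sigma>, \<sigma>', v). dist (?p \<sigma> v) (?p \<sigma>' v) / 3) ` (?A \<times> ?A \<times> ?V) - {0}))"
  define \<epsilon> where "\<epsilon> = Min S"
  have finS: "finite S" using fin by (simp add: S_def)
  have p_neq_0: "?p \<sigma> v \<noteq> 0" if \<sigma>: "\<sigma> \<in> ?A" and v: "v \<in> ?V" for \<sigma> v
  proof -
    obtain q t where "v = prod_encode (q, t)" "q \<in> {1..N}" "t \<in> {1..k q}" using v by (auto simp: strategy_vars_def)
    then show ?thesis using sol_neq_0[OF \<sigma>, of q t] by (simp add: solpt_encode)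
  qed
  have "\<forall>a\<in>S. a > 0" using \<epsilon>0 p_neq_0 by (auto simp: S_def)
  then have \<epsilon>: "\<epsilon> > 0" using finS by (simp add: \<epsilon>_def S_def)
  have \<epsilon>_le: "\<epsilon> \<le> a" if "a \<in> S" for a unfolding \<epsilon>_def using finS that by simp
  have le1: "\<epsilon> \<le> \<epsilon>0 \<sigma>" if "\<sigma> \<in> ?A" for \<sigma> by (rule \<epsilon>_le) (use that in \<open>simp add: S_def\<close>)
  have le2: "\<epsilon> \<le> norm (?p \<sigma> v) / 2" if "\<sigma> \<in> ?A" "v \<in> ?V" for \<sigma> v
    by (rule \<epsilon>_le) (use that in \<open>auto simp: S_def\<close>)
  have le3: "\<epsilon> \<le> dist (?p \<sigma> v) (?p \<sigma>' v) / 3" if "\<sigma> \<in> ?A" "\<sigma>' \<in> ?A" "v \<in> ?V" "?p \<sigma> v \<noteq> ?p \<sigma>' v" for \<sigma> \<sigma>' v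
  proof (rule \<epsilon>_le)
    have "dist (?p \<sigma> v) (?p \<sigma>' v) / 3 \<in> (\<lambda>(\<sigma>, \<sigma>', v). dist (?p \<sigma> v) (?p \<sigma>' v) / 3) ` (?A \<times> ?A \<times> ?V)"
      using that by (intro image_eqI[of _ _ "(\<sigma>, \<sigma>', v)"]) auto
    then show "dist (?p \<sigma> v) (?p \<sigma>' v) / 3 \<in> S" using that(4) by (simp add: S_def)
  qed
  have "\<forall>\<^sub>F n in sequentially. \<forall>\<sigma>\<in>?A. good \<sigma> \<epsilon> n"
    using \<epsilon>0 \<epsilon> le1 by (intro eventually_ball_finite fin(2)) blast
  moreover have "\<forall>\<^sub>F n in sequentially. \<forall>x. zero n x \<longrightarrow> (\<exists>\<sigma>\<in>?A. \<forall>v\<in>?V. dist (x v) (?p \<sigma> v) \<le> \<epsilon>)"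
    unfolding zero_def by (rule zeros_near_solpt[OF E u0 u \<epsilon>])
  ultimately show ?thesis
  proof eventually_elim
    case (elim n)
    have Z: "x \<in> sys_zeros N k E (u n) \<longleftrightarrow> x \<in> torus ?V \<and> zero n x" for x
      by (simp add: sys_zeros_def zero_def)
    have torus_near: "x \<in> near \<sigma> \<epsilon>" if "x \<in> torus ?V" "\<forall>v\<in>?V. dist (x v) (?p \<sigma> v) \<le> \<epsilon>" for x \<sigma>
      using that by (auto simp: near_def torus_def PiE_def extensional_def solpt_def)
    have near_torus: "x \<in> torus ?V" if \<sigma>: "\<sigma> \<in> ?A" and x: "x \<in> near \<sigma> \<epsilon>" for x \<sigma>
    proof -
      have "x v \<noteq> 0" if v: "v \<in> ?V" for v
      proof
        assume "x v = 0"
        then have "norm (?p \<sigma> v) \<le> \<epsilon>" using x v by (auto simp: near_def)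
        then have "norm (?p \<sigma> v) \<le> norm (?p \<sigma> v) / 2" using le2[OF \<sigma> v] by linarith
        then have "norm (?p \<sigma> v) \<le> 0" by linarith
        then show False using p_neq_0[OF \<sigma> v] by simp
      qed
      moreover have "x v = undefined" if "v \<notin> ?V" for v
        using x that by (simp add: near_def solpt_def)
      ultimately show ?thesis by (auto simp: torus_def PiE_def extensional_def)
    qed
    have "\<forall>\<sigma>\<in>?A. \<exists>x. x \<in> near \<sigma> \<epsilon> \<and> zero n x" using elim(1) by (auto simp: good_def)
    from bchoice[OF this] obtain \<psi> where \<psi>: "\<forall>\<sigma>\<in>?A. \<psi> \<sigma> \<in> near \<sigma> \<epsilon> \<and> zero n (\<psi> \<sigma>)" ..
    have sur: "\<exists>\<sigma>\<in>?A. x \<in> near \<sigma> \<epsilon>" if "x \<in> sys_zeros N k E (u n)" for x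
      using elim(2) that torus_near unfolding Z by blast
    have "inj_on \<psi> ?A"
    proof (rule inj_onI, rule ccontr)
      fix \<sigma> \<sigma>' assume \<sigma>: "\<sigma> \<in> ?A" "\<sigma>' \<in> ?A" "\<psi> \<sigma> = \<psi> \<sigma>'" "\<sigma> \<noteq> \<sigma>'"
      then have "?p \<sigma> \<noteq> ?p \<sigma>'" using solpt_inj[OF \<sigma>(1,2) _ E] by blast
      then obtain v where v: "?p \<sigma> v \<noteq> ?p \<sigma>' v" by blast
      then have vV: "v \<in> ?V" by (auto simp: solpt_def split: if_splits)
      have "dist (\<psi> \<sigma> v) (?p \<sigma> v) \<le> \<epsilon>" "dist (\<psi> \<sigma> v) (?p \<sigma>' v) \<le> \<epsilon>"
        using \<psi> \<sigma> vV unfolding near_def by auto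
      then have "dist (?p \<sigma> v) (?p \<sigma>' v) \<le> 2 * \<epsilon>"
        using dist_triangle3[of "?p \<sigma> v" "?p \<sigma>' v" "\<psi> \<sigma> v"] by simp
      then have "\<epsilon> \<le> 2 * \<epsilon> / 3" using le3[OF \<sigma>(1,2) vV v] by simp
      then show False using \<epsilon> by simp
    qed
    moreover have "\<psi> ` ?A = sys_zeros N k E (u n)"
    proof (intro equalityI subsetI)
      fix x assume "x \<in> \<psi> ` ?A"
      then show "x \<in> sys_zeros N k E (u n)" using \<psi> near_torus by (auto simp: Z)
    next
      fix x assume x: "x \<in> sys_zeros N k E (u n)"
      then obtain \<sigma> where \<sigma>: "\<sigma> \<in> ?A" "x \<in> near \<sigma> \<epsilon>" using sur by blast
      have "zero n x" using x by (simp add: Z)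
      moreover have "good \<sigma> \<epsilon> n" using elim(1) \<sigma>(1) by blast
      moreover have "\<psi> \<sigma> \<in> near \<sigma> \<epsilon>" "zero n (\<psi> \<sigma>)" using \<psi> \<sigma>(1) by auto
      ultimately have "x = \<psi> \<sigma>" using \<sigma>(2) unfolding good_def by blast
      then show "x \<in> \<psi> ` ?A" using \<sigma>(1) by blast
    qed
    ultimately have "bij_betw \<psi> ?A (sys_zeros N k E (u n))" by (simp add: bij_betw_def)
    moreover have "sysjac N k E (u n) x \<noteq> 0" if x: "x \<in> sys_zeros N k E (u n)" for x
    proof -
      obtain \<sigma> where \<sigma>: "\<sigma> \<in> ?A" "x \<in> near \<sigma> \<epsilon>" using sur[OF x] by blast
      then show ?thesis using elim(1) unfolding good_def by blast
    qed
    ultimately show ?case by blast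
  qed
qed

section \<open>Generic payoffs and the degree\<close>

text \<open>Complementation in \<open>Q\<close> turns the sum into the expansion of (1 - 1) to the
  power \<open>card (Q - A)\<close>.\<close>

lemma signed_sum_between:
  assumes "finite Q"
  shows "(\<Sum>R\<in>{R\<in>Pow Q. A \<subseteq> R}. (-1) ^ (card Q - card R)) = (if A = Q then 1 else (0::real))"
proof (cases "A \<subseteq> Q")
  case False
  then have "{R\<in>Pow Q. A \<subseteq> R} = {}" by auto
  then show ?thesis using False by (simp only: sum.empty) auto
next
  case True
  have "(\<Sum>R\<in>{R\<in>Pow Q. A \<subseteq> R}. (-1) ^ (card Q - card R)) = (\<Sum>S\<in>Pow (Q - A). (-1::real) ^ card S)"
  proof (rule sum.reindex_bij_witness[of _ "\<lambda>S. Q - S" "\<lambda>R. Q - R"])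
    fix R assume R: "R \<in> {R\<in>Pow Q. A \<subseteq> R}"
    then show "(-1::real) ^ card (Q - R) = (-1) ^ (card Q - card R)"
      using finite_subset[OF _ assms, of R] by (simp add: card_Diff_subset)
  qed (use True in auto)
  also have "\<dots> = (\<Prod>x\<in>Q - A. (-1) + 1)"
    by (subst prod_add) (use assms in simp_all)
  also have "\<dots> = (if A = Q then 1 else 0)"
    using True assms by auto
  finally show ?thesis .
qed

lemma exact_support_coeff_nonneg: "exact_support_coeff N k F \<ge> 0"
  unfolding exact_support_coeff_def factor_weight_def
  by (intro sum_nonneg prod_nonneg divide_nonneg_nonneg) auto

text \<open>\<open>D (E \<union> R)\<close> collects the \<open>\<mu> F\<close> with
  \<open>F - E \<subseteq> R\<close>. After the sums are exchanged, the signed sum over R retains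
  only the F with \<open>F - E = Q\<close>.\<close>

lemma set_difference_op_zeta:
  fixes D \<mu> :: "(nat \<times> nat) set \<Rightarrow> real"
  assumes D: "\<And>E. E \<subseteq> U \<Longrightarrow> D E = (\<Sum>F\<in>Pow E. \<mu> F)" and U: "finite U" "E \<subseteq> U" "Q \<subseteq> U"
    and disj: "E \<inter> Q = {}"
  shows "set_difference_op D Q E = (\<Sum>F\<in>{F. F \<subseteq> U \<and> F - E = Q}. \<mu> F)"
proof -
  have "D (E \<union> R) = (\<Sum>F\<in>Pow U. if F - E \<subseteq> R then \<mu> F else 0)" if "R \<in> Pow Q" for R
  proof -
    have "D (E \<union> R) = (\<Sum>F\<in>Pow (E \<union> R). \<mu> F)" using that U by (intro D) auto
    also have "\<dots> = (\<Sum>F\<in>Pow U. if F - E \<subseteq> R then \<mu> F else 0)"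
      using that U by (intro sum.mono_neutral_cong_left) auto
    finally show ?thesis .
  qed
  then have "set_difference_op D Q E = (\<Sum>R\<in>Pow Q. \<Sum>F\<in>Pow U. if F - E \<subseteq> R then (-1) ^ (card Q - card R) * \<mu> F else 0)"
    unfolding set_difference_op_def by (intro sum.cong) (auto simp: sum_distrib_left intro!: sum.cong)
  also have "\<dots> = (\<Sum>F\<in>Pow U. \<Sum>R\<in>Pow Q. if F - E \<subseteq> R then (-1) ^ (card Q - card R) * \<mu> F else 0)"
    by (rule sum.swap)
  also have "\<dots> = (\<Sum>F\<in>Pow U. \<mu> F * (\<Sum>R\<in>{R\<in>Pow Q. F - E \<subseteq> R}. (-1) ^ (card Q - card R)))"
  proof (intro sum.cong refl)
    fix F
    have "(\<Sum>R\<in>{R\<in>Pow Q. F - E \<subseteq> R}. (-1) ^ (card Q - card R) * \<mu> F)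
        = (\<Sum>R\<in>Pow Q. if F - E \<subseteq> R then (-1) ^ (card Q - card R) * \<mu> F else 0)"
      using finite_subset[OF U(3,1)] by (intro sum.inter_filter) simp
    then show "(\<Sum>R\<in>Pow Q. if F - E \<subseteq> R then (-1) ^ (card Q - card R) * \<mu> F else 0)
        = \<mu> F * (\<Sum>R\<in>{R\<in>Pow Q. F - E \<subseteq> R}. (-1) ^ (card Q - card R))"
      by (simp add: sum_distrib_left mult.commute)
  qed
  also have "\<dots> = (\<Sum>F\<in>Pow U. if F - E = Q then \<mu> F else 0)"
    using signed_sum_between[OF finite_subset[OF U(3,1)]] by (intro sum.cong refl) simp
  also have "\<dots> = (\<Sum>F\<in>{F\<in>Pow U. F - E = Q}. \<mu> F)"
    using U by (intro sum.inter_filter[symmetric]) simp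
  finally show ?thesis by (simp add: Pow_def)
qed

section \<open>Regularity of a payoff table as a constructible condition\<close>

lemma constructible_sysfun_zero: "constructible (\<lambda>w. sysfun k E e (join (\<lambda>p. w (Inl p)) (\<lambda>v. w (Inr (j, v)))) = 0)"
  by (intro constructible.zero polyfuns_comp[OF sysfun_polyfuns] polyfuns_join polyfuns.var)

text \<open>
  Points of the torus are \<open>undefined\<close> at all indices that are not variables of the system, and the
  unused coordinates of an environment have to take the same value.
\<close>

abbreviation zero_env ::
    "nat \<Rightarrow> (payoff_index \<Rightarrow> complex) \<Rightarrow> (nat \<Rightarrow> nat \<Rightarrow> complex) \<Rightarrow> payoff_index + nat \<times> nat \<Rightarrow> complex" where
  "zero_env m u x \<equiv> join u (\<lambda>(j, v). if j < m then x j v else undefined)"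

text \<open>The m points occupy the coordinates \<open>W\<close> of an enlarged environment,
  finitely many in number, so quantifying over torus zeros is eliminating finitely many
  coordinates.\<close>

lemma constructible_exists_zeros:
  assumes "constructible \<theta>"
  shows "constructible (\<lambda>u. \<exists>x. (\<forall>j<m. x j \<in> sys_zeros N k E u) \<and> \<theta> (zero_env m u x))"
proof -
  let ?V = "strategy_vars N k"
  define W :: "(payoff_index + nat \<times> nat) set" where "W = Inr ` ({..<m} \<times> ?V)"
  define \<psi> where "\<psi> w \<longleftrightarrow> (\<forall>j\<in>{..<m}. (\<forall>v\<in>?V. w (Inr (j, v)) \<noteq> 0) \<and>
      (\<forall>e\<in>?V. sysfun k E e (join (\<lambda>p. w (Inl p)) (\<lambda>v. w (Inr (j, v)))) = 0)) \<and> \<theta> w" for w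
  have "constructible \<psi>"
    unfolding \<psi>_def[abs_def]
    by (intro constructible_ball constructible.conj constructible_sysfun_zero constructible.nonzero polyfuns.var
        finite_strategy_vars finite_lessThan assms)
  then have "constructible (\<lambda>u. \<exists>w'. (\<forall>w. w \<notin> W \<longrightarrow> w' w = join u (\<lambda>_. undefined) w) \<and> \<psi> w')"
    by (intro constructible_comp[OF constructible_exs, where T = "\<lambda>u. join u (\<lambda>_. undefined)"] polyfuns_join polyfuns.var polyfuns.const)
      (simp_all add: W_def finite_strategy_vars)
  moreover have "(\<exists>w'. (\<forall>w. w \<notin> W \<longrightarrow> w' w = join u (\<lambda>_. undefined) w) \<and> \<psi> w') \<longleftrightarrow>
      (\<exists>x. (\<forall>j<m. x j \<in> sys_zeros N k E u) \<and> \<theta> (zero_env m u x))" for u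
  proof
    assume "\<exists>x. (\<forall>j<m. x j \<in> sys_zeros N k E u) \<and> \<theta> (zero_env m u x)"
    then obtain x where x: "\<forall>j<m. x j \<in> sys_zeros N k E u" "\<theta> (zero_env m u x)" by auto
    have undef: "x j v = undefined" if "j < m" "v \<notin> ?V" for j v
      using x(1) that by (simp add: sys_zeros_def torus_def PiE_def extensional_def)
    have "zero_env m u x w = join u (\<lambda>_. undefined) w" if w: "w \<notin> W" for w
    proof (cases w)
      case (Inr jv)
      obtain j v where jv: "jv = (j, v)" by fastforce
      have "\<not> (j < m \<and> v \<in> ?V)" using w by (auto simp: W_def Inr jv)
      then show ?thesis using undef[of j v] by (simp add: Inr jv)
    qed simp
    moreover have "\<psi> (zero_env m u x)"
      using x by (auto simp: \<psi>_def sys_zeros_def torus_def)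
    ultimately show "\<exists>w'. (\<forall>w. w \<notin> W \<longrightarrow> w' w = join u (\<lambda>_. undefined) w) \<and> \<psi> w'" by blast
  next
    assume "\<exists>w'. (\<forall>w. w \<notin> W \<longrightarrow> w' w = join u (\<lambda>_. undefined) w) \<and> \<psi> w'"
    then obtain w' where w': "\<forall>w. w \<notin> W \<longrightarrow> w' w = join u (\<lambda>_. undefined) w" and \<psi>: "\<psi> w'" by auto
    define x where "x = (\<lambda>j v. w' (Inr (j, v)))"
    have w'_u: "w' (Inl p) = u p" for p
      using w'[rule_format, of "Inl p"] by (auto simp: W_def)
    have undef: "x j v = undefined" if "\<not> (j < m \<and> v \<in> ?V)" for j v
      using w'[rule_format, of "Inr (j, v)"] that by (auto simp: W_def x_def)
    have "w' = zero_env m u x"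
      using w'_u undef by (auto simp: x_def split: sum.split)
    moreover have "(\<forall>j\<in>{..<m}. (\<forall>v\<in>?V. x j v \<noteq> 0) \<and> (\<forall>e\<in>?V. sysfun k E e (join u (x j)) = 0)) \<and> \<theta> w'"
      using \<psi> unfolding \<psi>_def w'_u x_def .
    ultimately have "\<forall>j<m. x j \<in> sys_zeros N k E u" "\<theta> (zero_env m u x)"
      using undef by (simp_all add: sys_zeros_def torus_def PiE_def extensional_def)
    then show "\<exists>x. (\<forall>j<m. x j \<in> sys_zeros N k E u) \<and> \<theta> (zero_env m u x)" by blast
  qed
  ultimately show ?thesis by simp
qed

text \<open>At least m zeros. The condition of having exactly M, including finiteness, becomes M but
  not \<open>Suc M\<close>, which quantifies over finitely many points only.\<close>

definition distinct_zeros :: "nat \<Rightarrow> (nat \<Rightarrow> nat) \<Rightarrow> (nat \<times> nat) set \<Rightarrow> nat \<Rightarrow> (payoff_index \<Rightarrow> complex) \<Rightarrow> bool" where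
  "distinct_zeros N k E m u \<longleftrightarrow> (\<exists>X. finite X \<and> card X = m \<and> X \<subseteq> sys_zeros N k E u)"

lemma constructible_distinct_zeros: "constructible (distinct_zeros N k E m)"
proof -
  let ?V = "strategy_vars N k" and ?Z = "sys_zeros N k E"
  define \<theta> where "\<theta> w \<longleftrightarrow> (\<forall>j\<in>{..<m}. \<forall>i\<in>{..<j}. \<exists>v\<in>?V. w (Inr (i, v)) - w (Inr (j, v)) \<noteq> 0)"
    for w :: "payoff_index + nat \<times> nat \<Rightarrow> complex"
  have "constructible \<theta>"
    unfolding \<theta>_def[abs_def]
    by (intro constructible_ball constructible_bex constructible.nonzero polyfuns_diff polyfuns.var finite_strategy_vars finite_lessThan)
  then have "constructible (\<lambda>u. \<exists>x. (\<forall>j<m. x j \<in> ?Z u) \<and> \<theta> (zero_env m u x))"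
    by (rule constructible_exists_zeros)
  moreover have "distinct_zeros N k E m u \<longleftrightarrow> (\<exists>x. (\<forall>j<m. x j \<in> ?Z u) \<and> \<theta> (zero_env m u x))" for u
  proof
    assume "distinct_zeros N k E m u"
    then obtain X where X: "finite X" "card X = m" "X \<subseteq> ?Z u" by (auto simp: distinct_zeros_def)
    from ex_bij_betw_nat_finite[OF X(1)] obtain x where x: "bij_betw x {0..<card X} X" ..
    have xZ: "x j \<in> ?Z u" if "j < m" for j using x X that by (auto simp: bij_betw_def)
    have "\<exists>v\<in>?V. x i v - x j v \<noteq> 0" if "i < j" "j < m" for i j
    proof -
      have "x i \<noteq> x j" using inj_onD[OF bij_betw_imp_inj_on[OF x], of i j] that X(2) by auto
      moreover have "x i \<in> extensional ?V" "x j \<in> extensional ?V"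
        using xZ[of i] xZ[of j] that by (simp_all add: sys_zeros_def torus_def PiE_def)
      ultimately show ?thesis using extensionalityI[of "x i" ?V "x j"] by auto
    qed
    then have "\<theta> (zero_env m u x)" by (simp add: \<theta>_def)
    then show "\<exists>x. (\<forall>j<m. x j \<in> ?Z u) \<and> \<theta> (zero_env m u x)" using xZ by blast
  next
    assume "\<exists>x. (\<forall>j<m. x j \<in> ?Z u) \<and> \<theta> (zero_env m u x)"
    then obtain x where x: "\<forall>j<m. x j \<in> ?Z u" "\<theta> (zero_env m u x)" by auto
    have "x i \<noteq> x j" if "i < j" "j < m" for i j
    proof -
      have "\<exists>v\<in>?V. x i v - x j v \<noteq> 0" using x(2) that by (simp add: \<theta>_def)
      then show ?thesis by auto
    qed
    then have "inj_on x {..<m}"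
      by (intro inj_onI) (metis lessThan_iff linorder_neqE_nat)
    then show "distinct_zeros N k E m u"
      unfolding distinct_zeros_def using x(1)
      by (intro exI[of _ "x ` {..<m}"]) (auto simp: card_image)
  qed
  then have "distinct_zeros N k E m = (\<lambda>u. \<exists>x. (\<forall>j<m. x j \<in> ?Z u) \<and> \<theta> (zero_env m u x))" by (rule ext)
  ultimately show ?thesis by simp
qed

lemma constructible_degenerate_zero: "constructible (\<lambda>u. \<exists>x\<in>sys_zeros N k E u. sysjac N k E u x = 0)"
proof -
  have "constructible (\<lambda>w. sysjac N k E (\<lambda>p. w (Inl p)) (\<lambda>v. w (Inr (0, v))) = 0)"
    unfolding sysjac_def
    by (intro constructible.zero polyfuns.var finite_strategy_vars fdet_polyfuns partial_polyfuns sysfun_polyfuns)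
  from constructible_exists_zeros[OF this, of 1 N k E]
  have "constructible (\<lambda>u. \<exists>x. x 0 \<in> sys_zeros N k E u \<and> sysjac N k E u (x (0::nat)) = 0)" by simp
  moreover have "(\<exists>x. x 0 \<in> sys_zeros N k E u \<and> sysjac N k E u (x (0::nat)) = 0) \<longleftrightarrow>
      (\<exists>x\<in>sys_zeros N k E u. sysjac N k E u x = 0)" for u
  proof
    assume "\<exists>x\<in>sys_zeros N k E u. sysjac N k E u x = 0"
    then obtain x where "x \<in> sys_zeros N k E u" "sysjac N k E u x = 0" by auto
    then show "\<exists>x. x 0 \<in> sys_zeros N k E u \<and> sysjac N k E u (x (0::nat)) = 0"
      by (intro exI[of _ "\<lambda>_. x"]) simp
  qed auto
  ultimately show ?thesis by simp
qed

definition regular_payoff :: "nat \<Rightarrow> (nat \<Rightarrow> nat) \<Rightarrow> (nat \<times> nat) set \<Rightarrow> (payoff_index \<Rightarrow> complex) \<Rightarrow> bool" where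
  "regular_payoff N k E u \<longleftrightarrow> finite (sys_zeros N k E u) \<and> card (sys_zeros N k E u) = card (assignments N k E) \<and>
     (\<forall>x\<in>sys_zeros N k E u. sysjac N k E u x \<noteq> 0)"

lemma constructible_regular_payoff: "constructible (regular_payoff N k E)"
proof -
  define M where "M = card (assignments N k E)"
  have "regular_payoff N k E u \<longleftrightarrow> distinct_zeros N k E M u \<and> \<not> distinct_zeros N k E (Suc M) u \<and> \<not> (\<exists>x\<in>sys_zeros N k E u. sysjac N k E u x = 0)" for u
  proof -
    let ?Z = "sys_zeros N k E u"
    have "finite ?Z \<and> card ?Z = M \<longleftrightarrow> distinct_zeros N k E M u \<and> \<not> distinct_zeros N k E (Suc M) u"
    proof
      assume Z: "finite ?Z \<and> card ?Z = M"
      have "distinct_zeros N k E M u" unfolding distinct_zeros_def using Z by (intro exI[of _ ?Z]) simp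
      moreover have "\<not> distinct_zeros N k E (Suc M) u"
      proof
        assume "distinct_zeros N k E (Suc M) u"
        then obtain X where "card X = Suc M" "X \<subseteq> ?Z" unfolding distinct_zeros_def by blast
        then show False using card_mono[of ?Z X] Z by simp
      qed
      ultimately show "distinct_zeros N k E M u \<and> \<not> distinct_zeros N k E (Suc M) u" by blast
    next
      assume D: "distinct_zeros N k E M u \<and> \<not> distinct_zeros N k E (Suc M) u"
      have fin: "finite ?Z"
      proof (rule ccontr)
        assume "infinite ?Z"
        from infinite_arbitrarily_large[OF this, of "Suc M"] show False
          using D unfolding distinct_zeros_def by blast
      qed
      have "\<not> Suc M \<le> card ?Z"
      proof
        assume "Suc M \<le> card ?Z"
        from obtain_subset_with_card_n[OF this] obtain X where "X \<subseteq> ?Z" "card X = Suc M" "finite X" by metis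
        then show False using D unfolding distinct_zeros_def by blast
      qed
      moreover have "M \<le> card ?Z" using D card_mono[OF fin] unfolding distinct_zeros_def by blast
      ultimately show "finite ?Z \<and> card ?Z = M" using fin by simp
    qed
    then show ?thesis unfolding regular_payoff_def M_def by blast
  qed
  then have "regular_payoff N k E = (\<lambda>u. distinct_zeros N k E M u \<and> \<not> distinct_zeros N k E (Suc M) u \<and> \<not> (\<exists>x\<in>sys_zeros N k E u. sysjac N k E u x = 0))"
    by (rule ext)
  moreover have "constructible (\<lambda>u. distinct_zeros N k E M u \<and> \<not> distinct_zeros N k E (Suc M) u \<and> \<not> (\<exists>x\<in>sys_zeros N k E u. sysjac N k E u x = 0))"
    by (rule constructible.conj[OF constructible_distinct_zeros constructible.conj[OF constructible_not[OF constructible_distinct_zeros] constructible_not[OF constructible_degenerate_zero]]])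
  ultimately show ?thesis by simp
qed

section \<open>From constructible to generic conditions\<close>

lemma holds_genericallyI:
  assumes g: "g \<in> polyfuns" "u0 \<in> affine_space V" "g u0 \<noteq> 0" "\<And>u. u \<in> affine_space V \<Longrightarrow> g u \<noteq> 0 \<Longrightarrow> Pr u"
  shows "holds_generically V Pr"
proof -
  obtain P where P: "P \<in> cpolys V" "\<forall>x\<in>affine_space V. cpeval P x = g x" using polyfuns_cpoly[OF g(1), of V] by blast
  define U where "U = affine_space V - {x. \<forall>P\<in>{P}. cpeval P x = 0}"
  have "zariski_open V U" unfolding zariski_open_def U_def using P(1) by (intro exI[of _ "{P}"]) simp
  moreover have "u0 \<in> U" using P(2) g(2,3) by (simp add: U_def)
  moreover have "Pr u" if "u \<in> U" for u using that P(2) g(4) by (auto simp: U_def)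
  ultimately show ?thesis unfolding holds_generically_def by blast
qed

lemma holds_genericallyD:
  assumes "holds_generically V Pr"
  shows "\<exists>g u0. g \<in> polyfuns \<and> u0 \<in> affine_space V \<and> g u0 \<noteq> 0 \<and> (\<forall>u\<in>affine_space V. g u \<noteq> 0 \<longrightarrow> Pr u)"
proof -
  obtain U I where U: "U = affine_space V - {x. \<forall>P\<in>I. cpeval P x = 0}" "U \<noteq> {}" "\<forall>u\<in>U. Pr u"
    using assms unfolding holds_generically_def zariski_open_def by blast
  then obtain u0 where u0: "u0 \<in> U" by blast
  then obtain P where P: "P \<in> I" "cpeval P u0 \<noteq> 0" using U(1) by blast
  have "Pr u" if "u \<in> affine_space V" "cpeval P u \<noteq> 0" for u
    using that P(1) U(1,3) by blast
  then show ?thesis using cpeval_polyfuns[of P] P(2) u0 U(1) by (intro exI[of _ "\<lambda>x. cpeval P x"] exI[of _ u0]) auto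
qed

text \<open>Irreducibility, transferred to \<open>affine_space V\<close> by the map
  \<open>T\<close>, which is polynomial in each coordinate and fixes that space. It makes the
  generic number of zeros unique.\<close>

lemma holds_generically_both:
  assumes "holds_generically V Pr" "holds_generically V Qr"
  shows "\<exists>u. Pr u \<and> Qr u"
proof -
  from holds_genericallyD[OF assms(1)] obtain g a where g: "g \<in> polyfuns" "a \<in> affine_space V" "g a \<noteq> 0"
    "\<forall>u\<in>affine_space V. g u \<noteq> 0 \<longrightarrow> Pr u" by (elim exE conjE)
  from holds_genericallyD[OF assms(2)] obtain h b where h: "h \<in> polyfuns" "b \<in> affine_space V" "h b \<noteq> 0"
    "\<forall>u\<in>affine_space V. h u \<noteq> 0 \<longrightarrow> Qr u" by (elim exE conjE)
  define T where "T u = (\<lambda>w. if w \<in> V then u w else undefined)" for u :: "'a \<Rightarrow> complex"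
  have T: "T u \<in> affine_space V" for u by (auto simp: T_def affine_space_def PiE_def extensional_def)
  have T_id: "T u = u" if "u \<in> affine_space V" for u
    using that by (auto simp: T_def affine_space_def PiE_def extensional_def)
  have "(\<lambda>u. T u w) \<in> polyfuns" for w
    unfolding T_def by (intro polyfuns_if polyfuns.var polyfuns.const)
  then have "(\<lambda>u. g (T u)) \<in> polyfuns" and "(\<lambda>u. h (T u)) \<in> polyfuns"
    by (rule polyfuns_comp[OF g(1)], rule polyfuns_comp[OF h(1)])
  from polyfuns_common_nonzero[of "\<lambda>u. g (T u)" "\<lambda>u. h (T u)" a b, OF this] obtain c where "g (T c) \<noteq> 0" "h (T c) \<noteq> 0"
    using g(2,3) h(2,3) by (auto simp: T_id)
  then show ?thesis using g(4) h(4) T by blast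
qed

text \<open>By the dichotomy one common value of regularity holds wherever \<open>g\<close> is
  nonzero. The points \<open>u n\<close> tend to the special payoffs on the line from
  \<open>b\<close>, so for late n they are regular; \<open>g\<close> has finitely many zeros on that
  line, so for late n it is nonzero there too.\<close>

lemma generically_regular_payoff:
  assumes E: "E \<subseteq> arcs N"
  shows "holds_generically (payoff_indices N k E) (regular_payoff N k E)"
proof -
  let ?I = "payoff_indices N k E"
  define T where "T u = (\<lambda>w. if w \<in> ?I then u w else undefined)" for u :: "payoff_index \<Rightarrow> complex"
  have T: "T u \<in> affine_space ?I" for u by (auto simp: T_def affine_space_def PiE_def extensional_def)
  have T_id: "T u = u" if "u \<in> affine_space ?I" for u
    using that by (auto simp: T_def affine_space_def PiE_def extensional_def)
  have "constructible (\<lambda>u. regular_payoff N k E (T u))"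
    by (rule constructible_comp[OF constructible_regular_payoff]) (simp only: T_def, intro polyfuns_if polyfuns.var polyfuns.const)
  from constructible_dichotomy[OF this] obtain g where g: "g \<in> polyfuns" "\<exists>e. g e \<noteq> 0"
    "(\<forall>u. g u \<noteq> 0 \<longrightarrow> regular_payoff N k E (T u)) \<or> (\<forall>u. g u \<noteq> 0 \<longrightarrow> \<not> regular_payoff N k E (T u))" by auto
  from g(2) obtain b where b: "g b \<noteq> 0" ..
  let ?s = "special_payoff E"
  define u where "u n = (\<lambda>w. ?s w + inverse (of_nat (Suc n)) * (b w - ?s w))" for n :: nat
  have lim0: "(\<lambda>n. inverse (of_nat (Suc n)) :: complex) \<longlonglongrightarrow> 0"
    by (rule LIMSEQ_Suc[OF lim_inverse_n])
  have u_lim: "(\<lambda>n. u n w) \<longlonglongrightarrow> ?s w" for w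
  proof -
    have "(\<lambda>n. u n w) \<longlonglongrightarrow> ?s w + 0 * (b w - ?s w)"
      unfolding u_def by (intro tendsto_intros lim0)
    then show ?thesis by simp
  qed
  have "(\<lambda>n. T (u n) w) \<longlonglongrightarrow> T ?s w" for w
    using u_lim by (auto simp: T_def)
  then have "\<forall>\<^sub>F n in sequentially. (\<exists>\<psi>. bij_betw \<psi> (assignments N k E) (sys_zeros N k E (T (u n)))) \<and>
    (\<forall>x\<in>sys_zeros N k E (T (u n)). sysjac N k E (T (u n)) x \<noteq> 0)"
    by (intro zeros_near_special[OF E, of k "T ?s"]) (simp_all add: T_def)
  then have reg: "\<forall>\<^sub>F n in sequentially. regular_payoff N k E (T (u n))"
  proof (rule eventually_mono, elim conjE exE)
    fix n \<psi> assume "bij_betw \<psi> (assignments N k E) (sys_zeros N k E (T (u n)))"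
      and nondeg: "\<forall>x\<in>sys_zeros N k E (T (u n)). sysjac N k E (T (u n)) x \<noteq> 0"
    then have "finite (sys_zeros N k E (T (u n)))" "card (sys_zeros N k E (T (u n))) = card (assignments N k E)"
      using bij_betw_finite bij_betw_same_card finite_assignments[OF E] by metis+
    then show "regular_payoff N k E (T (u n))" using nondeg unfolding regular_payoff_def by blast
  qed
  have nz: "\<forall>\<^sub>F n in sequentially. g (u n) \<noteq> 0"
  proof -
    obtain P where P: "\<forall>z. poly P z = g (\<lambda>w. ?s w + z * (b w - ?s w))" using polyfuns_line[OF g(1), of ?s "\<lambda>w. b w - ?s w"] by blast
    have "poly P 1 \<noteq> 0" using b P by simp
    then have "P \<noteq> 0" by auto
    then have fin: "finite {z. poly P z = 0}" by (rule poly_roots_finite)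
    have "inj (\<lambda>n. inverse (of_nat (Suc n)) :: complex)" by (rule injI) (simp del: of_nat_Suc)
    then have "finite ((\<lambda>n. inverse (of_nat (Suc n)) :: complex) -` {z. poly P z = 0})"
      by (intro finite_vimageI fin)
    then have "finite {n. \<not> g (u n) \<noteq> 0}" unfolding vimage_def by (simp add: P u_def del: of_nat_Suc)
    then show ?thesis using MOST_iff_cofinite cofinite_eq_sequentially unfolding eventually_cofinite[symmetric] by metis
  qed
  have "\<exists>n. regular_payoff N k E (T (u n)) \<and> g (u n) \<noteq> 0"
    using eventually_conj[OF reg nz] by (auto simp: eventually_sequentially)
  then have g3: "regular_payoff N k E (T u)" if "g u \<noteq> 0" for u using g(3) that by blast
  \<comment> \<open>\<open>g\<close> may also depend on coordinates that are no payoff indices;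
    these are frozen at the values of \<open>b\<close>, so that \<open>g\<close> stays nonzero
    somewhere on the affine space.\<close>
  define Ov where "Ov u = (\<lambda>w. if w \<in> ?I then u w else b w)" for u :: "payoff_index \<Rightarrow> complex"
  show ?thesis
  proof (rule holds_genericallyI[of "\<lambda>u. g (Ov u)" "T b"])
    show "(\<lambda>u. g (Ov u)) \<in> polyfuns"
      by (rule polyfuns_comp[OF g(1)]) (simp only: Ov_def, intro polyfuns_if polyfuns.var polyfuns.const)
    have "Ov (T b) = b" by (auto simp: Ov_def T_def)
    then show "g (Ov (T b)) \<noteq> 0" using b by simp
    fix u assume u: "u \<in> affine_space ?I" "g (Ov u) \<noteq> 0"
    have "T (Ov u) = T u" by (auto simp: Ov_def T_def)
    then show "regular_payoff N k E u" using g3[OF u(2)] T_id[OF u(1)] by simp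
  qed (rule T)
qed

section \<open>The degree at regular payoffs\<close>

lemma isolated_in_finite:
  fixes S :: "'a::t1_space set"
  assumes "finite S"
  shows "{x. x isolated_in S} = S"
proof (intro equalityI subsetI)
  fix x assume "x \<in> S"
  moreover have "open (- (S - {x}))" using assms by (intro open_Compl finite_imp_closed) simp
  ultimately show "x \<in> {x. x isolated_in S}" unfolding isolated_in_def by auto
qed (auto simp: isolated_in_def)

lemma indifference_system_image:
  "indifference_system N k E u
    = (\<lambda>e. indifference_poly k E u (fst (prod_decode e)) (snd (prod_decode e))) ` strategy_vars N k"
  by (auto simp: indifference_system_def strategy_vars_def image_iff) (metis fst_conv prod_encode_inverse snd_conv)+

lemma indifference_poly_cpolys:
  assumes "E \<subseteq> arcs N"
  shows "indifference_poly k E u i s \<in> cpolys (strategy_vars N k)"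
  unfolding indifference_poly_def
proof (intro cpolys_sum cpolys_mult cpolys_cconst cpolys_prod)
  fix \<alpha> q assume "\<alpha> \<in> profiles k E i" "q \<in> in_nbrs E i"
  then have "\<alpha> q \<le> k q" "q \<in> {1..N}" using in_nbrs_subset[OF assms, of i] unfolding profiles_def by fastforce+
  then show "strategy_prob k q (\<alpha> q) \<in> cpolys (strategy_vars N k)"
    unfolding strategy_prob_def
    by (auto intro!: cpolys_diff cpolys_1 cpolys_sum cpolys_cvar simp: strategy_vars_def)
qed

text \<open>Points of a finite zero set are isolated and nondegenerate ones have multiplicity one,
  so the sum of multiplicities is the number of zeros.\<close>

lemma regular_payoff_degree:
  assumes E: "E \<subseteq> arcs N" and u: "regular_payoff N k E u"
  defines "V \<equiv> strategy_vars N k" and "F \<equiv> indifference_system N k E u"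
  shows "finite (isolated_torus_zeros V F) \<and>
    (\<Sum>p \<in> isolated_torus_zeros V F. multiplicity_at V F p) = enat (card (assignments N k E))"
proof -
  define f where "f e = indifference_poly k E u (fst (prod_decode e)) (snd (prod_decode e))" for e
  have F: "F = f ` V" unfolding F_def V_def f_def indifference_system_image ..
  have f_eval: "cpeval (f e) x = sysfun k E e (join u x)" for e x
    by (simp add: f_def cpeval_indifference_poly sysfun_join)
  have zeros: "torus_zeros V F = sys_zeros N k E u"
    by (auto simp: torus_zeros_def sys_zeros_def F f_eval V_def)
  have fin: "finite (sys_zeros N k E u)" and card: "card (sys_zeros N k E u) = card (assignments N k E)"
    and nondeg: "\<And>x. x \<in> sys_zeros N k E u \<Longrightarrow> sysjac N k E u x \<noteq> 0"
    using u by (auto simp: regular_payoff_def V_def)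
  have iso: "isolated_torus_zeros V F = sys_zeros N k E u"
    unfolding isolated_torus_zeros_def zeros by (rule isolated_in_finite[OF fin])
  have "multiplicity_at V F p = 1" if p: "p \<in> sys_zeros N k E u" for p
  proof (rule multiplicity_at_nondegenerate[of V F f])
    show "finite V" "finite F" by (simp_all add: V_def F finite_strategy_vars)
    show "g \<in> cpolys V" if "g \<in> F" for g
      using that indifference_poly_cpolys[OF E] by (auto simp: F f_def V_def)
    show "cpeval g p = 0" if "g \<in> F" for g
      using that p by (auto simp: F f_eval sys_zeros_def V_def)
    show "fdet V (\<lambda>e v. deriv (\<lambda>z. cpeval (f e) (p(v := z))) (p v)) \<noteq> 0"
      using nondeg[OF p] by (simp add: sysjac_def partial_def f_eval V_def)
  qed (simp add: F)
  then have "(\<Sum>p \<in> sys_zeros N k E u. multiplicity_at V F p) = of_nat (card (sys_zeros N k E u))" by simp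
  then show ?thesis using fin by (simp add: iso card of_nat_eq_enat)
qed

text \<open>Regular payoffs show that this value is generic; any other generic value would be
  attained at some regular payoff table too, where the count is already known.\<close>

lemma algebraic_degree_eq_card:
  assumes E: "E \<subseteq> arcs N"
  shows "algebraic_degree N k E = card (assignments N k E)"
  unfolding algebraic_degree_def
proof (rule the_equality)
  let ?P = "\<lambda>n u. let V = strategy_vars N k; F = indifference_system N k E u
     in finite (isolated_torus_zeros V F) \<and> (\<Sum>p \<in> isolated_torus_zeros V F. multiplicity_at V F p) = enat n"
  have mono: "?P (card (assignments N k E)) u" if "regular_payoff N k E u" for u
    using regular_payoff_degree[OF E that] by (simp add: Let_def)
  show "holds_generically (payoff_indices N k E) (?P (card (assignments N k E)))"
    using generically_regular_payoff[OF E, of k] mono unfolding holds_generically_def by blast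
  fix n assume "holds_generically (payoff_indices N k E) (?P n)"
  from holds_generically_both[OF this generically_regular_payoff[OF E]]
  obtain u where u: "?P n u" "regular_payoff N k E u" by blast
  then show "n = card (assignments N k E)" using regular_payoff_degree[OF E u(2)] by (simp add: Let_def)
qed

theorem proposition5p2:
  fixes N :: nat and k :: "nat \<Rightarrow> nat"
  assumes "N \<ge> 2"
    and "\<forall>i\<in>{1..N}. k i > 0"
  shows "(\<forall>E. E \<subseteq> arcs N \<longrightarrow>
            real (algebraic_degree N k E) = (\<Sum>F\<in>Pow E. exact_support_coeff N k F))
       \<and> (\<forall>F. F \<subseteq> arcs N \<longrightarrow>
            exact_support_coeff N k F =
              (\<Sum>E\<in>Pow F. (-1) ^ (card F - card E) * real (algebraic_degree N k E))
            \<and> (\<Sum>E\<in>Pow F. (-1) ^ (card F - card E) * real (algebraic_degree N k E)) \<ge> 0)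
       \<and> (\<forall>E Q. E \<subseteq> arcs N \<longrightarrow> Q \<subseteq> arcs N \<longrightarrow> E \<inter> Q = {} \<longrightarrow>
            set_difference_op (\<lambda>R. real (algebraic_degree N k R)) Q E =
              (\<Sum>F\<in>{F. F \<subseteq> arcs N \<and> F - E = Q}. exact_support_coeff N k F)
            \<and> (\<Sum>F\<in>{F. F \<subseteq> arcs N \<and> F - E = Q}. exact_support_coeff N k F) \<ge> 0)"
proof -
  let ?D = "\<lambda>E. real (algebraic_degree N k E)" and ?\<mu> = "exact_support_coeff N k"
  have D: "?D E = (\<Sum>F\<in>Pow E. ?\<mu> F)" if "E \<subseteq> arcs N" for E
    using card_assignments[OF that] algebraic_degree_eq_card[OF that] by simp
  have diff: "set_difference_op ?D Q E = (\<Sum>F\<in>{F. F \<subseteq> arcs N \<and> F - E = Q}. ?\<mu> F)"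
    if "E \<subseteq> arcs N" "Q \<subseteq> arcs N" "E \<inter> Q = {}" for E Q
    using D finite_arcs that by (intro set_difference_op_zeta)
  \<comment> \<open>The difference formula over the empty arc set, where only F itself remains on
    the right.\<close>
  have moebius: "?\<mu> F = (\<Sum>E\<in>Pow F. (-1) ^ (card F - card E) * ?D E)" if F: "F \<subseteq> arcs N" for F
  proof -
    have "{G. G \<subseteq> arcs N \<and> G - {} = F} = {F}" using F by auto
    then show ?thesis using diff[of "{}" F] F by (simp add: set_difference_op_def)
  qed
  show ?thesis
    using D diff moebius exact_support_coeff_nonneg by (metis (no_types, lifting) sum_nonneg)
qed

end
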